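(* Let $k$ be a field. Assume that two finite dimensional $k$-algebras $\Lambda$ and $\Gamma$ are singularly equivalent of Morita type with level. If $\Lambda$ is eventually periodic, then so is $\Gamma$. In particular, the periods of their periodic syzygies coincide (that is, the common period of the periodic syzygies $\Omega_{\Lambda^{\rm e}}^{n}(\Lambda)$ equals the common period of the periodic syzygies $\Omega_{\Gamma^{\rm e}}^{m}(\Gamma)$).
   Context: Algebras are associative and unital; modules are left modules. For a $k$-algebra $\Lambda$, $\Lambda^{\rm e}=\Lambda\otimes_k\Lambda^{\rm op}$; $\Lambda^{\rm e}$-modules are identified with $\Lambda$-bimodules on which $k$ acts centrally. Eventual periodicity: for a finitely generated module $X$ over a left artin ring $R$, the syzygy $\Omega_R(X)$ is the kernel of a projective cover of $X$, $\Omega_R^0(X)=X$, $\Omega_R^{i+1}(X)=\Omega_R(\Omega_R^i(X))$. $X$ is periodic if $\Omega_R^p(X)\cong X$ for some $p>0$; the least such $p$ is the period of $X$. $X$ is eventually periodic if $\Omega_R^n(X)$ is non-zero and periodic for some $n\ge 0$; all periodic syzygies of an eventually periodic module have the same period. A finite dimensional $k$-algebra $\Lambda$ is eventually periodic if it is eventually periodic as a $\Lambda^{\rm e}$-module. The stable category $R\text{-}\underline{\mathrm{mod}}$ has the finitely generated $R$-modules as objects, and its morphisms are $R$-homomorphisms modulo those factoring through a projective module. Singular equivalence of Morita type with level: let $l\ge 0$ be an integer and let ${}_\Lambda M_\Gamma$, ${}_\Gamma N_\Lambda$ be bimodules. The pair $(M,N)$ defines a singular equivalence of Morita type with level $l$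 if (a) the one-sided modules ${}_\Lambda M$, $M_\Gamma$, ${}_\Gamma N$, $N_\Lambda$ are finitely generated and projective, and (b) $M\otimes_\Gamma N\cong\Omega^l_{\Lambda^{\rm e}}(\Lambda)$ in $\Lambda^{\rm e}\text{-}\underline{\mathrm{mod}}$ and $N\otimes_\Lambda M\cong\Omega^l_{\Gamma^{\rm e}}(\Gamma)$ in $\Gamma^{\rm e}\text{-}\underline{\mathrm{mod}}$. $\Lambda$ and $\Gamma$ are singularly equivalent of Morita type with level if such a pair exists for some $l\ge 0$. *)

theory Defs
  imports "HOL-Algebra.Module" "HOL-Algebra.AbelCoset" "HOL-Algebra.Generated_Groups" "HOL-Algebra.Free_Abelian_Groups"
begin

section \<open>Left modules over a ring\<close>

text \<open>The library locale \<^locale>\<open>module\<close> is restricted to commutative base rings. The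
  multiplicative fields that a \<^typ>\<open>('r, 'm) module\<close> record inherits from rings are ignored for
  modules.\<close>

locale left_module = R?: ring R + M?: abelian_group M for R (structure) and M (structure) +
  assumes smult_closed [simp, intro]:
      "\<lbrakk> a \<in> carrier R; x \<in> carrier M \<rbrakk> \<Longrightarrow> a \<odot>\<^bsub>M\<^esub> x \<in> carrier M"
    and smult_l_distr:
      "\<lbrakk> a \<in> carrier R; b \<in> carrier R; x \<in> carrier M \<rbrakk> \<Longrightarrow>
        (a \<oplus> b) \<odot>\<^bsub>M\<^esub> x = a \<odot>\<^bsub>M\<^esub> x \<oplus>\<^bsub>M\<^esub> b \<odot>\<^bsub>M\<^esub> x"
    and smult_r_distr:
      "\<lbrakk> a \<in> carrier R; x \<in> carrier M; y \<in> carrier M \<rbrakk> \<Longrightarrow>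
        a \<odot>\<^bsub>M\<^esub> (x \<oplus>\<^bsub>M\<^esub> y) = a \<odot>\<^bsub>M\<^esub> x \<oplus>\<^bsub>M\<^esub> a \<odot>\<^bsub>M\<^esub> y"
    and smult_assoc1:
      "\<lbrakk> a \<in> carrier R; b \<in> carrier R; x \<in> carrier M \<rbrakk> \<Longrightarrow>
        (a \<otimes> b) \<odot>\<^bsub>M\<^esub> x = a \<odot>\<^bsub>M\<^esub> (b \<odot>\<^bsub>M\<^esub> x)"
    and smult_one [simp]: "x \<in> carrier M \<Longrightarrow> \<one> \<odot>\<^bsub>M\<^esub> x = x"

definition fin_gen :: "('r, 'u) ring_scheme \<Rightarrow> ('r, 'm, 'v) module_scheme \<Rightarrow> bool" where
  "fin_gen R M \<longleftrightarrow> left_module R M \<and>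
     (\<exists>S. finite S \<and> S \<subseteq> carrier M \<and> (\<forall>H. submodule H R M \<and> S \<subseteq> H \<longrightarrow> H = carrier M))"

definition additive_maps :: "('a, 'u) ring_scheme \<Rightarrow> ('b, 'v) ring_scheme \<Rightarrow> ('a \<Rightarrow> 'b) set" where
  "additive_maps G H = {f \<in> carrier G \<rightarrow> carrier H.
     \<forall>x\<in>carrier G. \<forall>y\<in>carrier G. f (x \<oplus>\<^bsub>G\<^esub> y) = f x \<oplus>\<^bsub>H\<^esub> f y}"

definition mod_hom ::
  "('r, 'u) ring_scheme \<Rightarrow> ('r, 'm, 'v) module_scheme \<Rightarrow> ('r, 'n, 'w) module_scheme \<Rightarrow> ('m \<Rightarrow> 'n) set"
  where
  "mod_hom R M N = {f \<in> additive_maps M N.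
     \<forall>a\<in>carrier R. \<forall>x\<in>carrier M. f (a \<odot>\<^bsub>M\<^esub> x) = a \<odot>\<^bsub>N\<^esub> f x}"

definition mod_iso ::
  "('r, 'u) ring_scheme \<Rightarrow> ('r, 'm, 'v) module_scheme \<Rightarrow> ('r, 'n, 'w) module_scheme \<Rightarrow> bool" where
  "mod_iso R M N \<longleftrightarrow> left_module R M \<and> left_module R N \<and>
     (\<exists>f\<in>mod_hom R M N. bij_betw f (carrier M) (carrier N))"

text \<open>The lifting property of projective modules. The test modules in a definition have to live on
  fixed types; the types below suffice, since the free module on the carrier of \<open>P\<close> lives on
  \<^typ>\<open>'p \<Rightarrow> 'r\<close> and the lifting property against its canonical surjection onto \<open>P\<close> already
  exhibits \<open>P\<close> as a direct summand of a free module. Lemma \<open>projective_lift\<close> below proves the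
  lifting property against modules of arbitrary types.\<close>

definition projective :: "('r, 'u) ring_scheme \<Rightarrow> ('r, 'p, 'v) module_scheme \<Rightarrow> bool" where
  "projective R P \<longleftrightarrow> left_module R P \<and>
     (\<forall>(B :: ('r, 'p \<Rightarrow> 'r) module) (C :: ('r, 'p) module) g h.
        left_module R B \<and> left_module R C \<and> g \<in> mod_hom R B C \<and> g ` carrier B = carrier C \<and>
        h \<in> mod_hom R P C \<longrightarrow>
        (\<exists>h'\<in>mod_hom R P B. \<forall>x\<in>carrier P. g (h' x) = h x))"

section \<open>Syzygies and eventual periodicity\<close>

definition mod_kernel ::
  "('r, 'm, 'v) module_scheme \<Rightarrow> ('r, 'n, 'w) module_scheme \<Rightarrow> ('m \<Rightarrow> 'n) \<Rightarrow> ('r, 'm, 'v) module_scheme"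
  where
  "mod_kernel M N f = M\<lparr>carrier := {x \<in> carrier M. f x = \<zero>\<^bsub>N\<^esub>}\<rparr>"

text \<open>A projective cover is a surjection from a projective module with superfluous kernel.\<close>

definition projective_cover ::
  "('r, 'u) ring_scheme \<Rightarrow> ('r, 'p, 'v) module_scheme \<Rightarrow> ('r, 'm, 'w) module_scheme \<Rightarrow> ('p \<Rightarrow> 'm) \<Rightarrow> bool"
  where
  "projective_cover R P X f \<longleftrightarrow> projective R P \<and> left_module R X \<and>
     f \<in> mod_hom R P X \<and> f ` carrier P = carrier X \<and>
     (\<forall>H. submodule H R P \<and> H <+>\<^bsub>P\<^esub> carrier (mod_kernel P X f) = carrier P \<longrightarrow> H = carrier P)"

text \<open>Syzygies are only determined up to isomorphism, so they are rendered as relations closed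
  under isomorphism. Up to isomorphism, every finitely generated \<open>R\<close>-module is carried by a subset
  of the type \<^typ>\<open>nat \<Rightarrow> 'r\<close> (choose coset representatives in a quotient of \<open>R\<^sup>n\<close>), so that
  projective covers and iterated syzygies of finitely generated modules can be taken on that
  type.\<close>

definition syzygy ::
  "('r, 'u) ring_scheme \<Rightarrow> ('r, 'm, 'v) module_scheme \<Rightarrow> ('r, 'n, 'w) module_scheme \<Rightarrow> bool" where
  "syzygy R X Y \<longleftrightarrow>
     (\<exists>(P :: ('r, nat \<Rightarrow> 'r) module) f. projective_cover R P X f \<and> mod_iso R (mod_kernel P X f) Y)"

primrec iter_syzygy ::
  "('r, 'u) ring_scheme \<Rightarrow> ('r, 'm, 'v) module_scheme \<Rightarrow> nat \<Rightarrow> ('r, nat \<Rightarrow> 'r) module \<Rightarrow> bool" where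
  "iter_syzygy R X 0 = mod_iso R X"
| "iter_syzygy R X (Suc i) = (\<lambda>Y. \<exists>Z. iter_syzygy R X i Z \<and> syzygy R Z Y)"

text \<open>\<open>nth_syzygy R n X Y\<close> says that \<open>Y\<close>, on whatever type, is isomorphic to the \<open>n\<close>-th syzygy
  of \<open>X\<close>.\<close>

definition nth_syzygy ::
  "('r, 'u) ring_scheme \<Rightarrow> nat \<Rightarrow> ('r, 'm, 'v) module_scheme \<Rightarrow> ('r, 'n, 'w) module_scheme \<Rightarrow> bool"
  where
  "nth_syzygy R n X Y \<longleftrightarrow> (\<exists>Z. iter_syzygy R X n Z \<and> mod_iso R Z Y)"

definition periodic :: "('r, 'u) ring_scheme \<Rightarrow> ('r, 'm, 'v) module_scheme \<Rightarrow> bool" where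
  "periodic R X \<longleftrightarrow> (\<exists>p>0. nth_syzygy R p X X)"

definition period :: "('r, 'u) ring_scheme \<Rightarrow> ('r, 'm, 'v) module_scheme \<Rightarrow> nat" where
  "period R X = (LEAST p. p > 0 \<and> nth_syzygy R p X X)"

definition eventually_periodic :: "('r, 'u) ring_scheme \<Rightarrow> ('r, 'm, 'v) module_scheme \<Rightarrow> bool" where
  "eventually_periodic R X \<longleftrightarrow>
     (\<exists>n (Y :: ('r, nat \<Rightarrow> 'r) module). nth_syzygy R n X Y \<and> carrier Y \<noteq> {\<zero>\<^bsub>Y\<^esub>} \<and> periodic R Y)"

section \<open>The stable module category\<close>

text \<open>As above, the type of \<open>P\<close> is no restriction when \<open>X\<close> is finitely generated: a homomorphism
  from \<open>X\<close> that factors through a projective module factors through some \<open>R\<^sup>n\<close>.\<close>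

definition factors_through_projective ::
  "('r, 'u) ring_scheme \<Rightarrow> ('r, 'm, 'v) module_scheme \<Rightarrow> ('r, 'n, 'w) module_scheme \<Rightarrow> ('m \<Rightarrow> 'n) \<Rightarrow> bool"
  where
  "factors_through_projective R X Y h \<longleftrightarrow>
     (\<exists>P :: ('r, nat \<Rightarrow> 'r) module. projective R P \<and>
        (\<exists>u\<in>mod_hom R X P. \<exists>v\<in>mod_hom R P Y. \<forall>x\<in>carrier X. h x = v (u x)))"

definition stably_equal ::
  "('r, 'u) ring_scheme \<Rightarrow> ('r, 'm, 'v) module_scheme \<Rightarrow> ('r, 'n, 'w) module_scheme
     \<Rightarrow> ('m \<Rightarrow> 'n) \<Rightarrow> ('m \<Rightarrow> 'n) \<Rightarrow> bool"
  where
  "stably_equal R X Y f g \<longleftrightarrow> factors_through_projective R X Y (\<lambda>x. f x \<ominus>\<^bsub>Y\<^esub> g x)"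

definition stably_iso ::
  "('r, 'u) ring_scheme \<Rightarrow> ('r, 'm, 'v) module_scheme \<Rightarrow> ('r, 'n, 'w) module_scheme \<Rightarrow> bool" where
  "stably_iso R X Y \<longleftrightarrow> fin_gen R X \<and> fin_gen R Y \<and>
     (\<exists>f\<in>mod_hom R X Y. \<exists>g\<in>mod_hom R Y X.
        stably_equal R X X (g \<circ> f) id \<and> stably_equal R Y Y (f \<circ> g) id)"

section \<open>Opposite rings, right modules and tensor products\<close>

definition op_ring :: "('r, 'u) ring_scheme \<Rightarrow> ('r, 'u) ring_scheme" where
  "op_ring R = R\<lparr>mult := \<lambda>x y. y \<otimes>\<^bsub>R\<^esub> x\<rparr>"

text \<open>A right \<open>R\<close>-module is a left module \<open>M\<close> over \<^term>\<open>op_ring R\<close>, where \<open>r \<odot>\<^bsub>M\<^esub> m\<close> stands for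
  \<open>m r\<close>. In particular a module over a commutative ring is both a left and a right module.
  For a right module \<open>M\<close> and a left module \<open>N\<close>, the tensor product over \<open>R\<close> is the free abelian
  group on the pairs modulo the usual relations.\<close>

definition tensor_relations ::
  "('r, 'u) ring_scheme \<Rightarrow> ('r, 'm, 'v) module_scheme \<Rightarrow> ('r, 'n, 'w) module_scheme
     \<Rightarrow> ('m \<times> 'n \<Rightarrow>\<^sub>0 int) set"
  where
  "tensor_relations R M N =
     {frag_of (m \<oplus>\<^bsub>M\<^esub> m', n) - frag_of (m, n) - frag_of (m', n) | m m' n.
        m \<in> carrier M \<and> m' \<in> carrier M \<and> n \<in> carrier N} \<union>
     {frag_of (m, n \<oplus>\<^bsub>N\<^esub> n') - frag_of (m, n) - frag_of (m, n') | m n n'.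
        m \<in> carrier M \<and> n \<in> carrier N \<and> n' \<in> carrier N} \<union>
     {frag_of (r \<odot>\<^bsub>M\<^esub> m, n) - frag_of (m, r \<odot>\<^bsub>N\<^esub> n) | r m n.
        r \<in> carrier R \<and> m \<in> carrier M \<and> n \<in> carrier N}"

definition tensor_kernel ::
  "('r, 'u) ring_scheme \<Rightarrow> ('r, 'm, 'v) module_scheme \<Rightarrow> ('r, 'n, 'w) module_scheme
     \<Rightarrow> ('m \<times> 'n \<Rightarrow>\<^sub>0 int) set"
  where
  "tensor_kernel R M N =
     generate (free_Abelian_group (carrier M \<times> carrier N)) (tensor_relations R M N)"

definition tensor_quotient ::
  "('r, 'u) ring_scheme \<Rightarrow> ('r, 'm, 'v) module_scheme \<Rightarrow> ('r, 'n, 'w) module_scheme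
     \<Rightarrow> ('m \<times> 'n \<Rightarrow>\<^sub>0 int) set monoid"
  where
  "tensor_quotient R M N = free_Abelian_group (carrier M \<times> carrier N) Mod tensor_kernel R M N"

text \<open>The tensor product in additive notation; the multiplicative fields are irrelevant.\<close>

definition tensor ::
  "('r, 'u) ring_scheme \<Rightarrow> ('r, 'm, 'v) module_scheme \<Rightarrow> ('r, 'n, 'w) module_scheme
     \<Rightarrow> ('m \<times> 'n \<Rightarrow>\<^sub>0 int) set ring"
  where
  "tensor R M N =
     \<lparr>carrier = carrier (tensor_quotient R M N), monoid.mult = undefined, one = undefined,
      ring.zero = \<one>\<^bsub>tensor_quotient R M N\<^esub>, add = monoid.mult (tensor_quotient R M N)\<rparr>"

definition pure_tensor ::
  "('r, 'u) ring_scheme \<Rightarrow> ('r, 'm, 'v) module_scheme \<Rightarrow> ('r, 'n, 'w) module_scheme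
     \<Rightarrow> 'm \<Rightarrow> 'n \<Rightarrow> ('m \<times> 'n \<Rightarrow>\<^sub>0 int) set"
  where
  "pure_tensor R M N m n =
     tensor_kernel R M N #>\<^bsub>free_Abelian_group (carrier M \<times> carrier N)\<^esub> frag_of (m, n)"

text \<open>The additive map into \<open>G\<close> sending \<open>m \<otimes> n\<close> to \<open>\<phi> m n\<close>, for a balanced map \<open>\<phi>\<close>.\<close>

definition tensor_lift ::
  "('r, 'u) ring_scheme \<Rightarrow> ('r, 'm, 'v) module_scheme \<Rightarrow> ('r, 'n, 'w) module_scheme
     \<Rightarrow> ('g, 'x) ring_scheme \<Rightarrow> ('m \<Rightarrow> 'n \<Rightarrow> 'g) \<Rightarrow> ('m \<times> 'n \<Rightarrow>\<^sub>0 int) set \<Rightarrow> 'g"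
  where
  "tensor_lift R M N G \<phi> =
     (SOME h. h \<in> additive_maps (tensor R M N) G \<and>
        (\<forall>m\<in>carrier M. \<forall>n\<in>carrier N. h (pure_tensor R M N m n) = \<phi> m n))"

section \<open>Algebras, bimodules and enveloping algebras\<close>

text \<open>The library locale \<^locale>\<open>algebra\<close> is restricted to commutative algebras.\<close>

locale fd_algebra = k?: field k + A?: ring A + module k A for k (structure) and A (structure) +
  assumes smult_mult_l:
      "\<lbrakk> c \<in> carrier k; x \<in> carrier A; y \<in> carrier A \<rbrakk> \<Longrightarrow>
        (c \<odot>\<^bsub>A\<^esub> x) \<otimes>\<^bsub>A\<^esub> y = c \<odot>\<^bsub>A\<^esub> (x \<otimes>\<^bsub>A\<^esub> y)"
    and smult_mult_r:
      "\<lbrakk> c \<in> carrier k; x \<in> carrier A; y \<in> carrier A \<rbrakk> \<Longrightarrow>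
        x \<otimes>\<^bsub>A\<^esub> (c \<odot>\<^bsub>A\<^esub> y) = c \<odot>\<^bsub>A\<^esub> (x \<otimes>\<^bsub>A\<^esub> y)"
    and fin_dim: "fin_gen k A"

record ('a, 'b, 'm) bimodule = "('a, 'm) module" +
  rsmult :: "'m \<Rightarrow> 'b \<Rightarrow> 'm"

definition right_mod :: "('a, 'b, 'm, 'u) bimodule_scheme \<Rightarrow> ('b, 'm) module" where
  "right_mod M =
     \<lparr>carrier = carrier M, monoid.mult = monoid.mult M, one = \<one>\<^bsub>M\<^esub>, ring.zero = \<zero>\<^bsub>M\<^esub>, add = add M,
      smult = (\<lambda>b m. rsmult M m b)\<rparr>"

text \<open>\<open>A\<close>-\<open>B\<close>-bimodules on which \<open>k\<close> acts centrally.\<close>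

locale bimodule_over = left_module A M + right: left_module "op_ring B" "right_mod M"
  for k :: "('k, 'u) ring_scheme"
    and A :: "('k, 'a, 'v) module_scheme" and B :: "('k, 'b, 'w) module_scheme"
    and M :: "('a, 'b, 'm, 'x) bimodule_scheme" +
  assumes smult_rsmult:
      "\<lbrakk> a \<in> carrier A; m \<in> carrier M; b \<in> carrier B \<rbrakk> \<Longrightarrow>
        rsmult M (a \<odot>\<^bsub>M\<^esub> m) b = a \<odot>\<^bsub>M\<^esub> rsmult M m b"
    and central:
      "\<lbrakk> c \<in> carrier k; m \<in> carrier M \<rbrakk> \<Longrightarrow>
        (c \<odot>\<^bsub>A\<^esub> \<one>\<^bsub>A\<^esub>) \<odot>\<^bsub>M\<^esub> m = rsmult M m (c \<odot>\<^bsub>B\<^esub> \<one>\<^bsub>B\<^esub>)"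

definition regular_bimodule :: "('k, 'a, 'v) module_scheme \<Rightarrow> ('a, 'a, 'a) bimodule" where
  "regular_bimodule A =
     \<lparr>carrier = carrier A, monoid.mult = monoid.mult A, one = \<one>\<^bsub>A\<^esub>, ring.zero = \<zero>\<^bsub>A\<^esub>, add = add A,
      smult = monoid.mult A, rsmult = monoid.mult A\<rparr>"

text \<open>For an \<open>A\<close>-\<open>B\<close>-bimodule \<open>M\<close> and a \<open>B\<close>-\<open>C\<close>-bimodule \<open>N\<close>, the \<open>A\<close>-\<open>C\<close>-bimodule
  \<open>M \<otimes>\<^sub>B N\<close>.\<close>

definition tensor_bimodule ::
  "('b, 'u) ring_scheme \<Rightarrow> ('a, 'b, 'm, 'v) bimodule_scheme \<Rightarrow> ('b, 'c, 'n, 'w) bimodule_scheme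
     \<Rightarrow> ('a, 'c, ('m \<times> 'n \<Rightarrow>\<^sub>0 int) set) bimodule"
  where
  "tensor_bimodule B M N =
    (let T = tensor B (right_mod M) N; lift = tensor_lift B (right_mod M) N T;
         pure = pure_tensor B (right_mod M) N
     in \<lparr>carrier = carrier T, monoid.mult = monoid.mult T, one = \<one>\<^bsub>T\<^esub>, ring.zero = \<zero>\<^bsub>T\<^esub>, add = add T,
         smult = (\<lambda>a. lift (\<lambda>m n. pure (a \<odot>\<^bsub>M\<^esub> m) n)),
         rsmult = (\<lambda>t c. lift (\<lambda>m n. pure m (rsmult N n c)) t)\<rparr>)"

text \<open>The ring \<open>A \<otimes>\<^sub>k B\<close>, with product \<open>(a \<otimes> b) (a' \<otimes> b') = a a' \<otimes> b b'\<close>.\<close>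

definition tensor_algebra ::
  "('k, 'u) ring_scheme \<Rightarrow> ('k, 'a, 'v) module_scheme \<Rightarrow> ('k, 'b, 'w) module_scheme
     \<Rightarrow> ('a \<times> 'b \<Rightarrow>\<^sub>0 int) set ring"
  where
  "tensor_algebra k A B =
    (let T = tensor k A B; lift = tensor_lift k A B T; pure = pure_tensor k A B
     in T\<lparr>mult := (\<lambda>s t. lift (\<lambda>a b. lift (\<lambda>a' b'. pure (a \<otimes>\<^bsub>A\<^esub> a') (b \<otimes>\<^bsub>B\<^esub> b')) t) s),
          one := pure \<one>\<^bsub>A\<^esub> \<one>\<^bsub>B\<^esub>\<rparr>)"

definition enveloping_algebra ::
  "('k, 'u) ring_scheme \<Rightarrow> ('k, 'a, 'v) module_scheme \<Rightarrow> ('a \<times> 'a \<Rightarrow>\<^sub>0 int) set ring" where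
  "enveloping_algebra k A = tensor_algebra k A (op_ring A)"

text \<open>An \<open>A\<close>-bimodule with central action of \<open>k\<close> as a module over the enveloping algebra, via
  \<open>(a \<otimes> b) x = a x b\<close>.\<close>

definition enveloping_module ::
  "('k, 'u) ring_scheme \<Rightarrow> ('k, 'a, 'v) module_scheme \<Rightarrow> ('a, 'a, 'm, 'w) bimodule_scheme
     \<Rightarrow> (('a \<times> 'a \<Rightarrow>\<^sub>0 int) set, 'm) module"
  where
  "enveloping_module k A X =
     \<lparr>carrier = carrier X, monoid.mult = monoid.mult X, one = \<one>\<^bsub>X\<^esub>, ring.zero = \<zero>\<^bsub>X\<^esub>, add = add X,
      smult = (\<lambda>t x. tensor_lift k A (op_ring A) X (\<lambda>a b. a \<odot>\<^bsub>X\<^esub> rsmult X x b) t)\<rparr>"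

definition algebra_module ::
  "('k, 'u) ring_scheme \<Rightarrow> ('k, 'a, 'v) module_scheme \<Rightarrow> (('a \<times> 'a \<Rightarrow>\<^sub>0 int) set, 'a) module" where
  "algebra_module k A = enveloping_module k A (regular_bimodule A)"

definition eventually_periodic_algebra ::
  "('k, 'u) ring_scheme \<Rightarrow> ('k, 'a, 'v) module_scheme \<Rightarrow> bool" where
  "eventually_periodic_algebra k A \<longleftrightarrow>
     eventually_periodic (enveloping_algebra k A) (algebra_module k A)"

section \<open>Singular equivalences of Morita type with level\<close>

text \<open>\<open>X\<close> is isomorphic to the \<open>l\<close>-th syzygy of \<open>A\<close> in the stable category of modules over the
  enveloping algebra of \<open>A\<close>.\<close>

definition stably_iso_syzygy ::
  "('k, 'u) ring_scheme \<Rightarrow> ('k, 'a, 'v) module_scheme \<Rightarrow> nat \<Rightarrow> ('a, 'a, 'm, 'w) bimodule_scheme \<Rightarrow> bool"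
  where
  "stably_iso_syzygy k A l X \<longleftrightarrow>
     (\<exists>Y :: (('a \<times> 'a \<Rightarrow>\<^sub>0 int) set, nat \<Rightarrow> ('a \<times> 'a \<Rightarrow>\<^sub>0 int) set) module.
        nth_syzygy (enveloping_algebra k A) l (algebra_module k A) Y \<and>
        stably_iso (enveloping_algebra k A) (enveloping_module k A X) Y)"

definition singular_equivalence ::
  "('k, 'u) ring_scheme \<Rightarrow> ('k, 'a, 'v) module_scheme \<Rightarrow> ('k, 'b, 'w) module_scheme \<Rightarrow> nat
     \<Rightarrow> ('a, 'b, 'm, 'x) bimodule_scheme \<Rightarrow> ('b, 'a, 'n, 'y) bimodule_scheme \<Rightarrow> bool"
  where
  "singular_equivalence k A B l M N \<longleftrightarrow>
     bimodule_over k A B M \<and> bimodule_over k B A N \<and>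
     fin_gen A M \<and> projective A M \<and>
     fin_gen (op_ring B) (right_mod M) \<and> projective (op_ring B) (right_mod M) \<and>
     fin_gen B N \<and> projective B N \<and>
     fin_gen (op_ring A) (right_mod N) \<and> projective (op_ring A) (right_mod N) \<and>
     stably_iso_syzygy k A l (tensor_bimodule B M N) \<and>
     stably_iso_syzygy k B l (tensor_bimodule A N M)"

section \<open>Well-definedness\<close>

text \<open>The remainder checks that the constructions above are what they are meant to be: projective
  modules lift against surjections of modules on arbitrary types, \<open>tensor_lift\<close> satisfies the
  universal property of the tensor product, enveloping algebras are rings, bimodules are modules
  over them with \<open>(a \<otimes> b) x = a x b\<close>, and regular bimodules and tensor products of bimodules are
  bimodules.\<close>

lemma mod_homD:
  assumes "f \<in> mod_hom R M N"
  shows "x \<in> carrier M \<Longrightarrow> f x \<in> carrier N"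
    and "x \<in> carrier M \<Longrightarrow> y \<in> carrier M \<Longrightarrow> f (x \<oplus>\<^bsub>M\<^esub> y) = f x \<oplus>\<^bsub>N\<^esub> f y"
    and "a \<in> carrier R \<Longrightarrow> x \<in> carrier M \<Longrightarrow> f (a \<odot>\<^bsub>M\<^esub> x) = a \<odot>\<^bsub>N\<^esub> f x"
  using assms by (auto simp: mod_hom_def additive_maps_def)

lemma mod_hom_zero:
  assumes "left_module R M" "left_module R N" "f \<in> mod_hom R M N"
  shows "f \<zero>\<^bsub>M\<^esub> = \<zero>\<^bsub>N\<^esub>"
proof -
  interpret M: left_module R M by fact
  interpret N: left_module R N by fact
  have "f \<zero>\<^bsub>M\<^esub> \<oplus>\<^bsub>N\<^esub> f \<zero>\<^bsub>M\<^esub> = f \<zero>\<^bsub>M\<^esub>" "f \<zero>\<^bsub>M\<^esub> \<in> carrier N"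
    using mod_homD[OF assms(3)] M.M.zero_closed M.M.l_zero by metis+
  then show ?thesis by (metis N.M.add.l_cancel_one')
qed

context left_module begin

lemma smult_zero_l [simp]: "x \<in> carrier M \<Longrightarrow> \<zero> \<odot>\<^bsub>M\<^esub> x = \<zero>\<^bsub>M\<^esub>"
  using smult_l_distr[of \<zero> \<zero> x] M.add.l_cancel_one'[of "\<zero> \<odot>\<^bsub>M\<^esub> x" "\<zero> \<odot>\<^bsub>M\<^esub> x"] by simp

lemma smult_zero_r [simp]: "a \<in> carrier R \<Longrightarrow> a \<odot>\<^bsub>M\<^esub> \<zero>\<^bsub>M\<^esub> = \<zero>\<^bsub>M\<^esub>"
  using smult_r_distr[of a "\<zero>\<^bsub>M\<^esub>" "\<zero>\<^bsub>M\<^esub>"] M.add.l_cancel_one'[of "a \<odot>\<^bsub>M\<^esub> \<zero>\<^bsub>M\<^esub>" "a \<odot>\<^bsub>M\<^esub> \<zero>\<^bsub>M\<^esub>"] by simp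

definition lincomb :: "('p \<Rightarrow> 'c) \<Rightarrow> ('p \<Rightarrow> 'a) \<Rightarrow> 'c" where
  "lincomb \<phi> f = finsum M (\<lambda>x. f x \<odot>\<^bsub>M\<^esub> \<phi> x) {x. f x \<noteq> \<zero>}"

lemma lincomb_eq:
  assumes "finite S" "{x. f x \<noteq> \<zero>} \<subseteq> S" "\<phi> \<in> S \<rightarrow> carrier M" "f \<in> S \<rightarrow> carrier R"
  shows "lincomb \<phi> f = finsum M (\<lambda>x. f x \<odot>\<^bsub>M\<^esub> \<phi> x) S"
  unfolding lincomb_def
  by (rule M.add.finprod_mono_neutral_cong_left) (use assms in \<open>auto simp: Pi_def\<close>)

end

definition free_module :: "('r, 'u) ring_scheme \<Rightarrow> 'p set \<Rightarrow> ('r, 'p \<Rightarrow> 'r) module" where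
  "free_module R I = \<lparr>carrier = {f. (\<forall>x. f x \<in> carrier R) \<and> {x. f x \<noteq> \<zero>\<^bsub>R\<^esub>} \<subseteq> I \<and> finite {x. f x \<noteq> \<zero>\<^bsub>R\<^esub>}},
     monoid.mult = undefined, one = undefined, ring.zero = (\<lambda>_. \<zero>\<^bsub>R\<^esub>),
     add = (\<lambda>f g x. f x \<oplus>\<^bsub>R\<^esub> g x), smult = (\<lambda>a f x. a \<otimes>\<^bsub>R\<^esub> f x)\<rparr>"

lemma left_module_free_module: fixes I :: "'p set" assumes "ring R" shows "left_module R (free_module R I)"
proof -
  interpret ring R by fact
  have fin: "finite {x. f x \<oplus>\<^bsub>R\<^esub> g x \<noteq> \<zero>\<^bsub>R\<^esub>}" "{x. f x \<oplus>\<^bsub>R\<^esub> g x \<noteq> \<zero>\<^bsub>R\<^esub>} \<subseteq> I"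
    if "finite {x. f x \<noteq> \<zero>\<^bsub>R\<^esub>}" "finite {x. g x \<noteq> \<zero>\<^bsub>R\<^esub>}" "{x. f x \<noteq> \<zero>\<^bsub>R\<^esub>} \<subseteq> I" "{x. g x \<noteq> \<zero>\<^bsub>R\<^esub>} \<subseteq> I"
    for f g :: "'p \<Rightarrow> 'a"
  proof -
    have "{x. f x \<oplus>\<^bsub>R\<^esub> g x \<noteq> \<zero>\<^bsub>R\<^esub>} \<subseteq> {x. f x \<noteq> \<zero>\<^bsub>R\<^esub>} \<union> {x. g x \<noteq> \<zero>\<^bsub>R\<^esub>}" by auto
    with that show "finite {x. f x \<oplus>\<^bsub>R\<^esub> g x \<noteq> \<zero>\<^bsub>R\<^esub>}" "{x. f x \<oplus>\<^bsub>R\<^esub> g x \<noteq> \<zero>\<^bsub>R\<^esub>} \<subseteq> I"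
      using finite_subset by blast+
  qed
  have fin2: "finite {x. a \<otimes>\<^bsub>R\<^esub> f x \<noteq> \<zero>\<^bsub>R\<^esub>}" "{x. a \<otimes>\<^bsub>R\<^esub> f x \<noteq> \<zero>\<^bsub>R\<^esub>} \<subseteq> I"
    if "a \<in> carrier R" "finite {x. f x \<noteq> \<zero>\<^bsub>R\<^esub>}" "{x. f x \<noteq> \<zero>\<^bsub>R\<^esub>} \<subseteq> I" for a and f :: "'p \<Rightarrow> 'a"
  proof -
    have "{x. a \<otimes>\<^bsub>R\<^esub> f x \<noteq> \<zero>\<^bsub>R\<^esub>} \<subseteq> {x. f x \<noteq> \<zero>\<^bsub>R\<^esub>}" using that by auto
    with that show "finite {x. a \<otimes>\<^bsub>R\<^esub> f x \<noteq> \<zero>\<^bsub>R\<^esub>}" "{x. a \<otimes>\<^bsub>R\<^esub> f x \<noteq> \<zero>\<^bsub>R\<^esub>} \<subseteq> I"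
      using finite_subset by blast+
  qed
  have "abelian_group (free_module R I)"
  proof (rule abelian_groupI)
    fix f assume f: "f \<in> carrier (free_module R I)"
    have "{x. \<ominus>\<^bsub>R\<^esub> f x \<noteq> \<zero>\<^bsub>R\<^esub>} \<subseteq> {x. f x \<noteq> \<zero>\<^bsub>R\<^esub>}" by auto
    with f have "(\<lambda>x. \<ominus>\<^bsub>R\<^esub> f x) \<in> carrier (free_module R I)"
      by (auto simp: free_module_def intro: finite_subset)
    moreover have "(\<lambda>x. \<ominus>\<^bsub>R\<^esub> f x) \<oplus>\<^bsub>free_module R I\<^esub> f = \<zero>\<^bsub>free_module R I\<^esub>"
      using f by (auto simp: free_module_def l_neg)
    ultimately show "\<exists>g\<in>carrier (free_module R I). g \<oplus>\<^bsub>free_module R I\<^esub> f = \<zero>\<^bsub>free_module R I\<^esub>" by blast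
  qed (use fin in \<open>auto simp: free_module_def a_ac fun_eq_iff\<close>)
  then show ?thesis
    unfolding left_module_def left_module_axioms_def using ring_axioms fin2
    by (auto simp: free_module_def fun_eq_iff l_distr r_distr m_assoc)
qed

lemma (in left_module) lincomb_hom:
  assumes "\<phi> \<in> I \<rightarrow> carrier M"
  shows "lincomb \<phi> \<in> mod_hom R (free_module R I) M"
proof -
  let ?s = "\<lambda>f :: _ \<Rightarrow> 'a. {x. f x \<noteq> \<zero>}"
  have F: "finite (?s f)" "?s f \<subseteq> I" "\<And>x. f x \<in> carrier R" if "f \<in> carrier (free_module R I)" for f
    using that by (auto simp: free_module_def)
  have 1: "lincomb \<phi> f \<in> carrier M" if "f \<in> carrier (free_module R I)" for f
    unfolding lincomb_def using F[OF that] assms by (intro M.finsum_closed) auto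
  have 2: "lincomb \<phi> (\<lambda>x. f x \<oplus> g x) = lincomb \<phi> f \<oplus>\<^bsub>M\<^esub> lincomb \<phi> g"
    if f: "f \<in> carrier (free_module R I)" and g: "g \<in> carrier (free_module R I)" for f g
  proof -
    let ?S = "?s f \<union> ?s g"
    have S: "finite ?S" "\<phi> \<in> ?S \<rightarrow> carrier M" using F[OF f] F[OF g] assms by auto
    have "lincomb \<phi> (\<lambda>x. f x \<oplus> g x) = finsum M (\<lambda>x. (f x \<oplus> g x) \<odot>\<^bsub>M\<^esub> \<phi> x) ?S"
      by (rule lincomb_eq) (use S F[OF f] F[OF g] in auto)
    also have "\<dots> = finsum M (\<lambda>x. f x \<odot>\<^bsub>M\<^esub> \<phi> x \<oplus>\<^bsub>M\<^esub> g x \<odot>\<^bsub>M\<^esub> \<phi> x) ?S"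
      by (rule M.finsum_cong') (use S F[OF f] F[OF g] in \<open>auto simp: smult_l_distr Pi_def\<close>)
    also have "\<dots> = finsum M (\<lambda>x. f x \<odot>\<^bsub>M\<^esub> \<phi> x) ?S \<oplus>\<^bsub>M\<^esub> finsum M (\<lambda>x. g x \<odot>\<^bsub>M\<^esub> \<phi> x) ?S"
      by (rule M.finsum_addf) (use S F[OF f] F[OF g] in auto)
    also have "finsum M (\<lambda>x. f x \<odot>\<^bsub>M\<^esub> \<phi> x) ?S = lincomb \<phi> f"
      by (rule lincomb_eq[symmetric]) (use S F[OF f] in auto)
    also have "finsum M (\<lambda>x. g x \<odot>\<^bsub>M\<^esub> \<phi> x) ?S = lincomb \<phi> g"
      by (rule lincomb_eq[symmetric]) (use S F[OF g] in auto)
    finally show ?thesis .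
  qed
  have 3: "lincomb \<phi> (\<lambda>x. a \<otimes> f x) = a \<odot>\<^bsub>M\<^esub> lincomb \<phi> f"
    if f: "f \<in> carrier (free_module R I)" and a: "a \<in> carrier R" for f a
  proof -
    have S: "finite (?s f)" "\<phi> \<in> ?s f \<rightarrow> carrier M" using F[OF f] assms by auto
    have *: "finite S \<Longrightarrow> \<phi> \<in> S \<rightarrow> carrier M \<Longrightarrow>
        a \<odot>\<^bsub>M\<^esub> finsum M (\<lambda>x. f x \<odot>\<^bsub>M\<^esub> \<phi> x) S = finsum M (\<lambda>x. (a \<otimes> f x) \<odot>\<^bsub>M\<^esub> \<phi> x) S" for S
      by (induction S rule: finite_induct)
        (use a F(3)[OF f] in \<open>auto simp: Pi_def smult_r_distr smult_assoc1\<close>)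
    have "lincomb \<phi> (\<lambda>x. a \<otimes> f x) = finsum M (\<lambda>x. (a \<otimes> f x) \<odot>\<^bsub>M\<^esub> \<phi> x) (?s f)"
      by (rule lincomb_eq) (use S a F[OF f] in auto)
    with *[OF S] show ?thesis by (simp add: lincomb_def)
  qed
  show ?thesis
    unfolding mod_hom_def additive_maps_def using 1 2 3 by (auto simp: free_module_def)
qed

lemma lincomb_comp:
  assumes "left_module R B" "left_module R C" "g \<in> mod_hom R B C"
    "\<phi> \<in> I \<rightarrow> carrier B" "f \<in> carrier (free_module R I)"
  shows "g (left_module.lincomb R B \<phi> f) = left_module.lincomb R C (\<lambda>x. g (\<phi> x)) f"
proof -
  interpret B: left_module R B by fact
  interpret C: left_module R C by fact
  have f: "finite {x. f x \<noteq> \<zero>\<^bsub>R\<^esub>}" "{x. f x \<noteq> \<zero>\<^bsub>R\<^esub>} \<subseteq> I" "\<And>x. f x \<in> carrier R"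
    using assms(5) by (auto simp: free_module_def)
  have "finite S \<Longrightarrow> \<phi> \<in> S \<rightarrow> carrier B \<Longrightarrow>
      g (finsum B (\<lambda>x. f x \<odot>\<^bsub>B\<^esub> \<phi> x) S) = finsum C (\<lambda>x. f x \<odot>\<^bsub>C\<^esub> g (\<phi> x)) S" for S
    by (induction S rule: finite_induct)
      (use f mod_homD[OF assms(3)] mod_hom_zero[OF assms(1-3)] in \<open>auto simp: Pi_def\<close>)
  moreover have "\<phi> \<in> {x. f x \<noteq> \<zero>\<^bsub>R\<^esub>} \<rightarrow> carrier B" using f assms(4) by auto
  ultimately show ?thesis using f(1) by (simp add: B.lincomb_def C.lincomb_def)
qed

lemma projectiveD:
  fixes P :: "('r, 'p, 'v) module_scheme" and B :: "('r, 'p \<Rightarrow> 'r) module" and C :: "('r, 'p) module"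
  assumes "projective R P" "left_module R B" "left_module R C" "g \<in> mod_hom R B C"
    "g ` carrier B = carrier C" "h \<in> mod_hom R P C"
  shows "\<exists>h'\<in>mod_hom R P B. \<forall>x\<in>carrier P. g (h' x) = h x"
  using assms unfolding projective_def by blast

theorem projective_lift:
  assumes P: "projective R P" and B: "left_module R B" and C: "left_module R C"
    and g: "g \<in> mod_hom R B C" "g ` carrier B = carrier C" and h: "h \<in> mod_hom R P C"
  shows "\<exists>h'\<in>mod_hom R P B. \<forall>x\<in>carrier P. g (h' x) = h x"
proof -
  interpret P: left_module R P using P by (simp add: projective_def)
  interpret B: left_module R B by fact
  interpret C: left_module R C by fact
  let ?F = "free_module R (carrier P)"
  let ?P = "\<lparr>carrier = carrier P, monoid.mult = undefined, one = undefined, ring.zero = \<zero>\<^bsub>P\<^esub>,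
    add = add P, smult = smult P\<rparr> :: ('a, 'c) module"
  have abP: "abelian_group ?P"
    by (rule abelian_groupI) (use P.M.l_neg P.M.a_inv_closed in \<open>fastforce simp: P.M.a_ac\<close>)+
  then have P': "left_module R ?P"
    unfolding left_module_def left_module_axioms_def
    by (auto simp: P.R.ring_axioms P.smult_l_distr P.smult_r_distr P.smult_assoc1)
  have e: "P.lincomb id \<in> mod_hom R ?F P" by (rule P.lincomb_hom) auto
  have surj: "P.lincomb id ` carrier ?F = carrier P"
  proof
    show "P.lincomb id ` carrier ?F \<subseteq> carrier P" using mod_homD(1)[OF e] by auto
    show "carrier P \<subseteq> P.lincomb id ` carrier ?F"
    proof
      fix x assume x: "x \<in> carrier P"
      let ?d = "\<lambda>y. if y = x then \<one>\<^bsub>R\<^esub> else \<zero>\<^bsub>R\<^esub>"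
      have "{y. ?d y \<noteq> \<zero>\<^bsub>R\<^esub>} \<subseteq> {x}" by auto
      then have "?d \<in> carrier ?F" using x by (auto simp: free_module_def intro: finite_subset)
      moreover have "P.lincomb id ?d = finsum P (\<lambda>y. ?d y \<odot>\<^bsub>P\<^esub> id y) {x}"
        by (rule P.lincomb_eq) (use x in auto)
      then have "P.lincomb id ?d = x" using x by simp
      ultimately show "x \<in> P.lincomb id ` carrier ?F" by (metis imageI)
    qed
  qed
  have e': "P.lincomb id \<in> mod_hom R ?F ?P" and id': "(\<lambda>x. x) \<in> mod_hom R P ?P"
    using e by (auto simp: mod_hom_def additive_maps_def)
  have surj': "P.lincomb id ` carrier ?F = carrier ?P" using surj by simp
  obtain s where s: "s \<in> mod_hom R P ?F" "\<And>x. x \<in> carrier P \<Longrightarrow> P.lincomb id (s x) = x"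
    using projectiveD[OF P left_module_free_module[OF P.R.ring_axioms] P' e' surj' id'] by blast
  have "\<forall>x\<in>carrier P. \<exists>b\<in>carrier B. g b = h x"
    using g(2) mod_homD(1)[OF h] by (metis (no_types, lifting) imageE)
  then obtain b where b: "b \<in> carrier P \<rightarrow> carrier B" "\<And>x. x \<in> carrier P \<Longrightarrow> g (b x) = h x"
    by (metis Pi_I)
  have bh: "B.lincomb b \<in> mod_hom R ?F B" using b(1) by (rule B.lincomb_hom)
  have "(\<lambda>x. B.lincomb b (s x)) \<in> mod_hom R P B"
    using mod_homD[OF bh] mod_homD[OF s(1)] by (simp add: mod_hom_def additive_maps_def)
  moreover have "g (B.lincomb b (s x)) = h x" if x: "x \<in> carrier P" for x
  proof -
    have sx: "s x \<in> carrier ?F" using mod_homD(1)[OF s(1) x] .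
    have "g (B.lincomb b (s x)) = C.lincomb (\<lambda>y. g (b y)) (s x)"
      by (rule lincomb_comp[OF B C g(1) b(1) sx])
    also have "\<dots> = C.lincomb (\<lambda>y. h (id y)) (s x)"
      unfolding C.lincomb_def
      by (rule C.M.finsum_cong') (use sx b mod_homD[OF h] in \<open>auto simp: free_module_def Pi_def subset_iff\<close>)
    also have "\<dots> = h (P.lincomb id (s x))"
      by (rule lincomb_comp[OF P.left_module_axioms C h _ sx, symmetric]) auto
    finally show ?thesis using s(2)[OF x] by simp
  qed
  ultimately show ?thesis by (intro bexI[where x = "\<lambda>x. B.lincomb b (s x)"] ballI)
qed

lemma op_ring_simps [simp]:
  "carrier (op_ring R) = carrier R" "\<zero>\<^bsub>op_ring R\<^esub> = \<zero>\<^bsub>R\<^esub>" "\<one>\<^bsub>op_ring R\<^esub> = \<one>\<^bsub>R\<^esub>"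
  "x \<oplus>\<^bsub>op_ring R\<^esub> y = x \<oplus>\<^bsub>R\<^esub> y" "x \<otimes>\<^bsub>op_ring R\<^esub> y = y \<otimes>\<^bsub>R\<^esub> x"
  by (simp_all add: op_ring_def)

lemma op_ring_smult [simp]: "c \<odot>\<^bsub>op_ring A\<^esub> x = c \<odot>\<^bsub>A\<^esub> x"
  for A :: "('k, 'a, 'v) module_scheme"
  by (simp add: op_ring_def)

lemma ring_op_ring: assumes "ring R" shows "ring (op_ring R)"
proof -
  interpret ring R by fact
  show ?thesis
    by (intro ringI abelian_groupI monoidI)
       (auto simp: a_ac m_assoc l_distr r_distr intro: add.l_inv_ex)
qed

lemma additive_maps_props:
  assumes "abelian_group A" "abelian_group B" "f \<in> additive_maps A B"
  shows "f \<zero>\<^bsub>A\<^esub> = \<zero>\<^bsub>B\<^esub>"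
    and "x \<in> carrier A \<Longrightarrow> y \<in> carrier A \<Longrightarrow> f (x \<oplus>\<^bsub>A\<^esub> y) = f x \<oplus>\<^bsub>B\<^esub> f y"
    and "x \<in> carrier A \<Longrightarrow> y \<in> carrier A \<Longrightarrow> f (x \<ominus>\<^bsub>A\<^esub> y) = f x \<ominus>\<^bsub>B\<^esub> f y"
    and "x \<in> carrier A \<Longrightarrow> f x \<in> carrier B"
proof -
  interpret A: abelian_group A by fact
  interpret B: abelian_group B by fact
  have "f \<in> hom (add_monoid A) (add_monoid B)" using assms(3) by (simp add: additive_maps_def hom_def)
  then interpret f: group_hom "add_monoid A" "add_monoid B" f
    by (intro group_hom.intro group_hom_axioms.intro A.a_group B.a_group)
  show "f \<zero>\<^bsub>A\<^esub> = \<zero>\<^bsub>B\<^esub>" using f.hom_one by simp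
  show "x \<in> carrier A \<Longrightarrow> y \<in> carrier A \<Longrightarrow> f (x \<oplus>\<^bsub>A\<^esub> y) = f x \<oplus>\<^bsub>B\<^esub> f y"
    using f.hom_mult[of x y] by simp
  show "x \<in> carrier A \<Longrightarrow> y \<in> carrier A \<Longrightarrow> f (x \<ominus>\<^bsub>A\<^esub> y) = f x \<ominus>\<^bsub>B\<^esub> f y"
    using f.hom_mult[of x "\<ominus>\<^bsub>A\<^esub> y"] f.hom_inv[of y]
    by (simp add: a_minus_def a_inv_def[symmetric])
  show "x \<in> carrier A \<Longrightarrow> f x \<in> carrier B" using f.hom_closed[of x] by simp
qed

locale tensor_pair = M: left_module "op_ring R" M + N: left_module R N
  for R :: "('r, 'u) ring_scheme" and M :: "('r, 'm, 'v) module_scheme"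
    and N :: "('r, 'n, 'w) module_scheme"
begin

abbreviation "F \<equiv> free_Abelian_group (carrier M \<times> carrier N)"
abbreviation "K \<equiv> tensor_kernel R M N"
abbreviation "T \<equiv> tensor R M N"
abbreviation "pure \<equiv> pure_tensor R M N"

lemma relations_carrier: "tensor_relations R M N \<subseteq> carrier F"
  using M.smult_closed N.smult_closed
  unfolding tensor_relations_def
  by (auto dest!: subsetD[OF keys_diff])

lemma kernel_normal: "K \<lhd> F"
  unfolding tensor_kernel_def
  using relations_carrier abelian_free_Abelian_group comm_group.subgroup_imp_normal
    group.generate_is_subgroup group_free_Abelian_group by blast

lemma kernel_subgroup: "subgroup K F"
  using kernel_normal normal_imp_subgroup by blast

lemma coset_eqI:
  assumes "x - y \<in> K" "x \<in> carrier F" "y \<in> carrier F"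
  shows "K #>\<^bsub>F\<^esub> x = K #>\<^bsub>F\<^esub> y"
proof -
  have "x \<in> K #>\<^bsub>F\<^esub> y" using assms(1) by (force simp: r_coset_def intro: bexI[of _ "x - y"])
  then show ?thesis
    using group.repr_independence[OF group_free_Abelian_group _ assms(3) kernel_subgroup] by metis
qed

lemma carrier_T: "carrier T = (\<lambda>x. K #>\<^bsub>F\<^esub> x) ` carrier F"
  by (auto simp: tensor_def tensor_quotient_def FactGroup_def RCOSETS_def)

lemma add_T: "x \<in> carrier F \<Longrightarrow> y \<in> carrier F \<Longrightarrow>
   (K #>\<^bsub>F\<^esub> x) \<oplus>\<^bsub>T\<^esub> (K #>\<^bsub>F\<^esub> y) = K #>\<^bsub>F\<^esub> (x + y)"
  using normal.rcos_sum[OF kernel_normal, of x y]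
  by (simp add: tensor_def tensor_quotient_def FactGroup_def)

lemma zero_T: "\<zero>\<^bsub>T\<^esub> = K #>\<^bsub>F\<^esub> 0"
  using group.coset_mult_one[OF group_free_Abelian_group subgroup.subset[OF kernel_subgroup]]
  by (simp add: tensor_def tensor_quotient_def FactGroup_def)

lemma abelian_group_T: "abelian_group T"
proof (rule abelian_groupI)
  fix x assume "x \<in> carrier T"
  then obtain a where a: "a \<in> carrier F" "x = K #>\<^bsub>F\<^esub> a" by (auto simp: carrier_T)
  then have "(K #>\<^bsub>F\<^esub> (-a)) \<oplus>\<^bsub>T\<^esub> x = \<zero>\<^bsub>T\<^esub>"
    using add_T[of "-a" a] by (simp add: zero_T)
  moreover have "(K #>\<^bsub>F\<^esub> (-a)) \<in> carrier T" using a by (auto simp: carrier_T)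
  ultimately show "\<exists>y\<in>carrier T. y \<oplus>\<^bsub>T\<^esub> x = \<zero>\<^bsub>T\<^esub>" by blast
  show "\<zero>\<^bsub>T\<^esub> \<oplus>\<^bsub>T\<^esub> x = x" using a add_T[of 0 a] by (simp add: zero_T)
next
  fix x y assume "x \<in> carrier T" "y \<in> carrier T"
  then obtain a b where *: "a \<in> carrier F" "x = K #>\<^bsub>F\<^esub> a" "b \<in> carrier F" "y = K #>\<^bsub>F\<^esub> b"
    by (auto simp: carrier_T)
  moreover have "a + b \<in> carrier F"
    using * by (metis (no_types, lifting) group.is_monoid group_free_Abelian_group monoid.m_closed mult_free_Abelian_group)
  ultimately show "x \<oplus>\<^bsub>T\<^esub> y \<in> carrier T" "x \<oplus>\<^bsub>T\<^esub> y = y \<oplus>\<^bsub>T\<^esub> x"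
    using add_T[of a b] add_T[of b a] by (auto simp: carrier_T add.commute)
next
  fix x y z assume "x \<in> carrier T" "y \<in> carrier T" "z \<in> carrier T"
  then obtain a b c where *: "a \<in> carrier F" "x = K #>\<^bsub>F\<^esub> a" "b \<in> carrier F" "y = K #>\<^bsub>F\<^esub> b"
    "c \<in> carrier F" "z = K #>\<^bsub>F\<^esub> c"
    by (auto simp: carrier_T)
  moreover have "a + b \<in> carrier F" "b + c \<in> carrier F"
    using * by (metis (no_types, lifting) group.is_monoid group_free_Abelian_group monoid.m_closed mult_free_Abelian_group)+
  ultimately show "x \<oplus>\<^bsub>T\<^esub> y \<oplus>\<^bsub>T\<^esub> z = x \<oplus>\<^bsub>T\<^esub> (y \<oplus>\<^bsub>T\<^esub> z)"
    by (simp only: add_T add.assoc)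
qed (auto simp: zero_T carrier_T)

sublocale T: abelian_group T by (rule abelian_group_T)

lemma pure_closed [simp, intro]: "m \<in> carrier M \<Longrightarrow> n \<in> carrier N \<Longrightarrow> pure m n \<in> carrier T"
  by (auto simp: pure_tensor_def carrier_T)

lemma F_add: "x \<in> carrier F \<Longrightarrow> y \<in> carrier F \<Longrightarrow> x + y \<in> carrier F"
  by (metis group.is_monoid group_free_Abelian_group monoid.m_closed mult_free_Abelian_group)

lemma rel_K: "x \<in> tensor_relations R M N \<Longrightarrow> x \<in> K"
  unfolding tensor_kernel_def by (rule generate.incl)

lemma pure_add_l:
  assumes "m \<in> carrier M" "m' \<in> carrier M" "n \<in> carrier N"
  shows "pure (m \<oplus>\<^bsub>M\<^esub> m') n = pure m n \<oplus>\<^bsub>T\<^esub> pure m' n"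
proof -
  have "frag_of (m \<oplus>\<^bsub>M\<^esub> m', n) - (frag_of (m, n) + frag_of (m', n)) \<in> K"
    using assms by (intro rel_K) (force simp: tensor_relations_def diff_diff_eq)
  from coset_eqI[OF this] show ?thesis
    using assms add_T[of "frag_of (m, n)" "frag_of (m', n)"]
      F_add[of "frag_of (m, n)" "frag_of (m', n)"]
    by (simp add: pure_tensor_def)
qed

lemma pure_add_r:
  assumes "m \<in> carrier M" "n \<in> carrier N" "n' \<in> carrier N"
  shows "pure m (n \<oplus>\<^bsub>N\<^esub> n') = pure m n \<oplus>\<^bsub>T\<^esub> pure m n'"
proof -
  have "frag_of (m, n \<oplus>\<^bsub>N\<^esub> n') - (frag_of (m, n) + frag_of (m, n')) \<in> K"
    using assms by (intro rel_K) (force simp: tensor_relations_def diff_diff_eq)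
  from coset_eqI[OF this] show ?thesis
    using assms add_T[of "frag_of (m, n)" "frag_of (m, n')"]
      F_add[of "frag_of (m, n)" "frag_of (m, n')"]
    by (simp add: pure_tensor_def)
qed

lemma pure_balanced:
  assumes "m \<in> carrier M" "n \<in> carrier N" "r \<in> carrier R"
  shows "pure (r \<odot>\<^bsub>M\<^esub> m) n = pure m (r \<odot>\<^bsub>N\<^esub> n)"
proof -
  have "frag_of (r \<odot>\<^bsub>M\<^esub> m, n) - frag_of (m, r \<odot>\<^bsub>N\<^esub> n) \<in> K"
    using assms by (intro rel_K) (force simp: tensor_relations_def)
  from coset_eqI[OF this] show ?thesis
    using assms M.smult_closed[of r m] N.smult_closed by (simp add: pure_tensor_def)
qed

lemma tensor_induct [consumes 1, case_names zero pure diff]: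
  assumes "t \<in> carrier T"
    and "P \<zero>\<^bsub>T\<^esub>"
    and "\<And>m n. m \<in> carrier M \<Longrightarrow> n \<in> carrier N \<Longrightarrow> P (pure m n)"
    and "\<And>s t. s \<in> carrier T \<Longrightarrow> t \<in> carrier T \<Longrightarrow> P s \<Longrightarrow> P t \<Longrightarrow> P (s \<ominus>\<^bsub>T\<^esub> t)"
  shows "P t"
proof -
  obtain a where a: "a \<in> carrier F" "t = K #>\<^bsub>F\<^esub> a" using assms(1) by (auto simp: carrier_T)
  have "Poly_Mapping.keys a \<subseteq> carrier M \<times> carrier N" using a by simp
  then have "P (K #>\<^bsub>F\<^esub> a)"
  proof (induction a rule: free_Abelian_group_induct[consumes 1, case_names 1 2 3])
    case 1 then show ?case using assms(2) by (simp add: zero_T)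
  next
    case (2 x y)
    have c: "K #>\<^bsub>F\<^esub> x \<in> carrier T" "K #>\<^bsub>F\<^esub> y \<in> carrier T" "K #>\<^bsub>F\<^esub> (x-y) \<in> carrier T"
      using 2 order_trans[OF keys_diff[of x y], of "carrier M \<times> carrier N"]
      unfolding carrier_T by (intro imageI; simp)+
    have "(K #>\<^bsub>F\<^esub> (x - y)) \<oplus>\<^bsub>T\<^esub> (K #>\<^bsub>F\<^esub> y) = K #>\<^bsub>F\<^esub> x"
      using add_T[of "x - y" y] 2 order_trans[OF keys_diff[of x y]] by simp
    then have "K #>\<^bsub>F\<^esub> (x - y) = (K #>\<^bsub>F\<^esub> x) \<ominus>\<^bsub>T\<^esub> (K #>\<^bsub>F\<^esub> y)"
      using c by (metis T.add.inv_solve_right T.minus_eq)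
    then show ?case using assms(4) c 2 by simp
  next
    case (3 p) then show ?case using assms(3) by (cases p) (auto simp: pure_tensor_def)
  qed
  with a show ?thesis by simp
qed

definition balanced :: "('g, 'x) ring_scheme \<Rightarrow> ('m \<Rightarrow> 'n \<Rightarrow> 'g) \<Rightarrow> bool" where
  "balanced G \<phi> \<longleftrightarrow>
    (\<forall>m\<in>carrier M. \<forall>n\<in>carrier N. \<phi> m n \<in> carrier G) \<and>
    (\<forall>m\<in>carrier M. \<forall>m'\<in>carrier M. \<forall>n\<in>carrier N. \<phi> (m \<oplus>\<^bsub>M\<^esub> m') n = \<phi> m n \<oplus>\<^bsub>G\<^esub> \<phi> m' n) \<and>
    (\<forall>m\<in>carrier M. \<forall>n\<in>carrier N. \<forall>n'\<in>carrier N. \<phi> m (n \<oplus>\<^bsub>N\<^esub> n') = \<phi> m n \<oplus>\<^bsub>G\<^esub> \<phi> m n') \<and>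
    (\<forall>r\<in>carrier R. \<forall>m\<in>carrier M. \<forall>n\<in>carrier N. \<phi> (r \<odot>\<^bsub>M\<^esub> m) n = \<phi> m (r \<odot>\<^bsub>N\<^esub> n))"

lemma tensor_lift:
  assumes "abelian_group G" "balanced G \<phi>"
  shows "tensor_lift R M N G \<phi> \<in> additive_maps T G"
    and "\<And>m n. m \<in> carrier M \<Longrightarrow> n \<in> carrier N \<Longrightarrow> tensor_lift R M N G \<phi> (pure m n) = \<phi> m n"
proof -
  interpret G: abelian_group G by fact
  have "(\<lambda>(m, n). \<phi> m n) ` (carrier M \<times> carrier N) \<subseteq> carrier (add_monoid G)"
    using assms(2) by (auto simp: balanced_def)
  then obtain h where h: "h \<in> hom F (add_monoid G)"
      "\<And>x. x \<in> carrier M \<times> carrier N \<Longrightarrow> h (frag_of x) = (\<lambda>(m, n). \<phi> m n) x"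
    using comm_group.free_Abelian_group_universal[OF G.a_comm_group] by metis
  interpret h: group_hom F "add_monoid G" h
    using h(1) by (simp add: group_hom_def group_hom_axioms_def G.a_group)
  have hdiff: "h (a - b) = h a \<ominus>\<^bsub>G\<^esub> h b" if "a \<in> carrier F" "b \<in> carrier F" for a b
    using h.hom_mult[of a "-b"] h.hom_inv[of b] that
    by (simp add: a_minus_def a_inv_def)
  have rel: "tensor_relations R M N \<subseteq> kernel F (add_monoid G) h"
  proof
    fix x assume x: "x \<in> tensor_relations R M N"
    then have xF: "x \<in> carrier F" using relations_carrier by blast
    have "h x = \<zero>\<^bsub>G\<^esub>"
      using x unfolding tensor_relations_def
    proof (elim UnE CollectE exE conjE)
      fix m m' n
      assume *: "x = frag_of (m \<oplus>\<^bsub>M\<^esub> m', n) - frag_of (m, n) - frag_of (m', n)"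
        "m \<in> carrier M" "m' \<in> carrier M" "n \<in> carrier N"
      have "frag_of (m \<oplus>\<^bsub>M\<^esub> m', n) - frag_of (m, n) \<in> carrier F"
        using * keys_diff by (fastforce dest!: subsetD[OF keys_diff])
      then have "h x = \<phi> m n \<oplus>\<^bsub>G\<^esub> \<phi> m' n \<ominus>\<^bsub>G\<^esub> \<phi> m n \<ominus>\<^bsub>G\<^esub> \<phi> m' n"
        using * assms(2) by (simp add: hdiff h(2) balanced_def)
      then show ?thesis using * assms(2)
        by (simp add: balanced_def G.minus_eq G.a_ac G.r_neg)
    next
      fix m n n'
      assume *: "x = frag_of (m, n \<oplus>\<^bsub>N\<^esub> n') - frag_of (m, n) - frag_of (m, n')"
        "m \<in> carrier M" "n \<in> carrier N" "n' \<in> carrier N"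
      have "frag_of (m, n \<oplus>\<^bsub>N\<^esub> n') - frag_of (m, n) \<in> carrier F"
        using * keys_diff by (fastforce dest!: subsetD[OF keys_diff])
      then have "h x = \<phi> m n \<oplus>\<^bsub>G\<^esub> \<phi> m n' \<ominus>\<^bsub>G\<^esub> \<phi> m n \<ominus>\<^bsub>G\<^esub> \<phi> m n'"
        using * assms(2) by (simp add: hdiff h(2) balanced_def)
      then show ?thesis using * assms(2)
        by (simp add: balanced_def G.minus_eq G.a_ac G.r_neg)
    next
      fix r m n
      assume *: "x = frag_of (r \<odot>\<^bsub>M\<^esub> m, n) - frag_of (m, r \<odot>\<^bsub>N\<^esub> n)"
        "r \<in> carrier R" "m \<in> carrier M" "n \<in> carrier N"
      then have "r \<odot>\<^bsub>M\<^esub> m \<in> carrier M" using M.smult_closed[of r m] by simp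
      then show ?thesis using * assms(2)
        by (simp add: hdiff h(2) balanced_def G.minus_eq G.r_neg)
    qed
    then show "x \<in> kernel F (add_monoid G) h" using xF by (simp add: kernel_def)
  qed
  have "K \<subseteq> kernel F (add_monoid G) h"
    unfolding tensor_kernel_def
    using group.generate_subgroup_incl[OF group_free_Abelian_group rel h.subgroup_kernel] .
  from h.FactGroup_universal_kernel[OF kernel_normal this]
  obtain g where g: "g \<in> hom (F Mod K) (add_monoid G)"
     "\<And>x. x \<in> carrier F \<Longrightarrow> g (K #>\<^bsub>F\<^esub> x) = h x" by metis
  let ?P = "\<lambda>h. h \<in> additive_maps T G \<and>
        (\<forall>m\<in>carrier M. \<forall>n\<in>carrier N. h (pure m n) = \<phi> m n)"
  have "g \<in> additive_maps T G"
    using g(1) by (simp add: additive_maps_def hom_def tensor_def tensor_quotient_def)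
  then have "?P g" using g h(2) by (simp add: pure_tensor_def)
  then have "?P (tensor_lift R M N G \<phi>)"
    unfolding tensor_lift_def by (rule someI[of ?P])
  then show "tensor_lift R M N G \<phi> \<in> additive_maps T G"
    and "\<And>m n. m \<in> carrier M \<Longrightarrow> n \<in> carrier N \<Longrightarrow> tensor_lift R M N G \<phi> (pure m n) = \<phi> m n"
    by blast+
qed

lemma tensor_hom_eqI:
  assumes "abelian_group G" "f \<in> additive_maps T G"
    "g \<in> additive_maps T G"
    "\<And>m n. m \<in> carrier M \<Longrightarrow> n \<in> carrier N \<Longrightarrow> f (pure m n) = g (pure m n)"
    "t \<in> carrier T"
  shows "f t = g t"
proof -
  interpret G: abelian_group G by fact
  show ?thesis using assms(5)
  proof (induction t rule: tensor_induct)
    case zero then show ?case using additive_maps_props(1)[OF T.abelian_group_axioms assms(1)] assms by metis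
  next
    case (diff s t) then show ?case
      using additive_maps_props(3)[OF T.abelian_group_axioms assms(1)] assms by metis
  qed (use assms in auto)
qed

end

lemma additive_maps_comp:
  "f \<in> additive_maps A B \<Longrightarrow> g \<in> additive_maps B C \<Longrightarrow>
   (\<lambda>x. g (f x)) \<in> additive_maps A C"
  by (fastforce simp: additive_maps_def)

lemma additive_maps_add:
  assumes "abelian_group B" "f \<in> additive_maps A B" "g \<in> additive_maps A B"
  shows "(\<lambda>x. f x \<oplus>\<^bsub>B\<^esub> g x) \<in> additive_maps A B"
proof -
  interpret B: abelian_group B by fact
  show ?thesis using assms(2,3) by (auto simp: additive_maps_def Pi_def B.a_ac)
qed

lemma (in fd_algebra) left_module_k: "left_module k A" "left_module (op_ring k) A"
proof -
  show "left_module k A"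
    using smult_closed smult_l_distr smult_r_distr smult_assoc1 smult_one
    by (intro left_module.intro left_module_axioms.intro k.ring_axioms A.abelian_group_axioms) auto
  then show "left_module (op_ring k) A"
    unfolding left_module_def left_module_axioms_def
    using ring_op_ring[OF k.ring_axioms] smult_assoc1 k.m_comm by auto
qed

lemma (in fd_algebra) fd_algebra_op_ring: "fd_algebra k (op_ring A)"
proof -
  have r: "ring (op_ring A)" using A.ring_axioms by (rule ring_op_ring)
  have lm: "left_module k (op_ring A)"
    using left_module_k(1) r unfolding left_module_def left_module_axioms_def
    by (auto simp: ring_def)
  have sub: "submodule H k (op_ring A) = submodule H k A" for H
    by (simp add: submodule_def submodule_axioms_def op_ring_def)
  have "module k (op_ring A)"
    using lm k.is_cring unfolding module_def left_module_def left_module_axioms_def module_axioms_def by auto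
  then show ?thesis
    using lm r k.field_axioms fin_dim smult_mult_l smult_mult_r
    unfolding fd_algebra_def fd_algebra_axioms_def fin_gen_def by (auto simp: sub)
qed

locale two_algebras = A: fd_algebra k A + B: fd_algebra k B
  for k :: "('k, 'u) ring_scheme" and A :: "('k, 'a, 'v) module_scheme" and B :: "('k, 'b, 'w) module_scheme"
begin

sublocale tensor_pair k A B
  by (intro tensor_pair.intro A.left_module_k B.left_module_k)

definition L :: "'a \<Rightarrow> 'b \<Rightarrow> ('a \<times> 'b \<Rightarrow>\<^sub>0 int) set \<Rightarrow> ('a \<times> 'b \<Rightarrow>\<^sub>0 int) set" where
  "L a b = tensor_lift k A B T (\<lambda>a' b'. pure (a \<otimes>\<^bsub>A\<^esub> a') (b \<otimes>\<^bsub>B\<^esub> b'))"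
definition mul :: "('a \<times> 'b \<Rightarrow>\<^sub>0 int) set \<Rightarrow> ('a \<times> 'b \<Rightarrow>\<^sub>0 int) set \<Rightarrow> ('a \<times> 'b \<Rightarrow>\<^sub>0 int) set" where
  "mul s t = tensor_lift k A B T (\<lambda>a b. L a b t) s"

lemma L:
  assumes "a \<in> carrier A" "b \<in> carrier B"
  shows "L a b \<in> additive_maps T T"
    and "a' \<in> carrier A \<Longrightarrow> b' \<in> carrier B \<Longrightarrow> L a b (pure a' b') = pure (a \<otimes>\<^bsub>A\<^esub> a') (b \<otimes>\<^bsub>B\<^esub> b')"
proof -
  have "balanced T (\<lambda>a' b'. pure (a \<otimes>\<^bsub>A\<^esub> a') (b \<otimes>\<^bsub>B\<^esub> b'))"
    using assms unfolding balanced_def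
    by (auto simp: A.A.r_distr B.A.r_distr pure_add_l pure_add_r A.smult_mult_r B.smult_mult_r pure_balanced)
  from tensor_lift[OF T.abelian_group_axioms this]
  show "L a b \<in> additive_maps T T"
    and "a' \<in> carrier A \<Longrightarrow> b' \<in> carrier B \<Longrightarrow> L a b (pure a' b') = pure (a \<otimes>\<^bsub>A\<^esub> a') (b \<otimes>\<^bsub>B\<^esub> b')"
    unfolding L_def by auto
qed

lemma L_closed: "a \<in> carrier A \<Longrightarrow> b \<in> carrier B \<Longrightarrow> t \<in> carrier T \<Longrightarrow> L a b t \<in> carrier T"
  using additive_maps_props(4)[OF T.abelian_group_axioms T.abelian_group_axioms L(1)] .

lemma mul:
  assumes t: "t \<in> carrier T"
  shows "(\<lambda>s. mul s t) \<in> additive_maps T T"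
    and "a \<in> carrier A \<Longrightarrow> b \<in> carrier B \<Longrightarrow> mul (pure a b) t = L a b t"
proof -
  note eq = tensor_hom_eqI[OF T.abelian_group_axioms _ _ _ t]
  have "balanced T (\<lambda>a b. L a b t)"
    unfolding balanced_def
  proof (intro conjI ballI)
    fix a a' b assume *: "a \<in> carrier A" "a' \<in> carrier A" "b \<in> carrier B"
    show "L (a \<oplus>\<^bsub>A\<^esub> a') b t = L a b t \<oplus>\<^bsub>T\<^esub> L a' b t"
      by (rule eq) (use * in \<open>auto intro!: L additive_maps_add[OF T.abelian_group_axioms] simp: L A.A.l_distr pure_add_l\<close>)
  next
    fix a b b' assume *: "a \<in> carrier A" "b \<in> carrier B" "b' \<in> carrier B"
    show "L a (b \<oplus>\<^bsub>B\<^esub> b') t = L a b t \<oplus>\<^bsub>T\<^esub> L a b' t"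
      by (rule eq) (use * in \<open>auto intro!: L additive_maps_add[OF T.abelian_group_axioms] simp: L B.A.l_distr pure_add_r\<close>)
  next
    fix c a b assume *: "c \<in> carrier k" "a \<in> carrier A" "b \<in> carrier B"
    show "L (c \<odot>\<^bsub>A\<^esub> a) b t = L a (c \<odot>\<^bsub>B\<^esub> b) t"
      by (rule eq) (use * in \<open>auto intro!: L simp: L A.smult_mult_l B.smult_mult_l pure_balanced\<close>)
  qed (use L_closed t in auto)
  from tensor_lift[OF T.abelian_group_axioms this]
  show "(\<lambda>s. mul s t) \<in> additive_maps T T"
    and "a \<in> carrier A \<Longrightarrow> b \<in> carrier B \<Longrightarrow> mul (pure a b) t = L a b t"
    unfolding mul_def by auto
qed

lemma mul_closed: "s \<in> carrier T \<Longrightarrow> t \<in> carrier T \<Longrightarrow> mul s t \<in> carrier T"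
  using additive_maps_props(4)[OF T.abelian_group_axioms T.abelian_group_axioms mul(1)] .

lemma mul_r: 
  assumes s: "s \<in> carrier T"
  shows "mul s \<in> additive_maps T T"
proof -
  note eq = tensor_hom_eqI[OF T.abelian_group_axioms _ _ _ s]
  have "mul s (t \<oplus>\<^bsub>T\<^esub> t') = mul s t \<oplus>\<^bsub>T\<^esub> mul s t'" if *: "t \<in> carrier T" "t' \<in> carrier T" for t t'
  proof (rule eq)
    fix a b assume "a \<in> carrier A" "b \<in> carrier B"
    then show "mul (pure a b) (t \<oplus>\<^bsub>T\<^esub> t') = mul (pure a b) t \<oplus>\<^bsub>T\<^esub> mul (pure a b) t'"
      using * additive_maps_props(2)[OF T.abelian_group_axioms T.abelian_group_axioms L(1)] by (simp add: mul)
  qed (use * in \<open>auto intro!: mul additive_maps_add[OF T.abelian_group_axioms]\<close>)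
  then show ?thesis using s mul_closed by (fastforce simp: additive_maps_def)
qed

lemma mul_assoc:
  assumes s: "s \<in> carrier T" and t: "t \<in> carrier T" and u: "u \<in> carrier T"
  shows "mul (mul s t) u = mul s (mul t u)"
proof (rule tensor_hom_eqI[OF T.abelian_group_axioms _ _ _ s])
  fix a b assume ab: "a \<in> carrier A" "b \<in> carrier B"
  have "mul (L a b t) u = L a b (mul t u)"
  proof (rule tensor_hom_eqI[OF T.abelian_group_axioms _ _ _ t])
    fix c d assume cd: "c \<in> carrier A" "d \<in> carrier B"
    have "L (a \<otimes>\<^bsub>A\<^esub> c) (b \<otimes>\<^bsub>B\<^esub> d) u = L a b (L c d u)"
      by (rule tensor_hom_eqI[OF T.abelian_group_axioms _ _ _ u])
        (use ab cd in \<open>auto intro!: L additive_maps_comp[OF L(1) L(1)] simp: L A.A.m_assoc B.A.m_assoc\<close>)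
    then show "mul (L a b (pure c d)) u = L a b (mul (pure c d) u)"
      using ab cd u by (simp add: L mul)
  qed (use ab u in \<open>auto intro!: additive_maps_comp[OF mul(1) L(1)] additive_maps_comp[OF L(1) mul(1)]\<close>)
  then show "mul (mul (pure a b) t) u = mul (pure a b) (mul t u)"
    using ab t u by (simp add: mul mul_closed)
qed (use t u in \<open>auto intro!: mul mul_closed additive_maps_comp[OF mul(1) mul(1)]\<close>)

lemma tensor_algebra_simps:
  "carrier (tensor_algebra k A B) = carrier T" "\<zero>\<^bsub>tensor_algebra k A B\<^esub> = \<zero>\<^bsub>T\<^esub>"
  "add (tensor_algebra k A B) = add T" "\<one>\<^bsub>tensor_algebra k A B\<^esub> = pure \<one>\<^bsub>A\<^esub> \<one>\<^bsub>B\<^esub>"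
  "monoid.mult (tensor_algebra k A B) = mul"
  by (simp_all add: tensor_algebra_def Let_def mul_def L_def fun_eq_iff)

lemma mul_one: 
  assumes "t \<in> carrier T"
  shows "mul (pure \<one>\<^bsub>A\<^esub> \<one>\<^bsub>B\<^esub>) t = t" "mul t (pure \<one>\<^bsub>A\<^esub> \<one>\<^bsub>B\<^esub>) = t"
proof -
  have "L \<one>\<^bsub>A\<^esub> \<one>\<^bsub>B\<^esub> t = t"
    by (rule tensor_hom_eqI[OF T.abelian_group_axioms L(1) _ _ assms]) (auto simp: L additive_maps_def)
  with assms show "mul (pure \<one>\<^bsub>A\<^esub> \<one>\<^bsub>B\<^esub>) t = t" by (simp add: mul)
  show "mul t (pure \<one>\<^bsub>A\<^esub> \<one>\<^bsub>B\<^esub>) = t"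
    by (rule tensor_hom_eqI[OF T.abelian_group_axioms mul(1) _ _ assms]) (auto simp: mul L additive_maps_def)
qed

lemma ring_tensor_algebra: "ring (tensor_algebra k A B)"
proof (rule ringI)
  show "abelian_group (tensor_algebra k A B)"
    by (rule abelian_groupI) (use T.l_neg T.a_inv_closed in \<open>fastforce simp: tensor_algebra_simps T.a_ac\<close>)+
  show "monoid (tensor_algebra k A B)"
    by (rule monoidI) (simp_all add: tensor_algebra_simps mul_closed mul_assoc mul_one)
qed (use additive_maps_props(2)[OF T.abelian_group_axioms T.abelian_group_axioms mul(1)]
      additive_maps_props(2)[OF T.abelian_group_axioms T.abelian_group_axioms mul_r] in
      \<open>auto simp: tensor_algebra_simps\<close>)

end

theorem (in fd_algebra) ring_enveloping_algebra: "ring (enveloping_algebra k A)"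
proof -
  interpret two_algebras k A "op_ring A"
    using fd_algebra_op_ring fd_algebra_axioms by (simp add: two_algebras_def)
  show ?thesis unfolding enveloping_algebra_def by (rule ring_tensor_algebra)
qed


lemma right_mod_simps [simp]:
  "carrier (right_mod M) = carrier M" "\<zero>\<^bsub>right_mod M\<^esub> = \<zero>\<^bsub>M\<^esub>"
  "x \<oplus>\<^bsub>right_mod M\<^esub> y = x \<oplus>\<^bsub>M\<^esub> y" "b \<odot>\<^bsub>right_mod M\<^esub> x = rsmult M x b"
  by (simp_all add: right_mod_def)

lemma left_module_cong:
  assumes "left_module R M" "carrier M' = carrier M" "ring.zero M' = ring.zero M" "add M' = add M"
    "\<And>a x. a \<in> carrier R \<Longrightarrow> x \<in> carrier M \<Longrightarrow> a \<odot>\<^bsub>M'\<^esub> x = a \<odot>\<^bsub>M\<^esub> x"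
  shows "left_module R M'"
proof -
  interpret left_module R M by fact
  have "abelian_group M'"
    by (rule abelian_groupI) (use assms M.l_neg M.a_inv_closed in \<open>fastforce simp: M.a_ac\<close>)+
  then show ?thesis
    unfolding left_module_def left_module_axioms_def using assms(2-) R.ring_axioms
    by (auto simp: smult_l_distr smult_r_distr smult_assoc1)
qed

lemma left_module_bimodule: "left_module A M \<Longrightarrow> 
  left_module A \<lparr>carrier = carrier M, monoid.mult = p, one = q, ring.zero = \<zero>\<^bsub>M\<^esub>, add = add M, smult = smult M\<rparr>"
  by (erule left_module_cong) auto

context bimodule_over begin

lemma rs:
  "m \<in> carrier M \<Longrightarrow> b \<in> carrier B \<Longrightarrow> rsmult M m b \<in> carrier M"
  "m \<in> carrier M \<Longrightarrow> n \<in> carrier M \<Longrightarrow> b \<in> carrier B \<Longrightarrow> rsmult M (m \<oplus>\<^bsub>M\<^esub> n) b = rsmult M m b \<oplus>\<^bsub>M\<^esub> rsmult M n b"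
  "m \<in> carrier M \<Longrightarrow> b \<in> carrier B \<Longrightarrow> c \<in> carrier B \<Longrightarrow> rsmult M m (b \<oplus>\<^bsub>B\<^esub> c) = rsmult M m b \<oplus>\<^bsub>M\<^esub> rsmult M m c"
  "m \<in> carrier M \<Longrightarrow> b \<in> carrier B \<Longrightarrow> c \<in> carrier B \<Longrightarrow> rsmult M m (b \<otimes>\<^bsub>B\<^esub> c) = rsmult M (rsmult M m b) c"
  "m \<in> carrier M \<Longrightarrow> rsmult M m \<one>\<^bsub>B\<^esub> = m"
  using right.smult_closed[of b m] right.smult_r_distr[of b m n] right.smult_l_distr[of b c m]
    right.smult_assoc1[of c b m] right.smult_one[of m] by simp_all

end

theorem (in fd_algebra) bimodule_over_regular: "bimodule_over k A A (regular_bimodule A)"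
proof -
  interpret op: ring "op_ring A" using ring_op_ring[OF A.ring_axioms] .
  have ab: "abelian_group (regular_bimodule A)" "abelian_group (right_mod (regular_bimodule A))"
    unfolding regular_bimodule_def right_mod_def
    by (rule abelian_groupI; use A.l_neg A.a_inv_closed in \<open>fastforce simp: A.a_ac\<close>)+
  have "(c \<odot>\<^bsub>A\<^esub> \<one>\<^bsub>A\<^esub>) \<otimes>\<^bsub>A\<^esub> m = m \<otimes>\<^bsub>A\<^esub> (c \<odot>\<^bsub>A\<^esub> \<one>\<^bsub>A\<^esub>)" if "c \<in> carrier k" "m \<in> carrier A" for c m
    using that by (simp add: smult_mult_l smult_mult_r)
  then show ?thesis
    unfolding bimodule_over_def bimodule_over_axioms_def left_module_def left_module_axioms_def
    using ab A.ring_axioms op.ring_axioms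
    by (auto simp: regular_bimodule_def right_mod_def A.l_distr A.r_distr A.m_assoc)
qed

theorem (in fd_algebra) left_module_enveloping_module:
  assumes "bimodule_over k A A X"
  shows "left_module (enveloping_algebra k A) (enveloping_module k A X)"
    "\<And>a b x. a \<in> carrier A \<Longrightarrow> b \<in> carrier A \<Longrightarrow> x \<in> carrier X \<Longrightarrow>
       pure_tensor k A (op_ring A) a b \<odot>\<^bsub>enveloping_module k A X\<^esub> x = a \<odot>\<^bsub>X\<^esub> rsmult X x b"
proof -
  interpret X: bimodule_over k A A X by fact
  interpret E: two_algebras k A "op_ring A"
    using fd_algebra_op_ring fd_algebra_axioms by (simp add: two_algebras_def)
  define act where "act t x = tensor_lift k A (op_ring A) X (\<lambda>a b. a \<odot>\<^bsub>X\<^esub> rsmult X x b) t" for t x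
  note XA = X.M.abelian_group_axioms and TA = E.T.abelian_group_axioms
  note Xs = X.smult_closed X.smult_l_distr X.smult_r_distr X.smult_assoc1
  have c: "(c \<odot>\<^bsub>A\<^esub> a) \<odot>\<^bsub>X\<^esub> rsmult X x b = a \<odot>\<^bsub>X\<^esub> rsmult X x (c \<odot>\<^bsub>A\<^esub> b)"
    if "c \<in> carrier k" "a \<in> carrier A" "b \<in> carrier A" "x \<in> carrier X" for c a b x
  proof -
    have "c \<odot>\<^bsub>A\<^esub> a = a \<otimes>\<^bsub>A\<^esub> (c \<odot>\<^bsub>A\<^esub> \<one>\<^bsub>A\<^esub>)" "c \<odot>\<^bsub>A\<^esub> b = b \<otimes>\<^bsub>A\<^esub> (c \<odot>\<^bsub>A\<^esub> \<one>\<^bsub>A\<^esub>)"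
      using that by (simp_all add: smult_mult_r)
    then show ?thesis using that by (simp add: X.rs Xs X.central)
  qed
  have bal: "E.balanced X (\<lambda>a b. a \<odot>\<^bsub>X\<^esub> rsmult X x b)" if "x \<in> carrier X" for x
    using that by (auto simp: E.balanced_def X.rs Xs c)
  have act: "(\<lambda>t. act t x) \<in> additive_maps E.T X" if "x \<in> carrier X" for x
    using E.tensor_lift(1)[OF XA bal[OF that]] unfolding act_def .
  have act_pure: "act (E.pure a b) x = a \<odot>\<^bsub>X\<^esub> rsmult X x b"
    if "x \<in> carrier X" "a \<in> carrier A" "b \<in> carrier A" for a b x
    using E.tensor_lift(2)[OF XA bal[OF that(1)]] that unfolding act_def by simp
  have act_closed: "act t x \<in> carrier X" if "t \<in> carrier E.T" "x \<in> carrier X" for t x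
    using additive_maps_props(4)[OF TA XA act] that by blast
  have act_r: "act t (x \<oplus>\<^bsub>X\<^esub> y) = act t x \<oplus>\<^bsub>X\<^esub> act t y"
    if "t \<in> carrier E.T" "x \<in> carrier X" "y \<in> carrier X" for t x y
    by (rule E.tensor_hom_eqI[OF XA _ _ _ that(1)])
      (use that in \<open>auto intro!: act additive_maps_add[OF XA] simp: act_pure X.rs Xs\<close>)
  have act_assoc: "act (E.mul s t) x = act s (act t x)"
    if s: "s \<in> carrier E.T" and t: "t \<in> carrier E.T" and x: "x \<in> carrier X" for s t x
  proof (rule E.tensor_hom_eqI[OF XA _ _ _ s])
    fix a b assume ab: "a \<in> carrier A" "b \<in> carrier (op_ring A)"
    have h: "(\<lambda>y. a \<odot>\<^bsub>X\<^esub> rsmult X y b) \<in> additive_maps X X"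
      using ab by (auto simp: additive_maps_def X.rs Xs)
    have "act (E.L a b t) x = a \<odot>\<^bsub>X\<^esub> rsmult X (act t x) b"
      by (rule E.tensor_hom_eqI[OF XA _ _ _ t])
        (use ab x in \<open>auto intro!: additive_maps_comp[OF act h] additive_maps_comp[OF E.L(1) act] simp: E.L act_pure X.rs Xs X.smult_rsmult\<close>)
    then show "act (E.mul (E.pure a b) t) x = act (E.pure a b) (act t x)"
      using ab t x by (simp add: E.mul act_pure act_closed)
  qed (use t x in \<open>auto intro!: act act_closed additive_maps_comp[OF E.mul(1) act]\<close>)
  have X': "abelian_group (enveloping_module k A X)"
    by (rule abelian_groupI) (use X.M.l_neg X.M.a_inv_closed in
      \<open>fastforce simp: enveloping_module_def X.M.a_ac\<close>)+
  have sm: "t \<odot>\<^bsub>enveloping_module k A X\<^esub> x = act t x" for t x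
    by (simp add: enveloping_module_def act_def)
  show "left_module (enveloping_algebra k A) (enveloping_module k A X)"
    unfolding left_module_def left_module_axioms_def sm
    using X' ring_enveloping_algebra act_closed act_r act_assoc act_pure additive_maps_props(2)[OF TA XA act]
    by (simp add: E.tensor_algebra_simps enveloping_algebra_def) (simp add: enveloping_module_def X.rs)
  show "\<And>a b x. a \<in> carrier A \<Longrightarrow> b \<in> carrier A \<Longrightarrow> x \<in> carrier X \<Longrightarrow>
       E.pure a b \<odot>\<^bsub>enveloping_module k A X\<^esub> x = a \<odot>\<^bsub>X\<^esub> rsmult X x b"
    by (simp add: sm act_pure)
qed

theorem bimodule_over_tensor_bimodule:
  assumes "fd_algebra k A" "fd_algebra k B" "fd_algebra k C"
    and M: "bimodule_over k A B M" and N: "bimodule_over k B C N"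
  shows "bimodule_over k A C (tensor_bimodule B M N)"
    "\<And>a m n. a \<in> carrier A \<Longrightarrow> m \<in> carrier M \<Longrightarrow> n \<in> carrier N \<Longrightarrow>
       a \<odot>\<^bsub>tensor_bimodule B M N\<^esub> pure_tensor B (right_mod M) N m n = pure_tensor B (right_mod M) N (a \<odot>\<^bsub>M\<^esub> m) n"
    "\<And>c m n. c \<in> carrier C \<Longrightarrow> m \<in> carrier M \<Longrightarrow> n \<in> carrier N \<Longrightarrow>
       rsmult (tensor_bimodule B M N) (pure_tensor B (right_mod M) N m n) c = pure_tensor B (right_mod M) N m (rsmult N n c)"
proof -
  interpret A: fd_algebra k A by fact
  interpret B: fd_algebra k B by fact
  interpret C: fd_algebra k C by fact
  interpret M: bimodule_over k A B M by fact
  interpret N: bimodule_over k B C N by fact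
  interpret Q: tensor_pair B "right_mod M" N
    by (intro tensor_pair.intro M.right.left_module_axioms N.left_module_axioms)
  note TA = Q.T.abelian_group_axioms
  note Ms = M.smult_closed M.smult_l_distr M.smult_r_distr M.smult_assoc1 M.rs M.smult_rsmult
  note Ns = N.smult_closed N.smult_l_distr N.smult_r_distr N.smult_assoc1 N.rs N.smult_rsmult
  note pure = Q.pure_add_l Q.pure_add_r Q.pure_balanced
  define l where "l a = tensor_lift B (right_mod M) N Q.T (\<lambda>m n. Q.pure (a \<odot>\<^bsub>M\<^esub> m) n)" for a
  define r where "r t c = tensor_lift B (right_mod M) N Q.T (\<lambda>m n. Q.pure m (rsmult N n c)) t" for t c
  have bl: "Q.balanced Q.T (\<lambda>m n. Q.pure (a \<odot>\<^bsub>M\<^esub> m) n)" if "a \<in> carrier A" for a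
  proof -
    have "Q.pure (a \<odot>\<^bsub>M\<^esub> rsmult M m b) n = Q.pure (a \<odot>\<^bsub>M\<^esub> m) (b \<odot>\<^bsub>N\<^esub> n)"
      if "b \<in> carrier B" "m \<in> carrier M" "n \<in> carrier N" for b m n
      using that \<open>a \<in> carrier A\<close> Q.pure_balanced[of "a \<odot>\<^bsub>M\<^esub> m" n b] by (simp add: Ms)
    then show ?thesis
      unfolding Q.balanced_def using that Q.pure_add_l by (simp add: Ms Ns Q.pure_add_r)
  qed
  have br: "Q.balanced Q.T (\<lambda>m n. Q.pure m (rsmult N n c))" if "c \<in> carrier C" for c
  proof -
    have "Q.pure (rsmult M m b) (rsmult N n c) = Q.pure m (rsmult N (b \<odot>\<^bsub>N\<^esub> n) c)"
      if "b \<in> carrier B" "m \<in> carrier M" "n \<in> carrier N" for b m n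
      using that \<open>c \<in> carrier C\<close> Q.pure_balanced[of m "rsmult N n c" b] by (simp add: Ns)
    then show ?thesis
      unfolding Q.balanced_def using that Q.pure_add_l by (simp add: Ms Ns Q.pure_add_r)
  qed
  have l: "l a \<in> additive_maps Q.T Q.T" if "a \<in> carrier A" for a
    using Q.tensor_lift(1)[OF TA bl] that unfolding l_def by blast
  have r: "(\<lambda>t. r t c) \<in> additive_maps Q.T Q.T" if "c \<in> carrier C" for c
    using Q.tensor_lift(1)[OF TA br] that unfolding r_def by blast
  have lp: "l a (Q.pure m n) = Q.pure (a \<odot>\<^bsub>M\<^esub> m) n" if "a \<in> carrier A" "m \<in> carrier M" "n \<in> carrier N" for a m n
    using Q.tensor_lift(2)[OF TA bl] that unfolding l_def by simp
  have rp: "r (Q.pure m n) c = Q.pure m (rsmult N n c)" if "c \<in> carrier C" "m \<in> carrier M" "n \<in> carrier N" for c m n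
    using Q.tensor_lift(2)[OF TA br] that unfolding r_def by simp
  note eq = Q.tensor_hom_eqI[OF TA]
  note hp = additive_maps_add[OF TA]
  have idh: "(\<lambda>t. t) \<in> additive_maps Q.T Q.T" by (simp add: additive_maps_def)
  let ?T = "tensor_bimodule B M N"
  have simps: "carrier ?T = carrier Q.T" "\<zero>\<^bsub>?T\<^esub> = \<zero>\<^bsub>Q.T\<^esub>" "add ?T = add Q.T"
    "\<And>a t. a \<odot>\<^bsub>?T\<^esub> t = l a t" "\<And>t c. rsmult ?T t c = r t c"
    by (simp_all add: tensor_bimodule_def Let_def l_def r_def)
  have ab: "abelian_group ?T" "abelian_group (right_mod ?T)"
    by (rule abelian_groupI; use Q.T.l_neg Q.T.a_inv_closed in \<open>fastforce simp: simps Q.T.a_ac\<close>)+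
  have l1: "l (a \<oplus>\<^bsub>A\<^esub> b) t = l a t \<oplus>\<^bsub>Q.T\<^esub> l b t" if "a \<in> carrier A" "b \<in> carrier A" "t \<in> carrier Q.T" for a b t
    by (rule eq[OF _ _ _ that(3)]) (use that Q.pure_add_l in \<open>auto intro!: l hp simp: lp Ms\<close>)
  have l2: "l (a \<otimes>\<^bsub>A\<^esub> b) t = l a (l b t)" if "a \<in> carrier A" "b \<in> carrier A" "t \<in> carrier Q.T" for a b t
    by (rule eq[OF _ _ _ that(3)]) (use that in \<open>auto intro!: l additive_maps_comp[OF l l] simp: lp Ms\<close>)
  have l3: "l \<one>\<^bsub>A\<^esub> t = t" if "t \<in> carrier Q.T" for t
    by (rule eq[OF _ _ _ that]) (use that in \<open>auto intro!: l idh simp: lp Ms\<close>)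
  have r1: "r t (a \<oplus>\<^bsub>C\<^esub> b) = r t a \<oplus>\<^bsub>Q.T\<^esub> r t b" if "a \<in> carrier C" "b \<in> carrier C" "t \<in> carrier Q.T" for a b t
    by (rule eq[OF _ _ _ that(3)]) (use that Q.pure_add_r in \<open>auto intro!: r hp simp: rp Ns\<close>)
  have r2: "r t (a \<otimes>\<^bsub>C\<^esub> b) = r (r t a) b" if "a \<in> carrier C" "b \<in> carrier C" "t \<in> carrier Q.T" for a b t
    by (rule eq[OF _ _ _ that(3)]) (use that in \<open>auto intro!: r additive_maps_comp[OF r r] simp: rp Ns\<close>)
  have r3: "r t \<one>\<^bsub>C\<^esub> = t" if "t \<in> carrier Q.T" for t
    by (rule eq[OF _ _ _ that]) (use that in \<open>auto intro!: r idh simp: rp Ns\<close>)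
  have lr: "r (l a t) c = l a (r t c)" if "a \<in> carrier A" "c \<in> carrier C" "t \<in> carrier Q.T" for a c t
    by (rule eq[OF _ _ _ that(3)]) (use that in \<open>auto intro!: additive_maps_comp[OF l r] additive_maps_comp[OF r l] simp: lp rp Ms Ns\<close>)
  have ce: "l (c \<odot>\<^bsub>A\<^esub> \<one>\<^bsub>A\<^esub>) t = r t (c \<odot>\<^bsub>C\<^esub> \<one>\<^bsub>C\<^esub>)" if "c \<in> carrier k" "t \<in> carrier Q.T" for c t
  proof (rule eq[OF _ _ _ that(2)])
    fix m n assume mn: "m \<in> carrier (right_mod M)" "n \<in> carrier N"
    have "Q.pure (rsmult M m (c \<odot>\<^bsub>B\<^esub> \<one>\<^bsub>B\<^esub>)) n = Q.pure m ((c \<odot>\<^bsub>B\<^esub> \<one>\<^bsub>B\<^esub>) \<odot>\<^bsub>N\<^esub> n)"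
      using Q.pure_balanced[of m n "c \<odot>\<^bsub>B\<^esub> \<one>\<^bsub>B\<^esub>"] mn that by simp
    then show "l (c \<odot>\<^bsub>A\<^esub> \<one>\<^bsub>A\<^esub>) (Q.pure m n) = r (Q.pure m n) (c \<odot>\<^bsub>C\<^esub> \<one>\<^bsub>C\<^esub>)"
      using mn that by (simp add: lp rp M.central N.central)
  qed (use that in \<open>auto intro!: l r\<close>)
  show "bimodule_over k A C ?T"
    unfolding bimodule_over_def bimodule_over_axioms_def left_module_def left_module_axioms_def
    using ab A.A.ring_axioms ring_op_ring[OF C.A.ring_axioms] l1 l2 l3 r1 r2 r3 lr ce
      additive_maps_props(2,4)[OF TA TA l] additive_maps_props(2,4)[OF TA TA r]
    by (simp add: simps)
  show "\<And>a m n. a \<in> carrier A \<Longrightarrow> m \<in> carrier M \<Longrightarrow> n \<in> carrier N \<Longrightarrow>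
       a \<odot>\<^bsub>?T\<^esub> Q.pure m n = Q.pure (a \<odot>\<^bsub>M\<^esub> m) n"
    by (simp add: simps lp)
  show "\<And>c m n. c \<in> carrier C \<Longrightarrow> m \<in> carrier M \<Longrightarrow> n \<in> carrier N \<Longrightarrow>
       rsmult ?T (Q.pure m n) c = Q.pure m (rsmult N n c)"
    by (simp add: simps rp)
qed

end

theory Submission
  imports Defs
begin

text \<open>Write \<open>S = \<Gamma>\<^sup>e\<close>, \<open>R = \<Lambda>\<^sup>e\<close> and let \<open>(M, N)\<close> define the singular equivalence. The functor
  \<open>F(Y) = N \<otimes>\<^sub>\<Lambda> Y \<otimes>\<^sub>\<Lambda> M\<close> from \<open>R\<close>-modules to \<open>S\<close>-modules is exact and preserves finitely generated
  projectives, because \<open>N\<close> and \<open>M\<close> are finitely generated projective on both sides, and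
  \<open>F(\<Lambda>) \<cong> N \<otimes>\<^sub>\<Lambda> M\<close> is stably isomorphic to \<open>\<Omega>\<^sup>l(\<Gamma>)\<close>. It therefore turns a minimal projective resolution
  of \<open>\<Lambda>\<close> into a projective resolution of \<open>F(\<Lambda>)\<close>, and comparing this one with a minimal resolution of
  \<open>\<Omega>\<^sup>l(\<Gamma>)\<close> shows that \<open>F(\<Omega>\<^sup>n(\<Lambda>))\<close> is stably isomorphic to \<open>\<Omega>\<^sup>n\<^sup>+\<^sup>l(\<Gamma>)\<close> for all \<open>n\<close> (lemma \<open>F_syzygy\<close>).

  An isomorphism \<open>\<Omega>\<^sup>n(\<Lambda>) \<cong> \<Omega>\<^sup>n\<^sup>+\<^sup>p(\<Lambda>)\<close> thus gives a stable isomorphism of \<open>\<Omega>\<^sup>n\<^sup>+\<^sup>l(\<Gamma>)\<close> and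
  \<open>\<Omega>\<^sup>n\<^sup>+\<^sup>p\<^sup>+\<^sup>l(\<Gamma>)\<close>. Stably isomorphic modules may differ by projective summands, but these vanish in
  the next minimal syzygy (theorem \<open>short_exact_superfluous_iso\<close>), so that the syzygies of \<open>\<Gamma>\<close>
  repeat with period \<open>p\<close> from degree \<open>n + l + 1\<close> on. The roles of \<open>\<Lambda>\<close> and \<open>\<Gamma>\<close> are symmetric: a
  vanishing syzygy of \<open>\<Gamma>\<close> would force the syzygies of \<open>\<Lambda>\<close> to vanish in high degrees, against
  periodicity, and a shift \<open>p\<close> is a period on one side if and only if it is one on the other.

  Stable isomorphisms are handled through maps of finite rank \<open>x \<mapsto> \<Sum>\<^sub>i \<phi>\<^sub>i(x) y\<^sub>i\<close>, which on finitely
  generated modules are the maps that factor through a projective module. A module is finitely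
  generated projective precisely when its identity has finite rank, so that exactness of \<open>F\<close> and
  preservation of projectives both become statements about such maps and are proved by induction
  on the number of summands. For \<open>F\<close> itself one tensor product suffices:
  \<open>F(Y) = U \<otimes>\<^sub>R Y\<close> for the \<open>S\<close>-\<open>R\<close>-bimodule \<open>U = N \<otimes>\<^sub>k M\<close>. Finally, minimal resolutions exist because
  enveloping algebras are finite dimensional; finite length is used in the form of a strictly
  monotone \<open>\<nat>\<close>-valued function on submodules.\<close>

section \<open>Homomorphisms of modules\<close>

lemma mod_homI:
  assumes "\<And>x. x \<in> carrier M \<Longrightarrow> f x \<in> carrier N"
    and "\<And>x y. x \<in> carrier M \<Longrightarrow> y \<in> carrier M \<Longrightarrow> f (x \<oplus>\<^bsub>M\<^esub> y) = f x \<oplus>\<^bsub>N\<^esub> f y"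
    and "\<And>a x. a \<in> carrier R \<Longrightarrow> x \<in> carrier M \<Longrightarrow> f (a \<odot>\<^bsub>M\<^esub> x) = a \<odot>\<^bsub>N\<^esub> f x"
  shows "f \<in> mod_hom R M N"
  using assms by (auto simp: mod_hom_def additive_maps_def)

lemma mod_hom_comp:
  assumes "f \<in> mod_hom R M N" "g \<in> mod_hom R N L"
  shows "(\<lambda>x. g (f x)) \<in> mod_hom R M L"
  using mod_homD[OF assms(1)] mod_homD[OF assms(2)] by (intro mod_homI) auto

lemma mod_hom_cong:
  assumes "left_module R M" "f \<in> mod_hom R M N" "\<And>x. x \<in> carrier M \<Longrightarrow> g x = f x"
  shows "g \<in> mod_hom R M N"
proof -
  interpret M: left_module R M by fact
  show ?thesis using mod_homD[OF assms(2)] assms(3) by (intro mod_homI) auto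
qed

lemma mod_hom_ident: "(\<lambda>x. x) \<in> mod_hom R M M"
  by (intro mod_homI) auto

lemma mod_hom_factor_inj:
  assumes "left_module R M" "left_module R N" "f \<in> mod_hom R M N" "inj_on f (carrier M)"
    "g \<in> mod_hom R L N" "\<And>x. x \<in> carrier L \<Longrightarrow> g x \<in> f ` carrier M" "left_module R L"
  obtains h where "h \<in> mod_hom R L M" "\<And>x. x \<in> carrier L \<Longrightarrow> f (h x) = g x"
proof -
  interpret M: left_module R M by fact
  interpret N: left_module R N by fact
  interpret L: left_module R L by fact
  note f = mod_homD[OF assms(3)] and g = mod_homD[OF assms(5)]
  define h where "h x = inv_into (carrier M) f (g x)" for x
  have h: "h x \<in> carrier M" "f (h x) = g x" if "x \<in> carrier L" for x
    using assms(6)[OF that] unfolding h_def by (auto intro: inv_into_into f_inv_into_f)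
  have eq: "h x = m" if "x \<in> carrier L" "m \<in> carrier M" "f m = g x" for x m
    using h[OF that(1)] that assms(4) by (metis inj_onD)
  have "h \<in> mod_hom R L M"
    by (rule mod_homI; (rule eq)?) (use h f g in auto)
  with h that show ?thesis by blast
qed

lemma mod_iso_refl: "left_module R M \<Longrightarrow> mod_iso R M M"
  unfolding mod_iso_def by (auto intro!: bexI[OF _ mod_hom_ident] simp: bij_betw_def inj_on_def)

lemma mod_iso_trans: "mod_iso R M N \<Longrightarrow> mod_iso R N L \<Longrightarrow> mod_iso R M L"
  unfolding mod_iso_def
proof (elim conjE bexE, intro conjI)
  fix f g assume "f \<in> mod_hom R M N" "g \<in> mod_hom R N L" "bij_betw f (carrier M) (carrier N)" "bij_betw g (carrier N) (carrier L)"
  then show "\<exists>f\<in>mod_hom R M L. bij_betw f (carrier M) (carrier L)"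
    using bij_betw_trans[of f _ _ g] by (intro bexI[OF _ mod_hom_comp[of f _ _ N g]]) (auto simp: comp_def)
qed

lemma mod_isoE:
  assumes "mod_iso R M N"
  obtains f g where "f \<in> mod_hom R M N" "g \<in> mod_hom R N M"
    "\<And>x. x \<in> carrier M \<Longrightarrow> g (f x) = x" "\<And>y. y \<in> carrier N \<Longrightarrow> f (g y) = y"
proof -
  obtain f where f: "left_module R M" "left_module R N" "f \<in> mod_hom R M N" "bij_betw f (carrier M) (carrier N)"
    using assms by (auto simp: mod_iso_def)
  obtain h where h: "h \<in> mod_hom R N M" "\<And>x. x \<in> carrier N \<Longrightarrow> f (h x) = x"
    using mod_hom_factor_inj[OF f(1,2,3) _ mod_hom_ident[of R N] _ f(2)] f(4) by (auto simp: bij_betw_def)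
  have "h (f x) = x" if "x \<in> carrier M" for x
    using h(2)[of "f x"] f(4) mod_homD(1)[OF f(3)] mod_homD(1)[OF h(1)] that
    by (metis bij_betw_imp_inj_on inj_onD)
  with f h that show ?thesis by blast
qed

lemma mod_isoI:
  assumes "left_module R M" "left_module R N" "f \<in> mod_hom R M N" "g \<in> mod_hom R N M"
    "\<And>x. x \<in> carrier M \<Longrightarrow> g (f x) = x" "\<And>y. y \<in> carrier N \<Longrightarrow> f (g y) = y"
  shows "mod_iso R M N"
  unfolding mod_iso_def using assms mod_homD(1)[OF assms(3)] mod_homD(1)[OF assms(4)]
  by (auto intro!: bexI[of _ f] bij_betw_byWitness[where f' = g])

lemma mod_iso_sym:
  assumes "mod_iso R M N" shows "mod_iso R N M"
proof -
  obtain f g where "f \<in> mod_hom R M N" "g \<in> mod_hom R N M"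
    "\<And>x. x \<in> carrier M \<Longrightarrow> g (f x) = x" "\<And>y. y \<in> carrier N \<Longrightarrow> f (g y) = y"
    by (rule mod_isoE[OF assms]) (rule that)
  then show ?thesis using assms mod_isoI[of R N M g f] by (simp add: mod_iso_def)
qed

lemma mod_hom_injI:
  assumes "left_module R M" "left_module R N" "f \<in> mod_hom R M N"
    and "\<And>x. x \<in> carrier M \<Longrightarrow> f x = \<zero>\<^bsub>N\<^esub> \<Longrightarrow> x = \<zero>\<^bsub>M\<^esub>"
  shows "inj_on f (carrier M)"
proof (rule inj_onI)
  interpret M: left_module R M by fact
  interpret N: left_module R N by fact
  have f: "f \<in> additive_maps M N" using assms(3) by (simp add: mod_hom_def)
  fix x y assume xy: "x \<in> carrier M" "y \<in> carrier M" "f x = f y"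
  have "f (x \<ominus>\<^bsub>M\<^esub> y) = f x \<ominus>\<^bsub>N\<^esub> f y"
    by (rule additive_maps_props(3)[OF M.M.abelian_group_axioms N.M.abelian_group_axioms f xy(1,2)])
  then have "f (x \<ominus>\<^bsub>M\<^esub> y) = \<zero>\<^bsub>N\<^esub>"
    using xy mod_homD(1)[OF assms(3)] by (simp add: N.M.minus_eq N.M.r_neg)
  then have "x \<oplus>\<^bsub>M\<^esub> \<ominus>\<^bsub>M\<^esub> y = \<zero>\<^bsub>M\<^esub>" using assms(4)[of "x \<ominus>\<^bsub>M\<^esub> y"] xy by (simp add: M.M.minus_eq)
  then have "\<ominus>\<^bsub>M\<^esub> (\<ominus>\<^bsub>M\<^esub> y) = x" using xy by (intro M.M.minus_equality) auto
  then show "x = y" using xy by simp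
qed

lemma (in left_module) mod_hom_uminus: "(\<lambda>x. \<ominus>\<^bsub>M\<^esub> x) \<in> mod_hom R M M"
proof (rule mod_homI)
  fix r x assume rx: "r \<in> carrier R" "x \<in> carrier M"
  have "r \<odot>\<^bsub>M\<^esub> \<ominus>\<^bsub>M\<^esub> x \<oplus>\<^bsub>M\<^esub> r \<odot>\<^bsub>M\<^esub> x = \<zero>\<^bsub>M\<^esub>"
    using rx smult_r_distr[of r "\<ominus>\<^bsub>M\<^esub> x" x] by (simp add: M.l_neg)
  then show "\<ominus>\<^bsub>M\<^esub> (r \<odot>\<^bsub>M\<^esub> x) = r \<odot>\<^bsub>M\<^esub> \<ominus>\<^bsub>M\<^esub> x"
    using rx by (intro M.minus_equality) auto
qed (auto simp: M.minus_add)

subsection \<open>Submodules\<close>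

text \<open>Closure under negation is automatic, since \<open>-x = (-1) x\<close>.\<close>

lemma (in left_module) submoduleI:
  assumes "H \<subseteq> carrier M" "\<zero>\<^bsub>M\<^esub> \<in> H" "\<And>x y. x \<in> H \<Longrightarrow> y \<in> H \<Longrightarrow> x \<oplus>\<^bsub>M\<^esub> y \<in> H"
    "\<And>a x. a \<in> carrier R \<Longrightarrow> x \<in> H \<Longrightarrow> a \<odot>\<^bsub>M\<^esub> x \<in> H"
  shows "submodule H R M"
proof -
  have "\<ominus>\<^bsub>M\<^esub> x \<in> H" if x: "x \<in> H" for x
  proof -
    have xc: "x \<in> carrier M" using x assms(1) by auto
    have "(\<ominus> \<one>) \<odot>\<^bsub>M\<^esub> x \<oplus>\<^bsub>M\<^esub> x = (\<ominus> \<one> \<oplus> \<one>) \<odot>\<^bsub>M\<^esub> x"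
      using xc smult_l_distr[of "\<ominus> \<one>" \<one> x] by simp
    also have "\<dots> = \<zero>\<^bsub>M\<^esub>" using xc by (simp add: R.l_neg)
    finally have "(\<ominus> \<one>) \<odot>\<^bsub>M\<^esub> x = \<ominus>\<^bsub>M\<^esub> x"
      using xc M.minus_equality[of "(\<ominus> \<one>) \<odot>\<^bsub>M\<^esub> x" x] by auto
    then show ?thesis using assms(4)[of "\<ominus> \<one>" x] x by simp
  qed
  then show ?thesis
    using assms by (auto intro!: submodule.intro subgroup.intro simp: submodule_axioms_def a_inv_def)
qed

lemma submoduleD:
  assumes "submodule H R M"
  shows "H \<subseteq> carrier M" "\<zero>\<^bsub>M\<^esub> \<in> H" "\<And>x y. x \<in> H \<Longrightarrow> y \<in> H \<Longrightarrow> x \<oplus>\<^bsub>M\<^esub> y \<in> H"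
    "\<And>a x. a \<in> carrier R \<Longrightarrow> x \<in> H \<Longrightarrow> a \<odot>\<^bsub>M\<^esub> x \<in> H" "\<And>x. x \<in> H \<Longrightarrow> \<ominus>\<^bsub>M\<^esub> x \<in> H"
  using assms by (auto simp: submodule_def submodule_axioms_def subgroup_def a_inv_def)

lemma left_module_submodule:
  assumes "left_module R M" "submodule H R M"
  shows "left_module R (M\<lparr>carrier := H\<rparr>)"
proof -
  interpret M: left_module R M by fact
  note H = submoduleD[OF assms(2)]
  have sub: "x \<in> H \<Longrightarrow> x \<in> carrier M" for x using H(1) by auto
  have "abelian_group (M\<lparr>carrier := H\<rparr>)"
  proof (rule abelian_groupI)
    fix x assume "x \<in> carrier (M\<lparr>carrier := H\<rparr>)"
    then show "\<exists>y\<in>carrier (M\<lparr>carrier := H\<rparr>). y \<oplus>\<^bsub>M\<lparr>carrier := H\<rparr>\<^esub> x = \<zero>\<^bsub>M\<lparr>carrier := H\<rparr>\<^esub>"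
      using H(5)[of x] M.M.l_neg[OF sub[of x]] by auto
  qed (use H sub in \<open>auto simp: M.M.a_ac\<close>)
  then show ?thesis
    unfolding left_module_def left_module_axioms_def
    using H sub M.R.ring_axioms by (auto simp: M.smult_l_distr M.smult_r_distr M.smult_assoc1)
qed

lemma submodule_image:
  assumes "left_module R M" "left_module R N" "f \<in> mod_hom R M N" "submodule H R M"
  shows "submodule (f ` H) R N"
proof -
  interpret M: left_module R M by fact
  interpret N: left_module R N by fact
  note H = submoduleD[OF assms(4)] and f = mod_homD[OF assms(3)]
  have sub: "x \<in> H \<Longrightarrow> x \<in> carrier M" for x using H(1) by auto
  show ?thesis
  proof (rule N.submoduleI)
    show "f ` H \<subseteq> carrier N" using f sub by auto
    show "\<zero>\<^bsub>N\<^esub> \<in> f ` H" using mod_hom_zero[OF assms(1-3)] H(2) by (metis imageI)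
    fix x y assume "x \<in> f ` H" "y \<in> f ` H"
    then obtain u v where "x = f u" "y = f v" "u \<in> H" "v \<in> H" by auto
    then show "x \<oplus>\<^bsub>N\<^esub> y \<in> f ` H" using f(2)[of u v] sub H(3)[of u v] by (metis imageI)
  next
    fix a x assume a: "a \<in> carrier R" "x \<in> f ` H"
    then obtain u where "x = f u" "u \<in> H" by auto
    then show "a \<odot>\<^bsub>N\<^esub> x \<in> f ` H" using a f(3)[of a u] sub H(4)[of a u] by (metis imageI)
  qed
qed

lemma submodule_vimage:
  assumes "left_module R M" "left_module R N" "f \<in> mod_hom R M N" "submodule H R N"
  shows "submodule {x \<in> carrier M. f x \<in> H} R M"
proof -
  interpret M: left_module R M by fact
  show ?thesis
    by (rule M.submoduleI)
      (use submoduleD[OF assms(4)] mod_homD[OF assms(3)] mod_hom_zero[OF assms(1-3)] in auto)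
qed

lemma (in left_module) submodule_carrier: "submodule (carrier M) R M"
  by (rule submoduleI) auto

lemma (in left_module) submodule_zero: "submodule {\<zero>\<^bsub>M\<^esub>} R M"
  by (rule submoduleI) auto

lemma (in left_module) submodule_Int:
  "submodule H R M \<Longrightarrow> submodule K R M \<Longrightarrow> submodule (H \<inter> K) R M"
  by (rule submoduleI) (auto dest: submoduleD)

lemma submodule_trans:
  assumes "left_module R M" "submodule H R M" "submodule K R (M\<lparr>carrier := H\<rparr>)"
  shows "submodule K R M"
proof -
  interpret M: left_module R M by fact
  show ?thesis
    by (rule M.submoduleI) (use submoduleD[OF assms(2)] submoduleD[OF assms(3)] in auto)
qed

lemma (in left_module) submodule_sum:
  assumes "submodule H R M" "submodule K R M"
  shows "submodule (H <+>\<^bsub>M\<^esub> K) R M"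
proof -
  note H = submoduleD[OF assms(1)] and K = submoduleD[OF assms(2)]
  show ?thesis
  proof (rule submoduleI)
    show "H <+>\<^bsub>M\<^esub> K \<subseteq> carrier M" using H(1) K(1) by (auto simp: set_add_def' subset_iff)
    show "\<zero>\<^bsub>M\<^esub> \<in> H <+>\<^bsub>M\<^esub> K" using H(2) K(2) by (force simp: set_add_def')
    fix x y assume "x \<in> H <+>\<^bsub>M\<^esub> K" "y \<in> H <+>\<^bsub>M\<^esub> K"
    then obtain a b c d where *: "x = a \<oplus>\<^bsub>M\<^esub> b" "y = c \<oplus>\<^bsub>M\<^esub> d" "a \<in> H" "c \<in> H" "b \<in> K" "d \<in> K"
      by (auto simp: set_add_def')
    then have "x \<oplus>\<^bsub>M\<^esub> y = (a \<oplus>\<^bsub>M\<^esub> c) \<oplus>\<^bsub>M\<^esub> (b \<oplus>\<^bsub>M\<^esub> d)"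
      using H(1) K(1) by (simp add: subset_iff M.a_ac)
    then show "x \<oplus>\<^bsub>M\<^esub> y \<in> H <+>\<^bsub>M\<^esub> K" using H(3)[OF *(3,4)] K(3)[OF *(5,6)] unfolding set_add_def' by blast
  next
    fix r x assume r: "r \<in> carrier R" "x \<in> H <+>\<^bsub>M\<^esub> K"
    then obtain a b where *: "x = a \<oplus>\<^bsub>M\<^esub> b" "a \<in> H" "b \<in> K" by (auto simp: set_add_def')
    then have "r \<odot>\<^bsub>M\<^esub> x = r \<odot>\<^bsub>M\<^esub> a \<oplus>\<^bsub>M\<^esub> r \<odot>\<^bsub>M\<^esub> b"
      using r H(1) K(1) by (simp add: subset_iff smult_r_distr)
    then show "r \<odot>\<^bsub>M\<^esub> x \<in> H <+>\<^bsub>M\<^esub> K"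
      using H(4)[OF r(1) *(2)] K(4)[OF r(1) *(3)] unfolding set_add_def' by blast
  qed
qed

lemma fin_genE:
  assumes "fin_gen R M"
  obtains S where "finite S" "S \<subseteq> carrier M" "\<And>H. submodule H R M \<Longrightarrow> S \<subseteq> H \<Longrightarrow> H = carrier M"
proof -
  have "\<exists>S. finite S \<and> S \<subseteq> carrier M \<and> (\<forall>H. submodule H R M \<and> S \<subseteq> H \<longrightarrow> H = carrier M)"
    using assms by (simp only: fin_gen_def)
  then obtain S where "finite S \<and> S \<subseteq> carrier M \<and> (\<forall>H. submodule H R M \<and> S \<subseteq> H \<longrightarrow> H = carrier M)" ..
  then show thesis by (intro that[of S]) simp_all
qed

lemma fin_genI:
  assumes "left_module R M" "finite S" "S \<subseteq> carrier M" "\<And>H. submodule H R M \<Longrightarrow> S \<subseteq> H \<Longrightarrow> H = carrier M"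
  shows "fin_gen R M"
  unfolding fin_gen_def using assms by (intro conjI exI[of _ S] allI impI) simp_all

section \<open>Maps of finite rank and finitely generated projective modules\<close>

definition regular_module :: "('r, 'u) ring_scheme \<Rightarrow> ('r, 'r) module" where
  "regular_module R = \<lparr>carrier = carrier R, monoid.mult = monoid.mult R, one = \<one>\<^bsub>R\<^esub>,
     ring.zero = \<zero>\<^bsub>R\<^esub>, add = add R, smult = monoid.mult R\<rparr>"

lemma regular_module_simps [simp]:
  "carrier (regular_module R) = carrier R" "\<zero>\<^bsub>regular_module R\<^esub> = \<zero>\<^bsub>R\<^esub>"
  "x \<oplus>\<^bsub>regular_module R\<^esub> y = x \<oplus>\<^bsub>R\<^esub> y" "x \<odot>\<^bsub>regular_module R\<^esub> y = x \<otimes>\<^bsub>R\<^esub> y"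
  by (simp_all add: regular_module_def)

lemma (in ring) left_module_regular: "left_module R (regular_module R)"
proof -
  have "abelian_group (regular_module R)"
    by (rule abelian_groupI) (use l_neg a_inv_closed in \<open>fastforce simp: a_ac\<close>)+
  then show ?thesis
    unfolding left_module_def left_module_axioms_def using ring_axioms by (auto simp: l_distr r_distr m_assoc)
qed

text \<open>The maps \<open>x \<mapsto> \<Sum>\<^sub>i \<phi>\<^sub>i(x) y\<^sub>i\<close> with finitely many functionals \<open>\<phi>\<^sub>i\<close>, that is, the maps that factor
  through some \<open>R\<^sup>n\<close>. Building them one summand at a time gives an induction rule in place of
  calculations with finite sums, and relates modules on arbitrary types without naming \<open>R\<^sup>n\<close>.\<close>

inductive finite_rank ::
  "('r, 'u) ring_scheme \<Rightarrow> ('r, 'm, 'v) module_scheme \<Rightarrow> ('r, 'n, 'w) module_scheme \<Rightarrow> ('m \<Rightarrow> 'n) \<Rightarrow> bool"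
  for R X Y where
  zero: "(\<And>x. x \<in> carrier X \<Longrightarrow> h x = \<zero>\<^bsub>Y\<^esub>) \<Longrightarrow> finite_rank R X Y h"
| add: "finite_rank R X Y g \<Longrightarrow> \<phi> \<in> mod_hom R X (regular_module R) \<Longrightarrow> y \<in> carrier Y \<Longrightarrow>
    (\<And>x. x \<in> carrier X \<Longrightarrow> h x = g x \<oplus>\<^bsub>Y\<^esub> \<phi> x \<odot>\<^bsub>Y\<^esub> y) \<Longrightarrow> finite_rank R X Y h"

text \<open>The identity has finite rank if and only if \<open>P\<close> has a finite dual basis. That these are the
  finitely generated projective modules is shown by \<open>fg_projective_imp_projective\<close>,
  \<open>fg_projective_imp_fin_gen\<close> and \<open>projective_imp_fg_projective\<close>.\<close>

definition fg_projective :: "('r, 'u) ring_scheme \<Rightarrow> ('r, 'm, 'v) module_scheme \<Rightarrow> bool" where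
  "fg_projective R P \<longleftrightarrow> left_module R P \<and> finite_rank R P P (\<lambda>x. x)"

lemma finite_rank_cong:
  assumes "finite_rank R X Y h" "\<And>x. x \<in> carrier X \<Longrightarrow> h' x = h x"
  shows "finite_rank R X Y h'"
  using assms by (cases rule: finite_rank.cases) (auto intro: finite_rank.intros)

lemma (in left_module) mod_hom_add:
  assumes "f \<in> mod_hom R X M" "g \<in> mod_hom R X M"
  shows "(\<lambda>x. f x \<oplus>\<^bsub>M\<^esub> g x) \<in> mod_hom R X M"
  using mod_homD[OF assms(1)] mod_homD[OF assms(2)]
  by (intro mod_homI) (auto simp: M.a_ac smult_r_distr)

lemma (in left_module) mod_hom_functional:
  assumes "\<phi> \<in> mod_hom R X (regular_module R)" "y \<in> carrier M"
  shows "(\<lambda>x. \<phi> x \<odot>\<^bsub>M\<^esub> y) \<in> mod_hom R X M"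
  using mod_homD[OF assms(1)] assms(2)
  by (intro mod_homI) (auto simp: smult_l_distr smult_assoc1)

lemma (in left_module) mod_hom_zero_map: "(\<lambda>x. \<zero>\<^bsub>M\<^esub>) \<in> mod_hom R X M"
  by (rule mod_homI) auto

lemma finite_rank_hom:
  assumes "left_module R X" "left_module R Y" "finite_rank R X Y h"
  shows "h \<in> mod_hom R X Y"
proof -
  interpret Y: left_module R Y by fact
  show ?thesis using assms(3)
  proof induction
    case (zero h)
    then show ?case by (rule mod_hom_cong[OF assms(1) Y.mod_hom_zero_map])
  next
    case (add g \<phi> y h)
    show ?case
      using mod_hom_cong[OF assms(1) Y.mod_hom_add[OF add.IH Y.mod_hom_functional[OF add.hyps(2,3)]]] add.hyps(4) by blast
  qed
qed

lemma finite_rank_functional: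
  assumes "left_module R Y" "\<phi> \<in> mod_hom R X (regular_module R)" "y \<in> carrier Y"
  shows "finite_rank R X Y (\<lambda>x. \<phi> x \<odot>\<^bsub>Y\<^esub> y)"
proof -
  interpret Y: left_module R Y by fact
  show ?thesis
    by (rule finite_rank.add[OF finite_rank.zero[of X "\<lambda>x. \<zero>\<^bsub>Y\<^esub>"] assms(2,3)])
       (use mod_homD(1)[OF assms(2)] assms(3) in auto)
qed

lemma finite_rank_add:
  assumes X: "left_module R X" and Y: "left_module R Y" and g: "finite_rank R X Y g" and h: "finite_rank R X Y h"
  shows "finite_rank R X Y (\<lambda>x. g x \<oplus>\<^bsub>Y\<^esub> h x)"
proof -
  interpret Y: left_module R Y by fact
  note gc = mod_homD(1)[OF finite_rank_hom[OF X Y g]]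
  show ?thesis using h
  proof induction
    case (zero h)
    then show ?case using gc by (auto intro: finite_rank_cong[OF g])
  next
    case (add h' \<phi> y h)
    note hc = mod_homD(1)[OF finite_rank_hom[OF X Y add.hyps(1)]]
    show ?case
      by (rule finite_rank.add[OF add.IH add.hyps(2,3)])
        (use add.hyps gc hc mod_homD(1)[OF add.hyps(2)] in \<open>auto simp: Y.M.a_ac\<close>)
  qed
qed

lemma finite_rank_comp_left:
  assumes Y: "left_module R Y" and Z: "left_module R Z" and X: "left_module R X"
    and k: "k \<in> mod_hom R Y Z" and h: "finite_rank R X Y h"
  shows "finite_rank R X Z (\<lambda>x. k (h x))"
  using h
proof induction
  case (zero h) then show ?case using mod_hom_zero[OF Y Z k] by (auto intro: finite_rank.zero)
next
  case (add g \<phi> y h)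
  interpret Y: left_module R Y by fact
  note c = mod_homD(1)[OF finite_rank_hom[OF X Y add.hyps(1)]] mod_homD(1)[OF add.hyps(2)]
  show ?case
    by (rule finite_rank.add[OF add.IH add.hyps(2), of "k y"])
      (use add.hyps c mod_homD[OF k] in auto)
qed

lemma finite_rank_comp_right:
  assumes k: "k \<in> mod_hom R W X" and h: "finite_rank R X Y h"
  shows "finite_rank R W Y (\<lambda>x. h (k x))"
  using h
proof induction
  case (zero h) then show ?case using mod_homD[OF k] by (auto intro: finite_rank.zero)
next
  case (add g \<phi> y h)
  show ?case
    by (rule finite_rank.add[OF add.IH mod_hom_comp[OF k add.hyps(2)] add.hyps(3)])
      (use add.hyps mod_homD[OF k] in auto)
qed

text \<open>It suffices to choose preimages of the finitely many values \<open>y\<^sub>i\<close>.\<close>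

lemma finite_rank_lift:
  assumes X: "left_module R X" and P: "left_module R P" and Y: "left_module R Y"
    and p: "p \<in> mod_hom R P Y" "p ` carrier P = carrier Y" and h: "finite_rank R X Y h"
  shows "\<exists>h'. finite_rank R X P h' \<and> (\<forall>x\<in>carrier X. p (h' x) = h x)"
  using h
proof induction
  case (zero h)
  then show ?case using mod_hom_zero[OF P Y p(1)] finite_rank.zero[of X "\<lambda>x. \<zero>\<^bsub>P\<^esub>" P R] by auto
next
  case (add g \<phi> y h)
  interpret P: left_module R P by fact
  from add.IH obtain g' where g': "finite_rank R X P g'" "\<And>x. x \<in> carrier X \<Longrightarrow> p (g' x) = g x" by blast
  obtain q where q: "q \<in> carrier P" "p q = y" using add.hyps(3) p(2) by (metis imageE)
  note c = mod_homD(1)[OF finite_rank_hom[OF X P g'(1)]] mod_homD(1)[OF add.hyps(2)]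
  have "finite_rank R X P (\<lambda>x. g' x \<oplus>\<^bsub>P\<^esub> \<phi> x \<odot>\<^bsub>P\<^esub> q)"
    by (rule finite_rank.add[OF g'(1) add.hyps(2) q(1)]) simp
  moreover have "p (g' x \<oplus>\<^bsub>P\<^esub> \<phi> x \<odot>\<^bsub>P\<^esub> q) = h x" if "x \<in> carrier X" for x
    using that add.hyps c[of x] g'(2) q mod_homD[OF p(1)] by simp
  ultimately show ?case by blast
qed

lemma fg_projective_imp_projective:
  assumes "fg_projective R P"
  shows "projective R P"
proof -
  have P: "left_module R P" using assms by (simp add: fg_projective_def)
  have "\<exists>h'\<in>mod_hom R P B. \<forall>x\<in>carrier P. g (h' x) = h x"
    if *: "left_module R B" "left_module R C" "g \<in> mod_hom R B C" "g ` carrier B = carrier C" "h \<in> mod_hom R P C"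
    for B :: "('a, 'c \<Rightarrow> 'a) module" and C :: "('a, 'c) module" and g h
  proof -
    have "finite_rank R P C h"
      using finite_rank_comp_left[OF P *(2) P *(5)] assms unfolding fg_projective_def by blast
    from finite_rank_lift[OF P *(1,2,3,4) this] finite_rank_hom[OF P *(1)]
    show ?thesis by blast
  qed
  with P show ?thesis unfolding projective_def by blast
qed

lemma finite_rank_finitely_generated_range:
  assumes X: "left_module R X" and Y: "left_module R Y" and h: "finite_rank R X Y h"
  shows "\<exists>S. finite S \<and> S \<subseteq> carrier Y \<and> (\<forall>H. submodule H R Y \<and> S \<subseteq> H \<longrightarrow> h ` carrier X \<subseteq> H)"
  using h
proof induction
  case (zero h)
  have "h ` carrier X \<subseteq> H" if "submodule H R Y" for H
    using submoduleD(2)[OF that] zero by auto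
  then show ?case by (intro exI[of _ "{}"]) simp
next
  case (add g \<phi> y h)
  from add.IH obtain S where S0: "finite S \<and> S \<subseteq> carrier Y \<and> (\<forall>H. submodule H R Y \<and> S \<subseteq> H \<longrightarrow> g ` carrier X \<subseteq> H)"
    by (elim exE)
  then have S: "finite S" "S \<subseteq> carrier Y" "\<And>H. submodule H R Y \<Longrightarrow> S \<subseteq> H \<Longrightarrow> g ` carrier X \<subseteq> H" by simp_all
  have "h ` carrier X \<subseteq> H" if H: "submodule H R Y" "insert y S \<subseteq> H" for H
  proof
    fix z assume "z \<in> h ` carrier X"
    then obtain x where x: "x \<in> carrier X" "z = g x \<oplus>\<^bsub>Y\<^esub> \<phi> x \<odot>\<^bsub>Y\<^esub> y" using add.hyps(4) by auto
    have "g x \<in> H" using S(3)[OF H(1)] H(2) x(1) by auto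
    moreover have "\<phi> x \<odot>\<^bsub>Y\<^esub> y \<in> H" using submoduleD(4)[OF H(1)] H(2) mod_homD(1)[OF add.hyps(2) x(1)] by simp
    ultimately show "z \<in> H" unfolding x(2) by (rule submoduleD(3)[OF H(1)])
  qed
  moreover have "finite (insert y S)" "insert y S \<subseteq> carrier Y" using S(1,2) add.hyps(3) by auto
  ultimately show ?case by blast
qed

lemma fg_projective_imp_fin_gen:
  assumes "fg_projective R P" shows "fin_gen R P"
proof -
  have P: "left_module R P" "finite_rank R P P (\<lambda>x. x)" using assms by (auto simp: fg_projective_def)
  obtain S where S: "finite S \<and> S \<subseteq> carrier P \<and> (\<forall>H. submodule H R P \<and> S \<subseteq> H \<longrightarrow> (\<lambda>x. x) ` carrier P \<subseteq> H)"
    using finite_rank_finitely_generated_range[OF P(1,1,2)] by (elim exE)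
  have "H = carrier P" if "submodule H R P" "S \<subseteq> H" for H
    using S that submoduleD(1)[OF that(1)] by (metis image_ident subset_antisym)
  with S P(1) show ?thesis unfolding fin_gen_def by blast
qed

lemma projective_split:
  assumes "projective R P"
  obtains s where "s \<in> mod_hom R P (free_module R (carrier P))"
    "\<And>x. x \<in> carrier P \<Longrightarrow> left_module.lincomb R P id (s x) = x"
proof -
  interpret P: left_module R P using assms by (simp add: projective_def)
  let ?F = "free_module R (carrier P)"
  have e: "P.lincomb id \<in> mod_hom R ?F P" by (rule P.lincomb_hom) auto
  have "carrier P \<subseteq> P.lincomb id ` carrier ?F"
  proof
    fix x assume x: "x \<in> carrier P"
    let ?d = "\<lambda>y. if y = x then \<one>\<^bsub>R\<^esub> else \<zero>\<^bsub>R\<^esub>"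
    have "{y. ?d y \<noteq> \<zero>\<^bsub>R\<^esub>} \<subseteq> {x}" by auto
    then have "?d \<in> carrier ?F" using x by (auto simp: free_module_def intro: finite_subset)
    moreover have "P.lincomb id ?d = finsum P (\<lambda>y. ?d y \<odot>\<^bsub>P\<^esub> id y) {x}"
      by (rule P.lincomb_eq) (use x in auto)
    then have "P.lincomb id ?d = x" using x by simp
    ultimately show "x \<in> P.lincomb id ` carrier ?F" by (metis imageI)
  qed
  then have "P.lincomb id ` carrier ?F = carrier P" using mod_homD(1)[OF e] by auto
  from projective_lift[OF assms left_module_free_module[OF P.R.ring_axioms] P.left_module_axioms e this mod_hom_ident]
  show ?thesis using that by blast
qed

lemma finite_rank_finsum:
  assumes X: "left_module R X" and Y: "left_module R Y"
    and \<phi>: "\<And>j. j \<in> J \<Longrightarrow> (\<lambda>x. \<phi> x j) \<in> mod_hom R X (regular_module R)"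
    and y: "\<And>j. j \<in> J \<Longrightarrow> y j \<in> carrier Y"
    and J: "finite J"
  shows "finite_rank R X Y (\<lambda>x. finsum Y (\<lambda>j. \<phi> x j \<odot>\<^bsub>Y\<^esub> y j) J)"
  using J \<phi> y
proof (induction J rule: finite_induct)
  interpret Y: left_module R Y by fact
  case empty
  then show ?case by (auto intro: finite_rank.zero)
next
  interpret Y: left_module R Y by fact
  case (insert j J)
  have c: "\<And>i x. i \<in> insert j J \<Longrightarrow> x \<in> carrier X \<Longrightarrow> \<phi> x i \<odot>\<^bsub>Y\<^esub> y i \<in> carrier Y"
    using mod_homD(1)[OF insert.prems(1)] insert.prems(2) by auto
  show ?case
    by (rule finite_rank.add[OF insert.IH insert.prems(1)[of j] insert.prems(2)[of j]])
      (use insert c in \<open>auto simp: Y.M.a_ac Pi_def\<close>)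
qed

text \<open>The projective module \<open>P\<close> is a direct summand of the free module on its carrier. The coordinates
  there of the images of finitely many generators of \<open>X\<close> involve only a finite set \<open>J\<close> of basis
  elements, so that \<open>X \<rightarrow> P \<rightarrow> Y\<close> factors through the free module on \<open>J\<close>.\<close>

lemma projective_comp_finite_rank:
  assumes X: "fin_gen R X" and P: "projective R P" and Y: "left_module R Y"
    and u: "u \<in> mod_hom R X P" and v: "v \<in> mod_hom R P Y"
  shows "finite_rank R X Y (\<lambda>x. v (u x))"
proof -
  interpret X: left_module R X using X by (simp add: fin_gen_def)
  interpret P: left_module R P using P by (simp add: projective_def)
  interpret Y: left_module R Y by fact
  let ?F = "free_module R (carrier P)"
  note XM = X.left_module_axioms and PM = P.left_module_axioms
  obtain s where s: "s \<in> mod_hom R P ?F" "\<And>x. x \<in> carrier P \<Longrightarrow> P.lincomb id (s x) = x"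
    using projective_split[OF P] by blast
  obtain S where S: "finite S" "S \<subseteq> carrier X" "\<And>H. submodule H R X \<Longrightarrow> S \<subseteq> H \<Longrightarrow> H = carrier X"
    by (rule fin_genE[OF X]) (rule that)
  have su: "(\<lambda>x. s (u x)) \<in> mod_hom R X ?F" by (rule mod_hom_comp[OF u s(1)])
  note suD = mod_homD[OF su]
  have F: "finite {p. f p \<noteq> \<zero>\<^bsub>R\<^esub>}" "{p. f p \<noteq> \<zero>\<^bsub>R\<^esub>} \<subseteq> carrier P" "\<And>p. f p \<in> carrier R"
    if "f \<in> carrier ?F" for f
    using that by (auto simp: free_module_def)
  define J where "J = (\<Union>x\<in>S. {p. s (u x) p \<noteq> \<zero>\<^bsub>R\<^esub>})"
  have J: "finite J" "J \<subseteq> carrier P" unfolding J_def using F suD(1) S(1,2) by blast+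
  have "submodule {x \<in> carrier X. \<forall>p. p \<notin> J \<longrightarrow> s (u x) p = \<zero>\<^bsub>R\<^esub>} R X"
    by (rule X.submoduleI)
      (use suD mod_hom_zero[OF XM left_module_free_module[OF X.R.ring_axioms] su] in
        \<open>auto simp: free_module_def\<close>)
  moreover have "S \<subseteq> {x \<in> carrier X. \<forall>p. p \<notin> J \<longrightarrow> s (u x) p = \<zero>\<^bsub>R\<^esub>}"
    using S(2) by (auto simp: J_def)
  ultimately have "{x \<in> carrier X. \<forall>p. p \<notin> J \<longrightarrow> s (u x) p = \<zero>\<^bsub>R\<^esub>} = carrier X" by (rule S(3))
  from equalityD2[OF this] have supp: "s (u x) p = \<zero>\<^bsub>R\<^esub>" if "x \<in> carrier X" "p \<notin> J" for x p
    using that by (simp add: subset_iff)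
  have coord: "(\<lambda>x. s (u x) j) \<in> mod_hom R X (regular_module R)" for j
  proof (rule mod_homI)
    show "s (u x) j \<in> carrier (regular_module R)" if "x \<in> carrier X" for x
      using F(3)[OF suD(1)[OF that]] by simp
  qed (simp_all add: suD(2,3), simp_all add: free_module_def)
  have vj: "v j \<in> carrier Y" if "j \<in> J" for j using that J(2) mod_homD(1)[OF v] by auto
  have "v (u x) = finsum Y (\<lambda>j. s (u x) j \<odot>\<^bsub>Y\<^esub> v j) J" if x: "x \<in> carrier X" for x
  proof -
    have f: "s (u x) \<in> carrier ?F" using suD(1)[OF x] .
    have "v (u x) = v (P.lincomb id (s (u x)))" using s(2) mod_homD(1)[OF u x] by simp
    also have "\<dots> = Y.lincomb (\<lambda>x. v (id x)) (s (u x))"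
      by (rule lincomb_comp[OF PM Y v _ f]) auto
    also have "\<dots> = finsum Y (\<lambda>j. s (u x) j \<odot>\<^bsub>Y\<^esub> v (id j)) J"
      by (rule Y.lincomb_eq) (use J supp[OF x] F[OF f] vj in auto)
    finally show ?thesis by simp
  qed
  then show ?thesis
    by (intro finite_rank_cong[OF finite_rank_finsum[OF XM Y coord vj J(1)]]) auto
qed

lemma projective_imp_fg_projective:
  assumes "projective R P" "fin_gen R P"
  shows "fg_projective R P"
  using projective_comp_finite_rank[OF assms(2,1) _ mod_hom_ident mod_hom_ident] assms
  by (simp add: fg_projective_def projective_def)

section \<open>Stable equivalence\<close>

text \<open>For finitely generated modules this is isomorphism in the stable category. Errors are recorded
  additively, \<open>g f = 1 + h\<close>, which keeps subtraction out of the calculations.\<close>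

definition stable_equiv ::
  "('r, 'u) ring_scheme \<Rightarrow> ('r, 'm, 'v) module_scheme \<Rightarrow> ('r, 'n, 'w) module_scheme \<Rightarrow> bool" where
  "stable_equiv R X Y \<longleftrightarrow> left_module R X \<and> left_module R Y \<and>
     (\<exists>f g h h'. f \<in> mod_hom R X Y \<and> g \<in> mod_hom R Y X \<and> finite_rank R X X h \<and> finite_rank R Y Y h' \<and>
        (\<forall>x\<in>carrier X. g (f x) = x \<oplus>\<^bsub>X\<^esub> h x) \<and> (\<forall>y\<in>carrier Y. f (g y) = y \<oplus>\<^bsub>Y\<^esub> h' y))"

lemma stable_equivE:
  assumes "stable_equiv R X Y"
  obtains f g h h' where "f \<in> mod_hom R X Y" "g \<in> mod_hom R Y X" "finite_rank R X X h" "finite_rank R Y Y h'"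
    "\<And>x. x \<in> carrier X \<Longrightarrow> g (f x) = x \<oplus>\<^bsub>X\<^esub> h x" "\<And>y. y \<in> carrier Y \<Longrightarrow> f (g y) = y \<oplus>\<^bsub>Y\<^esub> h' y"
  using assms unfolding stable_equiv_def by blast

lemma stable_equivI:
  assumes "left_module R X" "left_module R Y" "f \<in> mod_hom R X Y" "g \<in> mod_hom R Y X" "finite_rank R X X h" "finite_rank R Y Y h'"
    "\<And>x. x \<in> carrier X \<Longrightarrow> g (f x) = x \<oplus>\<^bsub>X\<^esub> h x" "\<And>y. y \<in> carrier Y \<Longrightarrow> f (g y) = y \<oplus>\<^bsub>Y\<^esub> h' y"
  shows "stable_equiv R X Y"
  using assms unfolding stable_equiv_def by blast

lemma stable_equiv_left_module:
  "stable_equiv R X Y \<Longrightarrow> left_module R X" "stable_equiv R X Y \<Longrightarrow> left_module R Y"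
  by (simp_all add: stable_equiv_def)

lemma stable_equiv_sym: "stable_equiv R X Y \<Longrightarrow> stable_equiv R Y X"
  unfolding stable_equiv_def by blast

lemma mod_iso_imp_stable_equiv:
  assumes "mod_iso R X Y"
  shows "stable_equiv R X Y"
proof -
  have XY: "left_module R X" "left_module R Y" using assms by (auto simp: mod_iso_def)
  interpret X: left_module R X by fact
  interpret Y: left_module R Y by fact
  obtain f g where fg: "f \<in> mod_hom R X Y" "g \<in> mod_hom R Y X"
    "\<And>x. x \<in> carrier X \<Longrightarrow> g (f x) = x" "\<And>y. y \<in> carrier Y \<Longrightarrow> f (g y) = y"
    using mod_isoE[OF assms] by metis
  show ?thesis
    by (rule stable_equivI[OF XY fg(1,2) finite_rank.zero[of X "\<lambda>x. \<zero>\<^bsub>X\<^esub>"] finite_rank.zero[of Y "\<lambda>x. \<zero>\<^bsub>Y\<^esub>"]])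
      (simp_all add: fg)
qed

lemma stable_equiv_refl: "left_module R X \<Longrightarrow> stable_equiv R X X"
  by (intro mod_iso_imp_stable_equiv mod_iso_refl)

text \<open>From \<open>g f = 1 + h\<close> and \<open>q = 1 + k\<close> follows \<open>g q f = 1 + (h + g k f)\<close>.\<close>

lemma stable_composite:
  assumes X: "left_module R X" and Y: "left_module R Y"
    and f: "f \<in> mod_hom R X Y" and g: "g \<in> mod_hom R Y X"
    and h: "finite_rank R X X h" "\<And>x. x \<in> carrier X \<Longrightarrow> g (f x) = x \<oplus>\<^bsub>X\<^esub> h x"
    and k: "finite_rank R Y Y k" "\<And>y. y \<in> carrier Y \<Longrightarrow> q y = y \<oplus>\<^bsub>Y\<^esub> k y"
  shows "\<exists>l. finite_rank R X X l \<and> (\<forall>x\<in>carrier X. g (q (f x)) = x \<oplus>\<^bsub>X\<^esub> l x)"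
proof -
  interpret X: left_module R X by fact
  note c = mod_homD(1)[OF f] mod_homD(1)[OF g] mod_homD(1)[OF finite_rank_hom[OF X X h(1)]]
    mod_homD(1)[OF finite_rank_hom[OF Y Y k(1)]]
  have "finite_rank R X X (\<lambda>x. h x \<oplus>\<^bsub>X\<^esub> g (k (f x)))"
    using finite_rank_add[OF X X h(1) finite_rank_comp_left[OF Y X X g finite_rank_comp_right[OF f k(1)]]] .
  moreover have "g (q (f x)) = x \<oplus>\<^bsub>X\<^esub> (h x \<oplus>\<^bsub>X\<^esub> g (k (f x)))" if x: "x \<in> carrier X" for x
    using x c h(2)[OF x] k(2) mod_homD(2)[OF g] by (simp add: X.M.a_assoc)
  ultimately show ?thesis by blast
qed

lemma stable_equiv_trans:
  assumes 1: "stable_equiv R X Y" and 2: "stable_equiv R Y Z"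
  shows "stable_equiv R X Z"
proof -
  note X = stable_equiv_left_module(1)[OF 1] and Y = stable_equiv_left_module(2)[OF 1]
    and Z = stable_equiv_left_module(2)[OF 2]
  obtain f g h h' where a: "f \<in> mod_hom R X Y" "g \<in> mod_hom R Y X" "finite_rank R X X h" "finite_rank R Y Y h'"
    "\<And>x. x \<in> carrier X \<Longrightarrow> g (f x) = x \<oplus>\<^bsub>X\<^esub> h x" "\<And>y. y \<in> carrier Y \<Longrightarrow> f (g y) = y \<oplus>\<^bsub>Y\<^esub> h' y"
    by (rule stable_equivE[OF 1]) (rule that)
  obtain f' g' k k' where b: "f' \<in> mod_hom R Y Z" "g' \<in> mod_hom R Z Y" "finite_rank R Y Y k" "finite_rank R Z Z k'"
    "\<And>x. x \<in> carrier Y \<Longrightarrow> g' (f' x) = x \<oplus>\<^bsub>Y\<^esub> k x" "\<And>y. y \<in> carrier Z \<Longrightarrow> f' (g' y) = y \<oplus>\<^bsub>Z\<^esub> k' y"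
    by (rule stable_equivE[OF 2]) (rule that)
  obtain l where l: "finite_rank R X X l" "\<And>x. x \<in> carrier X \<Longrightarrow> g (g' (f' (f x))) = x \<oplus>\<^bsub>X\<^esub> l x"
    using stable_composite[OF X Y a(1,2,3,5) b(3,5)] by blast
  obtain l' where l': "finite_rank R Z Z l'" "\<And>x. x \<in> carrier Z \<Longrightarrow> f' (f (g (g' x))) = x \<oplus>\<^bsub>Z\<^esub> l' x"
    using stable_composite[OF Z Y b(2,1,4,6) a(4,6)] by blast
  show ?thesis
    by (rule stable_equivI[OF X Z mod_hom_comp[OF a(1) b(1)] mod_hom_comp[OF b(2) a(2)] l(1) l'(1) l(2) l'(2)])
qed

lemma stably_iso_imp_stable_equiv:
  assumes "stably_iso R X Y"
  shows "stable_equiv R X Y"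
proof -
  have fg: "fin_gen R X" "fin_gen R Y" using assms by (auto simp: stably_iso_def)
  then have X: "left_module R X" and Y: "left_module R Y" by (auto simp: fin_gen_def)
  have *: "\<exists>h. finite_rank R Z Z h \<and> (\<forall>z\<in>carrier Z. e z = z \<oplus>\<^bsub>Z\<^esub> h z)"
    if Z: "fin_gen R Z" and e: "stably_equal R Z Z e id" "\<And>z. z \<in> carrier Z \<Longrightarrow> e z \<in> carrier Z"
    for Z :: "('a, 'z, 'w) module_scheme" and e
  proof -
    have ZM: "left_module R Z" using Z by (simp add: fin_gen_def)
    interpret Z: left_module R Z by fact
    obtain P :: "('a, nat \<Rightarrow> 'a) module" and u v where P: "projective R P" "u \<in> mod_hom R Z P" "v \<in> mod_hom R P Z"
      "\<forall>z\<in>carrier Z. e z \<ominus>\<^bsub>Z\<^esub> id z = v (u z)"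
      using e(1) unfolding stably_equal_def factors_through_projective_def by blast
    have "finite_rank R Z Z (\<lambda>z. v (u z))"
      by (rule projective_comp_finite_rank[OF Z P(1) ZM P(2,3)])
    moreover have "e z = z \<oplus>\<^bsub>Z\<^esub> v (u z)" if z: "z \<in> carrier Z" for z
    proof -
      have "v (u z) = e z \<oplus>\<^bsub>Z\<^esub> \<ominus>\<^bsub>Z\<^esub> z" using P(4) z by (simp add: Z.M.minus_eq)
      then show ?thesis using z e(2)[OF z] Z.M.a_lcomm[of z "e z" "\<ominus>\<^bsub>Z\<^esub> z"] by (simp add: Z.M.r_neg)
    qed
    ultimately show ?thesis by blast
  qed
  obtain f g where f: "f \<in> mod_hom R X Y" "g \<in> mod_hom R Y X"
      "stably_equal R X X (g \<circ> f) id" "stably_equal R Y Y (f \<circ> g) id"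
    using assms unfolding stably_iso_def by blast
  note c = mod_homD(1)[OF f(1)] mod_homD(1)[OF f(2)]
  obtain h where "finite_rank R X X h" "\<forall>x\<in>carrier X. (g \<circ> f) x = x \<oplus>\<^bsub>X\<^esub> h x"
    using *[OF fg(1) f(3)] c by auto
  moreover obtain h' where "finite_rank R Y Y h'" "\<forall>x\<in>carrier Y. (f \<circ> g) x = x \<oplus>\<^bsub>Y\<^esub> h' x"
    using *[OF fg(2) f(4)] c by auto
  ultimately show ?thesis using stable_equivI[OF X Y f(1,2)] by simp
qed

text \<open>If \<open>f = 0\<close>, then \<open>0 = g f = 1 + h\<close> exhibits the identity \<open>-h\<close> as a map of finite rank.\<close>

lemma stable_equiv_zero_fg_projective:
  assumes "stable_equiv R X Z" "carrier Z = {\<zero>\<^bsub>Z\<^esub>}"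
  shows "fg_projective R X"
proof -
  note X = stable_equiv_left_module(1)[OF assms(1)] and Z = stable_equiv_left_module(2)[OF assms(1)]
  interpret X: left_module R X by fact
  obtain f g h h' where a: "f \<in> mod_hom R X Z" "g \<in> mod_hom R Z X" "finite_rank R X X h" "finite_rank R Z Z h'"
    "\<And>x. x \<in> carrier X \<Longrightarrow> g (f x) = x \<oplus>\<^bsub>X\<^esub> h x" "\<And>y. y \<in> carrier Z \<Longrightarrow> f (g y) = y \<oplus>\<^bsub>Z\<^esub> h' y"
    by (rule stable_equivE[OF assms(1)]) (rule that)
  have "x = \<ominus>\<^bsub>X\<^esub> h x" if x: "x \<in> carrier X" for x
  proof -
    have "f x = \<zero>\<^bsub>Z\<^esub>" using mod_homD(1)[OF a(1) x] assms(2) by auto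
    then have "x \<oplus>\<^bsub>X\<^esub> h x = \<zero>\<^bsub>X\<^esub>" using a(5)[OF x] mod_hom_zero[OF Z X a(2)] by simp
    then show ?thesis
      using x mod_homD(1)[OF finite_rank_hom[OF X X a(3)] x] by (metis X.M.minus_equality)
  qed
  then have "finite_rank R X X (\<lambda>x. x)"
    by (intro finite_rank_cong[OF finite_rank_comp_left[OF X X X X.mod_hom_uminus a(3)]])
  then show ?thesis using X by (simp add: fg_projective_def)
qed

section \<open>Comparison of syzygies\<close>

locale short_exact = K: left_module R K + P: left_module R P + X: left_module R X
  for R (structure) and K and P and X +
  fixes i p
  assumes i: "i \<in> mod_hom R K P" "inj_on i (carrier K)"
    and p: "p \<in> mod_hom R P X" "p ` carrier P = carrier X"
    and exact: "i ` carrier K = {x \<in> carrier P. p x = \<zero>\<^bsub>X\<^esub>}"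
begin

lemma pi [simp]: "k \<in> carrier K \<Longrightarrow> p (i k) = \<zero>\<^bsub>X\<^esub>"
  using exact by auto

lemma factor_kernel:
  assumes "left_module R Y" "q \<in> mod_hom R Y P" "\<And>y. y \<in> carrier Y \<Longrightarrow> p (q y) = \<zero>\<^bsub>X\<^esub>"
  obtains w where "w \<in> mod_hom R Y K" "\<And>y. y \<in> carrier Y \<Longrightarrow> i (w y) = q y"
proof -
  have "q y \<in> i ` carrier K" if "y \<in> carrier Y" for y
    unfolding exact using assms(3) mod_homD(1)[OF assms(2)] that by blast
  from mod_hom_factor_inj[OF K.left_module_axioms P.left_module_axioms i assms(2) this assms(1)] that
  show ?thesis by blast
qed

text \<open>An endomorphism of the sequence that induces \<open>1 + h\<close> on \<open>X\<close> with \<open>h\<close> of finite rank is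
  \<open>1 + w i\<close> on \<open>K\<close>: if \<open>h'\<close> lifts \<open>h\<close> through \<open>p\<close>, then \<open>E - 1 - h' p\<close> takes values in the kernel
  of \<open>p\<close>, hence equals \<open>i w\<close>, and \<open>h' p\<close> vanishes on \<open>K\<close>.\<close>

lemma homotopy:
  assumes E: "E \<in> mod_hom R P P" and \<epsilon>: "\<epsilon> \<in> mod_hom R K K"
    and \<epsilon>E: "\<And>k. k \<in> carrier K \<Longrightarrow> i (\<epsilon> k) = E (i k)"
    and h: "finite_rank R X X h" and pE: "\<And>x. x \<in> carrier P \<Longrightarrow> p (E x) = p x \<oplus>\<^bsub>X\<^esub> h (p x)"
  obtains w where "w \<in> mod_hom R P K" "\<And>k. k \<in> carrier K \<Longrightarrow> \<epsilon> k = k \<oplus>\<^bsub>K\<^esub> w (i k)"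
proof -
  note KM = K.left_module_axioms and PM = P.left_module_axioms and XM = X.left_module_axioms
  note hX = mod_homD[OF finite_rank_hom[OF XM XM h]]
  obtain h' where h': "finite_rank R X P h'" "\<And>x. x \<in> carrier X \<Longrightarrow> p (h' x) = h x"
    using finite_rank_lift[OF XM PM XM p h] by blast
  have h'hom: "h' \<in> mod_hom R X P" by (rule finite_rank_hom[OF XM PM h'(1)])
  have id_h': "(\<lambda>x. x \<oplus>\<^bsub>P\<^esub> h' (p x)) \<in> mod_hom R P P"
    by (rule P.mod_hom_add[OF mod_hom_ident mod_hom_comp[OF p(1) h'hom]])
  define q where "q x = E x \<oplus>\<^bsub>P\<^esub> \<ominus>\<^bsub>P\<^esub> (x \<oplus>\<^bsub>P\<^esub> h' (p x))" for x
  have q: "q \<in> mod_hom R P P"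
    unfolding q_def by (rule P.mod_hom_add[OF E mod_hom_comp[OF id_h' P.mod_hom_uminus]])
  note c = mod_homD(1)[OF p(1)] mod_homD(1)[OF h'hom] mod_homD(1)[OF E] hX(1) mod_homD(1)[OF q]
  have Eq: "E x = (x \<oplus>\<^bsub>P\<^esub> h' (p x)) \<oplus>\<^bsub>P\<^esub> q x" if x: "x \<in> carrier P" for x
    using x c by (simp add: q_def P.M.a_lcomm[of "_ \<oplus>\<^bsub>P\<^esub> _"] P.M.r_neg)
  have "p (q x) = \<zero>\<^bsub>X\<^esub>" if x: "x \<in> carrier P" for x
  proof -
    have "p x \<oplus>\<^bsub>X\<^esub> h (p x) = p x \<oplus>\<^bsub>X\<^esub> h (p x) \<oplus>\<^bsub>X\<^esub> p (q x)"
      using pE[OF x] Eq[OF x] x c h'(2) mod_homD(2)[OF p(1)] by simp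
    then show ?thesis using x c X.M.add.l_cancel_one' by (metis X.M.a_closed)
  qed
  from factor_kernel[OF PM q this] obtain w where w: "w \<in> mod_hom R P K" "\<And>x. x \<in> carrier P \<Longrightarrow> i (w x) = q x"
    by blast
  have "\<epsilon> k = k \<oplus>\<^bsub>K\<^esub> w (i k)" if k: "k \<in> carrier K" for k
  proof (rule inj_onD[OF i(2)])
    note ik = mod_homD(1)[OF i(1) k]
    have "h' (p (i k)) = \<zero>\<^bsub>P\<^esub>" using k mod_hom_zero[OF XM PM h'hom] by simp
    then have "E (i k) = i k \<oplus>\<^bsub>P\<^esub> i (w (i k))" using Eq[OF ik] w(2)[OF ik] ik by simp
    then show "i (\<epsilon> k) = i (k \<oplus>\<^bsub>K\<^esub> w (i k))"
      using \<epsilon>E[OF k] mod_homD(2)[OF i(1) k mod_homD(1)[OF w(1) ik]] by simp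
    show "\<epsilon> k \<in> carrier K" "k \<oplus>\<^bsub>K\<^esub> w (i k) \<in> carrier K"
      using k mod_homD(1)[OF \<epsilon> k] mod_homD(1)[OF w(1) ik] by auto
  qed
  with w(1) show ?thesis by (rule that)
qed

definition superfluous :: bool where
  "superfluous \<longleftrightarrow> (\<forall>H. submodule H R P \<longrightarrow> H <+>\<^bsub>P\<^esub> i ` carrier K = carrier P \<longrightarrow> H = carrier P)"

lemma superfluousD:
  assumes "superfluous" "submodule H R P"
    "\<And>x. x \<in> carrier P \<Longrightarrow> \<exists>y\<in>H. \<exists>k\<in>carrier K. x = y \<oplus>\<^bsub>P\<^esub> i k"
  shows "H = carrier P"
proof -
  have "H <+>\<^bsub>P\<^esub> i ` carrier K = carrier P"
  proof
    show "H <+>\<^bsub>P\<^esub> i ` carrier K \<subseteq> carrier P"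
      using submoduleD(1)[OF assms(2)] mod_homD(1)[OF i(1)] by (auto simp: set_add_def' subset_iff)
    show "carrier P \<subseteq> H <+>\<^bsub>P\<^esub> i ` carrier K"
      using assms(3) by (fastforce simp: set_add_def')
  qed
  then show ?thesis using assms(1,2) unfolding superfluous_def by blast
qed

text \<open>The map \<open>e = 1 + i w\<close> is invertible on \<open>P\<close>. Its image together with \<open>i(K)\<close> spans \<open>P\<close>, so \<open>e\<close> is
  surjective; as \<open>P\<close> is projective, \<open>e\<close> has a section \<open>s\<close>, and since \<open>ker e \<subseteq> i(K)\<close> the same
  argument makes \<open>s\<close> surjective. Both \<open>e\<close> and its inverse preserve \<open>i(K)\<close>, where \<open>e\<close> is
  \<open>1 + w i\<close>.\<close>

lemma superfluous_bij:
  assumes m: "superfluous" and P: "fg_projective R P" and w: "w \<in> mod_hom R P K"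
  shows "bij_betw (\<lambda>k. k \<oplus>\<^bsub>K\<^esub> w (i k)) (carrier K) (carrier K)"
proof -
  note KM = K.left_module_axioms and PM = P.left_module_axioms and XM = X.left_module_axioms
  note iD = mod_homD[OF i(1)] and wD = mod_homD[OF w]
  define e where "e x = x \<oplus>\<^bsub>P\<^esub> i (w x)" for x
  have e: "e \<in> mod_hom R P P"
    unfolding e_def by (rule P.mod_hom_add[OF mod_hom_ident mod_hom_comp[OF w i(1)]])
  note eD = mod_homD[OF e]
  have i_neg: "i (\<ominus>\<^bsub>K\<^esub> k) = \<ominus>\<^bsub>P\<^esub> i k" if "k \<in> carrier K" for k
  proof -
    have "i (\<ominus>\<^bsub>K\<^esub> k) \<oplus>\<^bsub>P\<^esub> i k = \<zero>\<^bsub>P\<^esub>"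
      using that iD(2)[of "\<ominus>\<^bsub>K\<^esub> k" k] mod_hom_zero[OF KM PM i(1)] by (simp add: K.M.l_neg)
    then show ?thesis using that iD(1) by (metis P.M.minus_equality K.M.a_inv_closed)
  qed
  have xe: "x = e x \<oplus>\<^bsub>P\<^esub> i (\<ominus>\<^bsub>K\<^esub> w x)" if "x \<in> carrier P" for x
    using that wD(1) iD(1) by (simp add: e_def i_neg P.M.a_assoc P.M.r_neg)
  have surj: "e ` carrier P = carrier P"
  proof (rule superfluousD[OF m submodule_image[OF PM PM e P.submodule_carrier]])
    fix x assume "x \<in> carrier P"
    with xe[of x] show "\<exists>y\<in>e ` carrier P. \<exists>k\<in>carrier K. x = y \<oplus>\<^bsub>P\<^esub> i k"
      using wD(1) by blast
  qed
  obtain s where "finite_rank R P P s" and es: "\<And>x. x \<in> carrier P \<Longrightarrow> e (s x) = x"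
    using finite_rank_lift[OF PM PM PM e surj, of "\<lambda>x. x"] P unfolding fg_projective_def by blast
  then have s: "s \<in> mod_hom R P P" using finite_rank_hom[OF PM PM] by blast
  note sD = mod_homD[OF s]
  have inj0: "x = \<zero>\<^bsub>P\<^esub>" if x: "x \<in> carrier P" "e x = \<zero>\<^bsub>P\<^esub>" for x
  proof -
    have "s ` carrier P = carrier P"
    proof (rule superfluousD[OF m submodule_image[OF PM PM s P.submodule_carrier]])
      fix x assume x: "x \<in> carrier P"
      define d where "d = x \<oplus>\<^bsub>P\<^esub> \<ominus>\<^bsub>P\<^esub> s (e x)"
      have c: "d \<in> carrier P" "e x \<in> carrier P" "s (e x) \<in> carrier P" using x eD(1) sD(1) by (auto simp: d_def)
      have xd: "x = s (e x) \<oplus>\<^bsub>P\<^esub> d" using x c by (simp add: d_def P.M.a_lcomm P.M.r_neg)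
      have "e x = e x \<oplus>\<^bsub>P\<^esub> e d"
        using xd es[OF c(2)] eD(2)[OF c(3,1)] by simp
      then have "e d = \<zero>\<^bsub>P\<^esub>" using c eD(1) P.M.add.l_cancel_one' by metis
      then have "d = i (\<ominus>\<^bsub>K\<^esub> w d)" using xe[OF c(1)] c wD(1) iD(1) by simp
      then show "\<exists>y\<in>s ` carrier P. \<exists>k\<in>carrier K. x = y \<oplus>\<^bsub>P\<^esub> i k"
        using xd c wD(1) by (metis K.M.a_inv_closed imageI)
    qed
    then obtain y where y: "y \<in> carrier P" "x = s y" using x(1) by blast
    then show ?thesis using es[OF y(1)] x(2) mod_hom_zero[OF PM PM s] by simp
  qed
  have inj: "inj_on e (carrier P)" by (rule mod_hom_injI[OF PM PM e inj0])
  let ?\<epsilon> = "\<lambda>k. k \<oplus>\<^bsub>K\<^esub> w (i k)"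
  have \<epsilon>: "?\<epsilon> k \<in> carrier K" "i (?\<epsilon> k) = e (i k)" if "k \<in> carrier K" for k
    using that iD(1,2) wD(1) by (auto simp: e_def)
  have "inj_on ?\<epsilon> (carrier K)"
  proof (rule inj_onI)
    fix k l assume kl: "k \<in> carrier K" "l \<in> carrier K" "?\<epsilon> k = ?\<epsilon> l"
    then have "e (i k) = e (i l)" using \<epsilon>(2) by metis
    then have "i k = i l" using inj_onD[OF inj] iD(1) kl by blast
    then show "k = l" using kl i(2) by (simp add: inj_on_eq_iff)
  qed
  moreover have "?\<epsilon> ` carrier K = carrier K"
  proof
    show "?\<epsilon> ` carrier K \<subseteq> carrier K" using \<epsilon>(1) by blast
    show "carrier K \<subseteq> ?\<epsilon> ` carrier K"
    proof
      fix k assume k: "k \<in> carrier K"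
      obtain y where y: "y \<in> carrier P" "e y = i k" using surj iD(1)[OF k] by (metis imageE)
      let ?k = "k \<oplus>\<^bsub>K\<^esub> \<ominus>\<^bsub>K\<^esub> w y"
      have k': "?k \<in> carrier K" using k wD(1)[OF y(1)] by simp
      have "y = i ?k" using xe[OF y(1)] y(2) k wD(1)[OF y(1)] iD(2) by simp
      then have "i (?\<epsilon> ?k) = i k" using \<epsilon>(2)[OF k'] y(2) by simp
      then have "?\<epsilon> ?k = k" using i(2) k \<epsilon>(1)[OF k'] by (simp add: inj_on_eq_iff)
      then show "k \<in> ?\<epsilon> ` carrier K" using k' by (metis (no_types, lifting) imageI)
    qed
  qed
  ultimately show ?thesis by (simp add: bij_betw_def)
qed

text \<open>If \<open>X\<close> is projective, then \<open>p\<close> splits, and a superfluous direct summand is zero.\<close>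

lemma fg_projective_kernel_zero:
  assumes m: "superfluous" and X: "fg_projective R X"
  shows "carrier K = {\<zero>\<^bsub>K\<^esub>}"
proof -
  note KM = K.left_module_axioms and PM = P.left_module_axioms and XM = X.left_module_axioms
  obtain s where "finite_rank R X P s" and ps: "\<And>x. x \<in> carrier X \<Longrightarrow> p (s x) = x"
    using finite_rank_lift[OF XM PM XM p, of "\<lambda>x. x"] X unfolding fg_projective_def by blast
  then have s: "s \<in> mod_hom R X P" using finite_rank_hom[OF XM PM] by blast
  note sD = mod_homD[OF s] and pD = mod_homD[OF p(1)] and iD = mod_homD[OF i(1)]
  have surj: "s ` carrier X = carrier P"
  proof (rule superfluousD[OF m submodule_image[OF XM PM s X.submodule_carrier]])
    fix x assume x: "x \<in> carrier P"
    define d where "d = x \<oplus>\<^bsub>P\<^esub> \<ominus>\<^bsub>P\<^esub> s (p x)"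
    have c: "d \<in> carrier P" "p x \<in> carrier X" "s (p x) \<in> carrier P" using x pD(1) sD(1) by (auto simp: d_def)
    have xd: "x = s (p x) \<oplus>\<^bsub>P\<^esub> d" using x c by (simp add: d_def P.M.a_lcomm P.M.r_neg)
    have "p x = p x \<oplus>\<^bsub>X\<^esub> p d"
      using xd ps[OF c(2)] pD(2)[OF c(3,1)] by simp
    then have "p d = \<zero>\<^bsub>X\<^esub>" using c pD(1) X.M.add.l_cancel_one' by metis
    then have "d \<in> i ` carrier K" using exact c(1) by blast
    then show "\<exists>y\<in>s ` carrier X. \<exists>k\<in>carrier K. x = y \<oplus>\<^bsub>P\<^esub> i k"
      using xd c by (metis imageE imageI)
  qed
  have "k = \<zero>\<^bsub>K\<^esub>" if k: "k \<in> carrier K" for k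
  proof -
    obtain x where x: "x \<in> carrier X" "i k = s x" using surj iD(1)[OF k] by (metis imageE)
    then have "x = \<zero>\<^bsub>X\<^esub>" using ps[OF x(1)] pi[OF k] by simp
    then have "i k = i \<zero>\<^bsub>K\<^esub>" using x(2) mod_hom_zero[OF XM PM s] mod_hom_zero[OF KM PM i(1)] by simp
    then show ?thesis using i(2) k by (simp add: inj_on_eq_iff)
  qed
  then show ?thesis by auto
qed

end

lemma short_exact_lift:
  assumes "short_exact R K P X i p" and "short_exact R K' P' X' i' p'" and P: "fg_projective R P"
    and f: "f \<in> mod_hom R X X'"
  obtains F \<phi> where "F \<in> mod_hom R P P'" "\<phi> \<in> mod_hom R K K'"
    "\<And>x. x \<in> carrier P \<Longrightarrow> p' (F x) = f (p x)" "\<And>k. k \<in> carrier K \<Longrightarrow> i' (\<phi> k) = F (i k)"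
proof -
  interpret A: short_exact R K P X i p by fact
  interpret B: short_exact R K' P' X' i' p' by fact
  note KM = A.K.left_module_axioms and PM = A.P.left_module_axioms and XM = A.X.left_module_axioms
  note KM' = B.K.left_module_axioms and PM' = B.P.left_module_axioms and XM' = B.X.left_module_axioms
  have "finite_rank R P X' (\<lambda>x. f (p x))"
    using finite_rank_comp_left[OF PM XM' PM mod_hom_comp[OF A.p(1) f]] P by (simp add: fg_projective_def)
  then obtain F where F: "finite_rank R P P' F" "\<And>x. x \<in> carrier P \<Longrightarrow> p' (F x) = f (p x)"
    using finite_rank_lift[OF PM PM' XM' B.p] by blast
  have Fh: "F \<in> mod_hom R P P'" by (rule finite_rank_hom[OF PM PM' F(1)])
  have "p' (F (i k)) = \<zero>\<^bsub>X'\<^esub>" if "k \<in> carrier K" for k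
    using F(2)[of "i k"] that mod_homD(1)[OF A.i(1) that] mod_hom_zero[OF XM XM' f] by simp
  from B.factor_kernel[OF KM mod_hom_comp[OF A.i(1) Fh] this] that Fh F(2) show ?thesis by blast
qed

text \<open>The common core of the two comparison theorems: lifts of mutually inverse stable isomorphisms
  between \<open>X\<close> and \<open>X'\<close> compose on the kernels to maps of the form \<open>1 + w i\<close>.\<close>

lemma short_exact_compare:
  assumes AA: "short_exact R K P X i p" and BB: "short_exact R K' P' X' i' p'"
    and P: "fg_projective R P" and P': "fg_projective R P'" and X: "stable_equiv R X X'"
  obtains \<phi> \<gamma> w w' where "\<phi> \<in> mod_hom R K K'" "\<gamma> \<in> mod_hom R K' K" "w \<in> mod_hom R P K" "w' \<in> mod_hom R P' K'"
    "\<And>k. k \<in> carrier K \<Longrightarrow> \<gamma> (\<phi> k) = k \<oplus>\<^bsub>K\<^esub> w (i k)" "\<And>k. k \<in> carrier K' \<Longrightarrow> \<phi> (\<gamma> k) = k \<oplus>\<^bsub>K'\<^esub> w' (i' k)"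
proof -
  interpret A: short_exact R K P X i p by fact
  interpret B: short_exact R K' P' X' i' p' by fact
  obtain f g h h' where a: "f \<in> mod_hom R X X'" "g \<in> mod_hom R X' X" "finite_rank R X X h" "finite_rank R X' X' h'"
    "\<And>x. x \<in> carrier X \<Longrightarrow> g (f x) = x \<oplus>\<^bsub>X\<^esub> h x" "\<And>y. y \<in> carrier X' \<Longrightarrow> f (g y) = y \<oplus>\<^bsub>X'\<^esub> h' y"
    by (rule stable_equivE[OF X]) (rule that)
  obtain F \<phi> where F: "F \<in> mod_hom R P P'" "\<phi> \<in> mod_hom R K K'"
    "\<And>x. x \<in> carrier P \<Longrightarrow> p' (F x) = f (p x)" "\<And>k. k \<in> carrier K \<Longrightarrow> i' (\<phi> k) = F (i k)"
    by (rule short_exact_lift[OF AA BB P a(1)]) (rule that)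
  obtain G \<gamma> where G: "G \<in> mod_hom R P' P" "\<gamma> \<in> mod_hom R K' K"
    "\<And>x. x \<in> carrier P' \<Longrightarrow> p (G x) = g (p' x)" "\<And>k. k \<in> carrier K' \<Longrightarrow> i (\<gamma> k) = G (i' k)"
    by (rule short_exact_lift[OF BB AA P' a(2)]) (rule that)
  note c = mod_homD(1)[OF F(1)] mod_homD(1)[OF F(2)] mod_homD(1)[OF G(1)] mod_homD(1)[OF G(2)]
    mod_homD(1)[OF A.p(1)] mod_homD(1)[OF B.p(1)]
  obtain w where w: "w \<in> mod_hom R P K" "\<And>k. k \<in> carrier K \<Longrightarrow> \<gamma> (\<phi> k) = k \<oplus>\<^bsub>K\<^esub> w (i k)"
    by (rule A.homotopy[OF mod_hom_comp[OF F(1) G(1)] mod_hom_comp[OF F(2) G(2)] _ a(3)])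
      (simp_all add: F G c a)
  obtain w' where w': "w' \<in> mod_hom R P' K'" "\<And>k. k \<in> carrier K' \<Longrightarrow> \<phi> (\<gamma> k) = k \<oplus>\<^bsub>K'\<^esub> w' (i' k)"
    by (rule B.homotopy[OF mod_hom_comp[OF G(1) F(1)] mod_hom_comp[OF G(2) F(2)] _ a(4)])
      (simp_all add: F G c a)
  show ?thesis by (rule that[OF F(2) G(2) w(1) w'(1) w(2) w'(2)])
qed

text \<open>The error \<open>w i\<close> has finite rank because it factors through \<open>P\<close>.\<close>

theorem short_exact_stable_equiv:
  assumes AA: "short_exact R K P X i p" and BB: "short_exact R K' P' X' i' p'"
    and P: "fg_projective R P" and P': "fg_projective R P'" and X: "stable_equiv R X X'"
  shows "stable_equiv R K K'"
proof -
  interpret A: short_exact R K P X i p by fact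
  interpret B: short_exact R K' P' X' i' p' by fact
  note KM = A.K.left_module_axioms and PM = A.P.left_module_axioms
  note KM' = B.K.left_module_axioms and PM' = B.P.left_module_axioms
  obtain \<phi> \<gamma> w w' where *: "\<phi> \<in> mod_hom R K K'" "\<gamma> \<in> mod_hom R K' K" "w \<in> mod_hom R P K" "w' \<in> mod_hom R P' K'"
    "\<And>k. k \<in> carrier K \<Longrightarrow> \<gamma> (\<phi> k) = k \<oplus>\<^bsub>K\<^esub> w (i k)" "\<And>k. k \<in> carrier K' \<Longrightarrow> \<phi> (\<gamma> k) = k \<oplus>\<^bsub>K'\<^esub> w' (i' k)"
    by (rule short_exact_compare[OF assms]) (rule that)
  have "finite_rank R K K (\<lambda>k. w (i k))"
    using finite_rank_comp_left[OF PM KM KM *(3) finite_rank_comp_right[OF A.i(1), of P "\<lambda>x. x"]] P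
    by (simp add: fg_projective_def)
  moreover have "finite_rank R K' K' (\<lambda>k. w' (i' k))"
    using finite_rank_comp_left[OF PM' KM' KM' *(4) finite_rank_comp_right[OF B.i(1), of P' "\<lambda>x. x"]] P'
    by (simp add: fg_projective_def)
  ultimately show ?thesis using stable_equivI[OF KM KM' *(1,2) _ _ *(5,6)] by blast
qed

text \<open>Here \<open>1 + w i\<close> is even bijective, so that minimal syzygies of stably isomorphic modules are
  isomorphic and not only stably so. The case of isomorphic modules is the uniqueness of minimal
  syzygies.\<close>

theorem short_exact_superfluous_iso:
  assumes AA: "short_exact R K P X i p" and BB: "short_exact R K' P' X' i' p'"
    and P: "fg_projective R P" and P': "fg_projective R P'" and X: "stable_equiv R X X'"
    and m: "short_exact.superfluous R K P i" "short_exact.superfluous R K' P' i'"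
  shows "mod_iso R K K'"
proof -
  interpret A: short_exact R K P X i p by fact
  interpret B: short_exact R K' P' X' i' p' by fact
  obtain \<phi> \<gamma> w w' where *: "\<phi> \<in> mod_hom R K K'" "\<gamma> \<in> mod_hom R K' K" "w \<in> mod_hom R P K" "w' \<in> mod_hom R P' K'"
    "\<And>k. k \<in> carrier K \<Longrightarrow> \<gamma> (\<phi> k) = k \<oplus>\<^bsub>K\<^esub> w (i k)" "\<And>k. k \<in> carrier K' \<Longrightarrow> \<phi> (\<gamma> k) = k \<oplus>\<^bsub>K'\<^esub> w' (i' k)"
    by (rule short_exact_compare[OF AA BB P P' X]) (rule that)
  have b: "bij_betw (\<lambda>k. \<gamma> (\<phi> k)) (carrier K) (carrier K)" "bij_betw (\<lambda>k. \<phi> (\<gamma> k)) (carrier K') (carrier K')"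
    using A.superfluous_bij[OF m(1) P *(3)] B.superfluous_bij[OF m(2) P' *(4)] *(5,6)
    by (simp_all cong: bij_betw_cong)
  have "inj_on \<phi> (carrier K)"
    using b(1) by (auto simp: bij_betw_def inj_on_def)
  moreover have "carrier K' \<subseteq> \<phi> ` carrier K"
  proof
    fix y assume "y \<in> carrier K'"
    then obtain x where "x \<in> carrier K'" "y = \<phi> (\<gamma> x)" using b(2) unfolding bij_betw_def by (metis imageE)
    then show "y \<in> \<phi> ` carrier K" using mod_homD(1)[OF *(2)] by blast
  qed
  ultimately have "bij_betw \<phi> (carrier K) (carrier K')"
    using mod_homD(1)[OF *(1)] by (auto simp: bij_betw_def)
  then show ?thesis
    unfolding mod_iso_def using *(1) A.K.left_module_axioms B.K.left_module_axioms by blast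
qed

section \<open>Modules of finite length\<close>

text \<open>The length of a submodule is such a function \<open>d\<close>; conversely \<open>d\<close> bounds the length of chains by
  \<open>d(M)\<close>. Any \<open>d\<close> supports the arguments by minimality and maximality below.\<close>

definition finite_length :: "('r, 'u) ring_scheme \<Rightarrow> ('r, 'm, 'v) module_scheme \<Rightarrow> bool" where
  "finite_length R M \<longleftrightarrow> left_module R M \<and>
     (\<exists>d :: 'm set \<Rightarrow> nat. \<forall>H H'. submodule H R M \<longrightarrow> submodule H' R M \<longrightarrow> H \<subset> H' \<longrightarrow> d H < d H')"

lemma finite_lengthE:
  fixes M :: "('r, 'm, 'v) module_scheme"
  assumes "finite_length R M"
  obtains d :: "'m set \<Rightarrow> nat" where
    "\<And>H H'. submodule H R M \<Longrightarrow> submodule H' R M \<Longrightarrow> H \<subset> H' \<Longrightarrow> d H < d H'"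
    "\<And>H H'. submodule H R M \<Longrightarrow> submodule H' R M \<Longrightarrow> H \<subseteq> H' \<Longrightarrow> d H \<le> d H'"
proof -
  obtain d :: "'m set \<Rightarrow> nat" where d: "\<forall>H H'. submodule H R M \<longrightarrow> submodule H' R M \<longrightarrow> H \<subset> H' \<longrightarrow> d H < d H'"
    using assms unfolding finite_length_def by blast
  show thesis
  proof (rule that[of d])
    show *: "d H < d H'" if "submodule H R M" "submodule H' R M" "H \<subset> H'" for H H'
      using d that by blast
    show "d H \<le> d H'" if "submodule H R M" "submodule H' R M" "H \<subseteq> H'" for H H'
      using *[OF that(1,2)] that(3) by (cases "H = H'") (simp_all add: psubset_eq)
  qed
qed

lemma (in left_module) mod_hom_smult: "v \<in> carrier M \<Longrightarrow> (\<lambda>r. r \<odot>\<^bsub>M\<^esub> v) \<in> mod_hom R (regular_module R) M"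
  by (rule mod_homI) (auto simp: smult_l_distr smult_assoc1)

lemma (in left_module) submodule_extend:
  assumes N: "submodule N R M" and v: "v \<in> carrier M"
  defines "N' \<equiv> {n \<oplus>\<^bsub>M\<^esub> r \<odot>\<^bsub>M\<^esub> v | n r. n \<in> N \<and> r \<in> carrier R}"
  shows "submodule N' R M" "N \<subseteq> N'" "v \<in> N'"
proof -
  interpret reg: left_module R "regular_module R" by (rule R.left_module_regular)
  note ND = submoduleD[OF N]
  have "N' = N <+>\<^bsub>M\<^esub> ((\<lambda>r. r \<odot>\<^bsub>M\<^esub> v) ` carrier (regular_module R))"
    by (auto simp: N'_def set_add_def')
  then show "submodule N' R M"
    using submodule_sum[OF N submodule_image[OF reg.left_module_axioms left_module_axioms mod_hom_smult[OF v] reg.submodule_carrier]] by simp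
  show "N \<subseteq> N'"
  proof
    fix n assume n: "n \<in> N"
    then have "n = n \<oplus>\<^bsub>M\<^esub> \<zero> \<odot>\<^bsub>M\<^esub> v" using ND(1) v by (simp add: subset_iff)
    then show "n \<in> N'" using n unfolding N'_def by blast
  qed
  have "v = \<zero>\<^bsub>M\<^esub> \<oplus>\<^bsub>M\<^esub> \<one> \<odot>\<^bsub>M\<^esub> v" using v by simp
  then show "v \<in> N'" using ND(2) R.one_closed unfolding N'_def by blast
qed

lemma (in left_module) submodule_coefficients:
  assumes N: "submodule N R M" and H: "submodule H R M" and v: "v \<in> carrier M"
  shows "submodule {r \<in> carrier R. \<exists>n\<in>N. n \<oplus>\<^bsub>M\<^esub> r \<odot>\<^bsub>M\<^esub> v \<in> H} R (regular_module R)"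
proof -
  interpret reg: left_module R "regular_module R" by (rule R.left_module_regular)
  note ND = submoduleD[OF N] and HD = submoduleD[OF H]
  show ?thesis
  proof (rule reg.submoduleI)
    have "\<zero>\<^bsub>M\<^esub> \<oplus>\<^bsub>M\<^esub> \<zero> \<odot>\<^bsub>M\<^esub> v \<in> H" using v HD(2) by simp
    then show "\<zero>\<^bsub>regular_module R\<^esub> \<in> {r \<in> carrier R. \<exists>n\<in>N. n \<oplus>\<^bsub>M\<^esub> r \<odot>\<^bsub>M\<^esub> v \<in> H}" using ND(2) by auto
  next
    fix r s assume "r \<in> {r \<in> carrier R. \<exists>n\<in>N. n \<oplus>\<^bsub>M\<^esub> r \<odot>\<^bsub>M\<^esub> v \<in> H}" "s \<in> {r \<in> carrier R. \<exists>n\<in>N. n \<oplus>\<^bsub>M\<^esub> r \<odot>\<^bsub>M\<^esub> v \<in> H}"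
    then obtain m n where *: "r \<in> carrier R" "s \<in> carrier R" "m \<in> N" "n \<in> N" "m \<oplus>\<^bsub>M\<^esub> r \<odot>\<^bsub>M\<^esub> v \<in> H" "n \<oplus>\<^bsub>M\<^esub> s \<odot>\<^bsub>M\<^esub> v \<in> H"
      by auto
    have c: "m \<in> carrier M" "n \<in> carrier M" using * ND(1) by auto
    have "(m \<oplus>\<^bsub>M\<^esub> n) \<oplus>\<^bsub>M\<^esub> (r \<oplus> s) \<odot>\<^bsub>M\<^esub> v = (m \<oplus>\<^bsub>M\<^esub> r \<odot>\<^bsub>M\<^esub> v) \<oplus>\<^bsub>M\<^esub> (n \<oplus>\<^bsub>M\<^esub> s \<odot>\<^bsub>M\<^esub> v)"
      using * c v by (simp add: smult_l_distr M.a_ac)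
    then show "r \<oplus>\<^bsub>regular_module R\<^esub> s \<in> {r \<in> carrier R. \<exists>n\<in>N. n \<oplus>\<^bsub>M\<^esub> r \<odot>\<^bsub>M\<^esub> v \<in> H}"
      using HD(3)[OF *(5,6)] ND(3)[OF *(3,4)] *(1,2) by (auto intro: bexI[of _ "m \<oplus>\<^bsub>M\<^esub> n"])
  next
    fix a r assume a: "a \<in> carrier R" and "r \<in> {r \<in> carrier R. \<exists>n\<in>N. n \<oplus>\<^bsub>M\<^esub> r \<odot>\<^bsub>M\<^esub> v \<in> H}"
    then obtain m where *: "r \<in> carrier R" "m \<in> N" "m \<oplus>\<^bsub>M\<^esub> r \<odot>\<^bsub>M\<^esub> v \<in> H" by auto
    have "a \<odot>\<^bsub>M\<^esub> m \<oplus>\<^bsub>M\<^esub> (a \<otimes> r) \<odot>\<^bsub>M\<^esub> v = a \<odot>\<^bsub>M\<^esub> (m \<oplus>\<^bsub>M\<^esub> r \<odot>\<^bsub>M\<^esub> v)"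
      using a * ND(1) v by (simp add: smult_r_distr smult_assoc1 subset_iff)
    then show "a \<odot>\<^bsub>regular_module R\<^esub> r \<in> {r \<in> carrier R. \<exists>n\<in>N. n \<oplus>\<^bsub>M\<^esub> r \<odot>\<^bsub>M\<^esub> v \<in> H}"
      using HD(4)[OF a *(3)] ND(4)[OF a *(2)] a *(1) by (auto intro: bexI[of _ "a \<odot>\<^bsub>M\<^esub> m"])
  qed auto
qed

text \<open>By induction on the generators: if \<open>N' = N + R v\<close>, then a submodule of \<open>N'\<close> that contains \<open>H\<close> and has
  the same intersection with \<open>N\<close> and the same left ideal of coefficients of \<open>v\<close> equals \<open>H\<close>. Hence
  the sum of the two measures is strictly monotone on the submodules of \<open>N'\<close>.\<close>

lemma fin_gen_finite_length:
  fixes M :: "('r, 'm, 'v) module_scheme"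
  assumes R: "finite_length R (regular_module R)" and M: "fin_gen R M"
  shows "finite_length R M"
proof -
  have MM: "left_module R M" using M by (simp add: fin_gen_def)
  interpret M: left_module R M by fact
  obtain e where e: "\<And>H H'. submodule H R (regular_module R) \<Longrightarrow> submodule H' R (regular_module R) \<Longrightarrow> H \<subset> H' \<Longrightarrow> e H < e H'"
    "\<And>H H'. submodule H R (regular_module R) \<Longrightarrow> submodule H' R (regular_module R) \<Longrightarrow> H \<subseteq> H' \<Longrightarrow> (e H :: nat) \<le> e H'"
    by (rule finite_lengthE[OF R]) (rule that)
  obtain S where S: "finite S" "S \<subseteq> carrier M" "\<And>H. submodule H R M \<Longrightarrow> S \<subseteq> H \<Longrightarrow> H = carrier M"
    by (rule fin_genE[OF M]) (rule that)
  have "\<exists>N. submodule N R M \<and> S \<subseteq> N \<and> (\<exists>d :: 'm set \<Rightarrow> nat. \<forall>H H'. submodule H R M \<longrightarrow> submodule H' R M \<longrightarrow>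
      H' \<subseteq> N \<longrightarrow> H \<subset> H' \<longrightarrow> d H < d H')"
    using S(1,2)
  proof (induction S rule: finite_induct)
    case empty
    have "\<not> H \<subset> H'" if "submodule H R M" "submodule H' R M" "H' \<subseteq> {\<zero>\<^bsub>M\<^esub>}" for H H'
      using submoduleD(2)[OF that(1)] that(3) by auto
    then show ?case using M.submodule_zero by (intro exI[of _ "{\<zero>\<^bsub>M\<^esub>}"]) blast
  next
    case (insert v S)
    then have v: "v \<in> carrier M" by simp
    from insert.IH insert.prems obtain N and d :: "'m set \<Rightarrow> nat" where N: "submodule N R M" "S \<subseteq> N"
      and d: "\<And>H H'. submodule H R M \<Longrightarrow> submodule H' R M \<Longrightarrow> H' \<subseteq> N \<Longrightarrow> H \<subset> H' \<Longrightarrow> d H < d H'"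
      by (metis insert_subset)
    define N' where "N' = {n \<oplus>\<^bsub>M\<^esub> r \<odot>\<^bsub>M\<^esub> v | n r. n \<in> N \<and> r \<in> carrier R}"
    note N' = M.submodule_extend[OF N(1) v, folded N'_def]
    define L where "L H = {r \<in> carrier R. \<exists>n\<in>N. n \<oplus>\<^bsub>M\<^esub> r \<odot>\<^bsub>M\<^esub> v \<in> H}" for H
    have L: "submodule (L H) R (regular_module R)" if "submodule H R M" for H
      unfolding L_def by (rule M.submodule_coefficients[OF N(1) that v])
    define d' where "d' H = d (H \<inter> N) + e (L H)" for H
    have "d' H < d' H'" if H: "submodule H R M" "submodule H' R M" "H' \<subseteq> N'" "H \<subset> H'" for H H'
    proof -
      note HN = M.submodule_Int[OF H(1) N(1)] M.submodule_Int[OF H(2) N(1)]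
      have sub: "H \<inter> N \<subseteq> H' \<inter> N" "L H \<subseteq> L H'" using H(4) by (auto simp: L_def)
      have le: "d (H \<inter> N) \<le> d (H' \<inter> N)"
        using d[OF HN] sub(1) by (cases "H \<inter> N = H' \<inter> N") (simp_all add: psubset_eq)
      have le': "e (L H) \<le> e (L H')" by (rule e(2)[OF L[OF H(1)] L[OF H(2)] sub(2)])
      show ?thesis
      proof (cases "H \<inter> N = H' \<inter> N \<and> L H = L H'")
        case False
        then have "d (H \<inter> N) < d (H' \<inter> N) \<or> e (L H) < e (L H')"
          using d[OF HN] e(1)[OF L[OF H(1)] L[OF H(2)]] sub by blast
        then show ?thesis using le le' by (auto simp: d'_def)
      next
        case True
        have "x \<in> H" if x: "x \<in> H'" for x
        proof -
          note HD = submoduleD[OF H(1)] and HD' = submoduleD[OF H(2)] and ND = submoduleD[OF N(1)]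
          obtain n r where nr: "x = n \<oplus>\<^bsub>M\<^esub> r \<odot>\<^bsub>M\<^esub> v" "n \<in> N" "r \<in> carrier R" using x H(3) by (auto simp: N'_def)
          then have "r \<in> L H" using x True by (auto simp: L_def)
          then obtain m where m: "m \<in> N" "m \<oplus>\<^bsub>M\<^esub> r \<odot>\<^bsub>M\<^esub> v \<in> H" by (auto simp: L_def)
          let ?y = "m \<oplus>\<^bsub>M\<^esub> r \<odot>\<^bsub>M\<^esub> v"
          have c: "n \<in> carrier M" "m \<in> carrier M" "r \<odot>\<^bsub>M\<^esub> v \<in> carrier M" using nr m ND(1) v by auto
          have eq: "x \<oplus>\<^bsub>M\<^esub> \<ominus>\<^bsub>M\<^esub> ?y = n \<oplus>\<^bsub>M\<^esub> \<ominus>\<^bsub>M\<^esub> m"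
          proof -
            have "x \<oplus>\<^bsub>M\<^esub> \<ominus>\<^bsub>M\<^esub> ?y = n \<oplus>\<^bsub>M\<^esub> (r \<odot>\<^bsub>M\<^esub> v \<oplus>\<^bsub>M\<^esub> (\<ominus>\<^bsub>M\<^esub> (r \<odot>\<^bsub>M\<^esub> v) \<oplus>\<^bsub>M\<^esub> \<ominus>\<^bsub>M\<^esub> m))"
              using c nr(1) by (simp add: M.M.minus_add M.M.a_assoc M.M.a_comm)
            also have "r \<odot>\<^bsub>M\<^esub> v \<oplus>\<^bsub>M\<^esub> (\<ominus>\<^bsub>M\<^esub> (r \<odot>\<^bsub>M\<^esub> v) \<oplus>\<^bsub>M\<^esub> \<ominus>\<^bsub>M\<^esub> m) = \<ominus>\<^bsub>M\<^esub> m"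
              using c by (simp add: M.M.a_assoc[symmetric] M.M.r_neg)
            finally show ?thesis .
          qed
          have "x \<oplus>\<^bsub>M\<^esub> \<ominus>\<^bsub>M\<^esub> ?y \<in> H'" using HD'(3)[OF x HD'(5)] m(2) H(4) by blast
          moreover have "x \<oplus>\<^bsub>M\<^esub> \<ominus>\<^bsub>M\<^esub> ?y \<in> N" unfolding eq using ND(3)[OF nr(2) ND(5)[OF m(1)]] .
          ultimately have "x \<oplus>\<^bsub>M\<^esub> \<ominus>\<^bsub>M\<^esub> ?y \<in> H" using True by blast
          from HD(3)[OF this m(2)] show "x \<in> H"
            using c nr(1) by (simp add: M.M.a_assoc M.M.l_neg)
        qed
        then show ?thesis using H(4) by blast
      qed
    qed
    moreover have "insert v S \<subseteq> N'" using N' N(2) by blast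
    ultimately show ?case using N'(1) by blast
  qed
  then obtain N and d :: "'m set \<Rightarrow> nat" where N: "submodule N R M" "S \<subseteq> N"
    and d: "\<And>H H'. submodule H R M \<Longrightarrow> submodule H' R M \<Longrightarrow> H' \<subseteq> N \<Longrightarrow> H \<subset> H' \<Longrightarrow> d H < d H'" by metis
  have "N = carrier M" by (rule S(3)[OF N])
  with d have "d H < d H'" if "submodule H R M" "submodule H' R M" "H \<subset> H'" for H H'
    using that submoduleD(1)[OF that(2)] by metis
  then show ?thesis using MM unfolding finite_length_def by blast
qed

lemma finite_length_submodule:
  assumes "finite_length R M" "submodule N R M"
  shows "finite_length R (M\<lparr>carrier := N\<rparr>)"
proof -
  have M: "left_module R M" using assms by (simp add: finite_length_def)
  obtain d where "\<And>H H'. submodule H R M \<Longrightarrow> submodule H' R M \<Longrightarrow> H \<subset> H' \<Longrightarrow> (d H :: nat) < d H'"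
    by (rule finite_lengthE[OF assms(1)]) (rule that)
  then have "\<forall>H H'. submodule H R (M\<lparr>carrier := N\<rparr>) \<longrightarrow> submodule H' R (M\<lparr>carrier := N\<rparr>) \<longrightarrow> H \<subset> H' \<longrightarrow> d H < d H'"
    using submodule_trans[OF M assms(2)] by blast
  then show ?thesis using left_module_submodule[OF M assms(2)] unfolding finite_length_def by blast
qed

text \<open>A finitely generated submodule of maximal measure contains every element \<open>v\<close>, since adjoining \<open>v\<close>
  keeps it finitely generated.\<close>

lemma finite_length_fin_gen:
  assumes "finite_length R M"
  shows "fin_gen R M"
proof -
  have MM: "left_module R M" using assms by (simp add: finite_length_def)
  interpret M: left_module R M by fact
  obtain d where d: "\<And>H H'. submodule H R M \<Longrightarrow> submodule H' R M \<Longrightarrow> H \<subset> H' \<Longrightarrow> (d H :: nat) < d H'"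
    "\<And>H H'. submodule H R M \<Longrightarrow> submodule H' R M \<Longrightarrow> H \<subseteq> H' \<Longrightarrow> d H \<le> d H'"
    by (rule finite_lengthE[OF assms]) (rule that)
  define Q where "Q N \<longleftrightarrow> submodule N R M \<and> (\<exists>S. finite S \<and> S \<subseteq> carrier M \<and> (\<forall>H. submodule H R M \<longrightarrow> S \<subseteq> H \<longrightarrow> N \<subseteq> H))" for N
  have Q0: "Q {\<zero>\<^bsub>M\<^esub>}"
    unfolding Q_def using M.submodule_zero submoduleD(2) by (intro conjI exI[of _ "{}"]) auto
  have "\<forall>N. Q N \<longrightarrow> d N < Suc (d (carrier M))"
    using d(2)[OF _ M.submodule_carrier] submoduleD(1) unfolding Q_def less_Suc_eq_le by blast
  from ex_has_greatest_nat[of Q, OF Q0 this] obtain N where "Q N \<and> (\<forall>N'. Q N' \<longrightarrow> d N' \<le> d N)" ..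
  then have N: "Q N" "\<And>N'. Q N' \<Longrightarrow> d N' \<le> d N" by simp_all
  then obtain S where S: "submodule N R M" "finite S" "S \<subseteq> carrier M" "\<And>H. submodule H R M \<Longrightarrow> S \<subseteq> H \<Longrightarrow> N \<subseteq> H"
    unfolding Q_def by metis
  have "carrier M \<subseteq> N"
  proof
    fix v assume v: "v \<in> carrier M"
    define N' where "N' = {n \<oplus>\<^bsub>M\<^esub> r \<odot>\<^bsub>M\<^esub> v | n r. n \<in> N \<and> r \<in> carrier R}"
    note N' = M.submodule_extend[OF S(1) v, folded N'_def]
    have "N' \<subseteq> H" if H: "submodule H R M" "insert v S \<subseteq> H" for H
    proof -
      have "N \<subseteq> H" "v \<in> H" using S(4)[OF H(1)] H(2) by simp_all
      then show ?thesis using submoduleD(3,4)[OF H(1)] by (auto simp: N'_def)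
    qed
    then have "Q N'" unfolding Q_def using N'(1) S(2,3) v by (intro conjI exI[of _ "insert v S"]) auto
    then have "\<not> N \<subset> N'" using N(2) d(1)[OF S(1) N'(1)] by fastforce
    then show "v \<in> N" using N'(2,3) by blast
  qed
  then have "H = carrier M" if "submodule H R M" "S \<subseteq> H" for H
    using S(4)[OF that] submoduleD(1)[OF that(1)] by (intro subset_antisym) auto
  then show ?thesis by (rule fin_genI[OF MM S(2,3)])
qed

lemma fin_gen_image:
  assumes M: "fin_gen R M" and N: "left_module R N" and p: "p \<in> mod_hom R M N" "p ` carrier M = carrier N"
  shows "fin_gen R N"
proof -
  have MM: "left_module R M" using M by (simp add: fin_gen_def)
  obtain S where S: "finite S" "S \<subseteq> carrier M" "\<And>H. submodule H R M \<Longrightarrow> S \<subseteq> H \<Longrightarrow> H = carrier M"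
    by (rule fin_genE[OF M]) (rule that)
  show ?thesis
  proof (rule fin_genI[OF N finite_imageI[OF S(1)]])
    show "p ` S \<subseteq> carrier N" using S(2) p(2) by blast
    fix H assume H: "submodule H R N" "p ` S \<subseteq> H"
    have "{x \<in> carrier M. p x \<in> H} = carrier M"
      by (rule S(3)[OF submodule_vimage[OF MM N p(1) H(1)]]) (use S(2) H(2) in blast)
    then have "carrier N \<subseteq> H" unfolding p(2)[symmetric] by blast
    with submoduleD(1)[OF H(1)] show "H = carrier N" by (rule subset_antisym)
  qed
qed

lemma mod_iso_fin_gen:
  assumes "mod_iso R M N" "fin_gen R M"
  shows "fin_gen R N"
  using assms unfolding mod_iso_def by (auto intro: fin_gen_image[OF assms(2)] simp: bij_betw_def)

text \<open>If \<open>g\<close> is surjective and kills \<open>x \<noteq> 0\<close>, then a preimage of \<open>x\<close> under \<open>g\<^sup>n\<close> lies in \<open>ker g\<^sup>n\<^sup>+\<^sup>1\<close> but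
  not in \<open>ker g\<^sup>n\<close>, and the kernels form an infinite ascending chain.\<close>

lemma finite_length_surj_inj:
  assumes M: "finite_length R M" and g: "g \<in> mod_hom R M M" "g ` carrier M = carrier M"
  shows "inj_on g (carrier M)"
proof -
  have MM: "left_module R M" using M by (simp add: finite_length_def)
  interpret M: left_module R M by fact
  note gD = mod_homD[OF g(1)]
  obtain d where d: "\<And>H H'. submodule H R M \<Longrightarrow> submodule H' R M \<Longrightarrow> H \<subset> H' \<Longrightarrow> (d H :: nat) < d H'"
    "\<And>H H'. submodule H R M \<Longrightarrow> submodule H' R M \<Longrightarrow> H \<subseteq> H' \<Longrightarrow> d H \<le> d H'"
    by (rule finite_lengthE[OF M]) (rule that)
  have gn: "(g ^^ n) \<in> mod_hom R M M" "(g ^^ n) ` carrier M = carrier M" for n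
  proof (induction n)
    case 0
    { case 1 then show ?case using mod_hom_ident[of R M] by (simp add: id_def) }
    { case 2 then show ?case by simp }
  next
    case (Suc n)
    { case 1 then show ?case using mod_hom_comp[OF Suc(1) g(1)] by (simp add: comp_def) }
    { case 2 then show ?case using Suc(2) g(2) by (metis funpow.simps(2) image_comp) }
  qed
  define K where "K n = {x \<in> carrier M. (g ^^ n) x \<in> {\<zero>\<^bsub>M\<^esub>}}" for n
  have K: "submodule (K n) R M" for n
    unfolding K_def by (rule submodule_vimage[OF MM MM gn(1) M.submodule_zero])
  have inj0: "x = \<zero>\<^bsub>M\<^esub>" if x: "x \<in> carrier M" "g x = \<zero>\<^bsub>M\<^esub>" for x
  proof (rule ccontr)
    assume nz: "x \<noteq> \<zero>\<^bsub>M\<^esub>"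
    have "K n \<subset> K (Suc n)" for n
    proof
      show "K n \<subseteq> K (Suc n)" using mod_hom_zero[OF MM MM g(1)] by (auto simp: K_def)
      obtain y where y: "y \<in> carrier M" "(g ^^ n) y = x" using gn(2)[of n] x(1) by (metis imageE)
      then have "y \<in> K (Suc n)" "y \<notin> K n" using x nz by (auto simp: K_def)
      then show "K n \<noteq> K (Suc n)" by blast
    qed
    then have "n \<le> d (K n)" for n
      by (induction n) (use d(1)[OF K K] in \<open>auto simp: Suc_le_eq intro: le_less_trans\<close>)
    moreover have "d (K n) \<le> d (carrier M)" for n
      by (rule d(2)[OF K M.submodule_carrier submoduleD(1)[OF K]])
    ultimately show False by (metis Suc_n_not_le_n order_trans)
  qed
  show ?thesis by (rule mod_hom_injI[OF MM MM g(1) inj0])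
qed

section \<open>Projective covers\<close>

text \<open>The truncations to the first \<open>m\<close> coordinates have finite rank by induction on \<open>m\<close>.\<close>

lemma (in ring) fg_projective_free_module: "fg_projective R (free_module R {..<n::nat})"
proof -
  let ?F = "free_module R {..<n}"
  interpret F: left_module R ?F by (rule left_module_free_module[OF ring_axioms])
  have F: "f i \<in> carrier R" "i \<ge> n \<Longrightarrow> f i = \<zero>" if "f \<in> carrier ?F" for f i
    using that by (auto simp: free_module_def)
  let ?t = "\<lambda>m f i. if i < m then f i else \<zero>"
  have "finite_rank R ?F ?F (?t m)" if "m \<le> n" for m
    using that
  proof (induction m)
    case 0
    then show ?case by (auto intro!: finite_rank.zero simp: free_module_def)
  next
    case (Suc m)
    let ?d = "\<lambda>i. if i = m then \<one> else \<zero>"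
    have "{i. ?d i \<noteq> \<zero>} \<subseteq> {m}" by auto
    then have d: "?d \<in> carrier ?F" using Suc.prems by (auto simp: free_module_def intro: finite_subset)
    have \<phi>: "(\<lambda>f. f m) \<in> mod_hom R ?F (regular_module R)"
      by (rule mod_homI) (auto simp: free_module_def)
    show ?case
    proof (rule finite_rank.add[OF Suc.IH \<phi> d])
      fix f assume f: "f \<in> carrier ?F"
      show "?t (Suc m) f = ?t m f \<oplus>\<^bsub>?F\<^esub> f m \<odot>\<^bsub>?F\<^esub> ?d"
        using F(1)[OF f] by (auto simp: free_module_def fun_eq_iff less_Suc_eq)
    qed (use Suc.prems in simp)
  qed
  then have "finite_rank R ?F ?F (\<lambda>f. f)"
    by (rule finite_rank_cong[of R ?F ?F "?t n"]) (use F(2) in \<open>auto simp: fun_eq_iff\<close>)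
  then show ?thesis using F.left_module_axioms by (simp add: fg_projective_def)
qed

lemma fin_gen_free_cover:
  assumes X: "fin_gen R X"
  obtains n :: nat and f where "f \<in> mod_hom R (free_module R {..<n}) X"
    "f ` carrier (free_module R {..<n}) = carrier X"
proof -
  have XM: "left_module R X" using X by (simp add: fin_gen_def)
  interpret X: left_module R X by fact
  obtain S where S: "finite S" "S \<subseteq> carrier X" "\<And>H. submodule H R X \<Longrightarrow> S \<subseteq> H \<Longrightarrow> H = carrier X"
    by (rule fin_genE[OF X]) (rule that)
  obtain n :: nat and \<phi> where \<phi>: "S = \<phi> ` {..<n}"
    using finite_imp_nat_seg_image_inj_on[OF S(1)] by (auto simp: lessThan_def)
  let ?F = "free_module R {..<n}"
  interpret F: left_module R ?F by (rule left_module_free_module[OF X.R.ring_axioms])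
  have \<phi>c: "\<phi> \<in> {..<n} \<rightarrow> carrier X" using S(2) \<phi> by auto
  have f: "X.lincomb \<phi> \<in> mod_hom R ?F X" by (rule X.lincomb_hom[OF \<phi>c])
  have "X.lincomb \<phi> ` carrier ?F = carrier X"
  proof (rule S(3)[OF submodule_image[OF F.left_module_axioms XM f F.submodule_carrier]], rule subsetI)
    fix x assume "x \<in> S"
    then obtain i where i: "i < n" "x = \<phi> i" using \<phi> by auto
    let ?d = "\<lambda>j. if j = i then \<one>\<^bsub>R\<^esub> else \<zero>\<^bsub>R\<^esub>"
    have "{j. ?d j \<noteq> \<zero>\<^bsub>R\<^esub>} \<subseteq> {i}" by auto
    then have "?d \<in> carrier ?F" using i by (auto simp: free_module_def intro: finite_subset)
    moreover have "\<phi> i \<in> carrier X" using \<phi>c i(1) by auto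
    then have "X.lincomb \<phi> ?d = finsum X (\<lambda>j. ?d j \<odot>\<^bsub>X\<^esub> \<phi> j) {i}"
      by (intro X.lincomb_eq) auto
    then have "X.lincomb \<phi> ?d = x" using \<open>\<phi> i \<in> carrier X\<close> i(2) by simp
    ultimately show "x \<in> X.lincomb \<phi> ` carrier ?F" by (metis imageI)
  qed
  with f show thesis by (rule that)
qed

text \<open>Among the submodules of a free module of finite rank that map onto \<open>X\<close>, a minimal one, \<open>H\<close>, is a
  projective cover. That the kernel of \<open>H \<rightarrow> X\<close> is superfluous restates minimality, and \<open>H\<close> is
  projective because minimality and finite length turn a lift of the surjection into a retraction
  onto \<open>H\<close>.\<close>

theorem projective_cover_exists:
  fixes X :: "('r, 'm, 'v) module_scheme"
  assumes R: "finite_length R (regular_module R)" and X: "fin_gen R X"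
  shows "\<exists>(P :: ('r, nat \<Rightarrow> 'r) module) f. projective_cover R P X f"
proof -
  have XM: "left_module R X" using X by (simp add: fin_gen_def)
  interpret X: left_module R X by fact
  obtain n :: nat and f where f: "f \<in> mod_hom R (free_module R {..<n}) X"
      "f ` carrier (free_module R {..<n}) = carrier X"
    by (rule fin_gen_free_cover[OF X]) (rule that)
  define F where "F = free_module R {..<n}"
  note f = f[folded F_def]
  have Fp: "fg_projective R F" unfolding F_def by (rule X.R.fg_projective_free_module)
  have FM: "left_module R F" using Fp by (simp add: fg_projective_def)
  interpret F: left_module R F by fact
  have Fl: "finite_length R F" by (rule fin_gen_finite_length[OF R fg_projective_imp_fin_gen[OF Fp]])
  obtain d where d: "\<And>H H'. submodule H R F \<Longrightarrow> submodule H' R F \<Longrightarrow> H \<subset> H' \<Longrightarrow> (d H :: nat) < d H'"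
    by (rule finite_lengthE[OF Fl]) (rule that)
  define Q where "Q H \<longleftrightarrow> submodule H R F \<and> f ` H = carrier X" for H
  have "Q (carrier F)" using F.submodule_carrier f(2) by (simp add: Q_def)
  then obtain H where H0: "Q H" and Hmin: "\<And>H'. Q H' \<Longrightarrow> d H \<le> d H'"
    using ex_has_least_nat[of Q "carrier F" d] by blast
  then have H: "submodule H R F" "f ` H = carrier X" by (auto simp: Q_def)
  have Heq: "H' = H" if "submodule H' R F" "f ` H' = carrier X" "H' \<subseteq> H" for H'
    using Hmin[of H'] d[OF that(1) H(1)] that by (fastforce simp: Q_def)
  define P where "P = F\<lparr>carrier := H\<rparr>"
  have P_simps: "carrier P = H" "add P = add F" "ring.zero P = \<zero>\<^bsub>F\<^esub>" "smult P = smult F" by (simp_all add: P_def)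
  have PM: "left_module R P" unfolding P_def by (rule left_module_submodule[OF FM H(1)])
  interpret P: left_module R P by fact
  have HF: "x \<in> H \<Longrightarrow> x \<in> carrier F" for x using submoduleD(1)[OF H(1)] by blast
  have incl: "(\<lambda>x. x) \<in> mod_hom R P F" by (rule mod_homI) (auto simp: P_simps HF)
  have fP: "f \<in> mod_hom R P X" using mod_hom_comp[OF incl f(1)] .
  have fP': "f ` carrier P = carrier X" using H(2) by (simp add: P_simps)
  \<comment> \<open>A lift \<open>g\<close> of \<open>f\<close> through \<open>f|\<^sub>H\<close> maps \<open>H\<close> onto \<open>H\<close> by minimality, so \<open>g|\<^sub>H\<close> is invertible and
    \<open>(g|\<^sub>H)\<^sup>-\<^sup>1 g\<close> retracts the free module onto \<open>H\<close>.\<close>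
  have "finite_rank R F X f"
    using finite_rank_comp_left[OF FM XM FM f(1)] Fp by (simp add: fg_projective_def)
  then obtain g where "finite_rank R F P g" and fg: "\<And>x. x \<in> carrier F \<Longrightarrow> f (g x) = f x"
    using finite_rank_lift[OF FM PM XM fP fP'] by blast
  then have g: "g \<in> mod_hom R F P" using finite_rank_hom[OF FM PM] by blast
  have gP: "g \<in> mod_hom R P P" using mod_hom_comp[OF incl g] .
  have gH: "g ` carrier P = carrier P"
    unfolding P_simps
  proof (rule Heq)
    show "submodule (g ` H) R F"
      using submodule_image[OF PM FM mod_hom_comp[OF gP incl] P.submodule_carrier] by (simp add: P_simps)
    show "f ` g ` H = carrier X" unfolding image_image H(2)[symmetric]
      by (rule image_cong) (auto simp: fg HF)
    show "g ` H \<subseteq> H" using mod_homD(1)[OF gP] by (auto simp: P_simps)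
  qed
  have ginj: "inj_on g (carrier P)"
    by (rule finite_length_surj_inj[OF _ gP gH])
      (unfold P_def, rule finite_length_submodule[OF Fl H(1)])
  obtain r where r: "r \<in> mod_hom R F P" "\<And>x. x \<in> carrier F \<Longrightarrow> g (r x) = g x"
    by (rule mod_hom_factor_inj[OF PM PM gP ginj g _ FM]) (use mod_homD(1)[OF g] gH in blast)+
  have r_id: "r x = x" if x: "x \<in> carrier P" for x
  proof (rule inj_onD[OF ginj])
    have xF: "x \<in> carrier F" using x HF by (simp add: P_simps)
    show "g (r x) = g x" "r x \<in> carrier P" using r(2)[OF xF] mod_homD(1)[OF r(1) xF] by auto
  qed (rule x)
  have "finite_rank R P P r"
    using finite_rank_comp_left[OF FM PM PM r(1) finite_rank_comp_right[OF incl, of F "\<lambda>x. x"]] Fp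
    by (simp add: fg_projective_def)
  then have "finite_rank R P P (\<lambda>x. x)" by (rule finite_rank_cong) (simp add: r_id)
  then have "projective R P" using PM by (intro fg_projective_imp_projective) (simp add: fg_projective_def)
  moreover have "H' = carrier P"
    if H': "submodule H' R P" "H' <+>\<^bsub>P\<^esub> carrier (mod_kernel P X f) = carrier P" for H'
    unfolding P_simps
  proof (rule Heq)
    show "submodule H' R F" by (rule submodule_trans[OF FM H(1) H'(1)[unfolded P_def]])
    show "H' \<subseteq> H" using submoduleD(1)[OF H'(1)] by (simp add: P_simps)
    have "carrier X \<subseteq> f ` H'"
    proof
      fix x assume "x \<in> carrier X"
      then obtain y where y: "y \<in> carrier P" "x = f y" using fP' by (metis imageE)
      then obtain h k where hk: "h \<in> H'" "k \<in> carrier P" "f k = \<zero>\<^bsub>X\<^esub>" "y = h \<oplus>\<^bsub>P\<^esub> k"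
        using H'(2) by (force simp: set_add_def' mod_kernel_def)
      have h: "h \<in> carrier P" using hk(1) submoduleD(1)[OF H'(1)] by blast
      have "x = f h" using y(2) hk mod_homD(1,2)[OF fP] h by simp
      then show "x \<in> f ` H'" using hk(1) by blast
    qed
    then show "f ` H' = carrier X" using mod_homD(1)[OF fP] submoduleD(1)[OF H'(1)] by blast
  qed
  ultimately have "projective_cover R P X f"
    unfolding projective_cover_def using XM fP fP' by blast
  then show ?thesis unfolding P_def F_def by blast
qed

section \<open>Sequences of syzygies\<close>

text \<open>Lifts of generators of \<open>X\<close> generate \<open>P\<close>, since they do so up to the superfluous kernel.\<close>

lemma projective_cover_fin_gen:
  assumes c: "projective_cover R P X f" and X: "fin_gen R X"
  shows "fin_gen R P"
proof -
  have P: "projective R P" and XM: "left_module R X" and f: "f \<in> mod_hom R P X" "f ` carrier P = carrier X"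
    and m: "\<And>H. submodule H R P \<Longrightarrow> H <+>\<^bsub>P\<^esub> carrier (mod_kernel P X f) = carrier P \<Longrightarrow> H = carrier P"
    using c unfolding projective_cover_def by blast+
  then have PM: "left_module R P" by (simp add: projective_def)
  interpret P: left_module R P by fact
  interpret X: left_module R X by fact
  obtain S where S: "finite S" "S \<subseteq> carrier X" "\<And>H. submodule H R X \<Longrightarrow> S \<subseteq> H \<Longrightarrow> H = carrier X"
    by (rule fin_genE[OF X]) (rule that)
  obtain T where T: "finite T" "T \<subseteq> carrier P" "S = f ` T"
    using finite_subset_image[OF S(1), of f "carrier P"] S(2) f(2) by metis
  show ?thesis
  proof (rule fin_genI[OF PM T(1,2)])
    fix H assume H: "submodule H R P" "T \<subseteq> H"
    have fH: "f ` H = carrier X"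
      by (rule S(3)[OF submodule_image[OF PM XM f(1) H(1)]]) (use H(2) T(3) in blast)
    show "H = carrier P"
    proof (rule m[OF H(1)], rule subset_antisym)
      show "H <+>\<^bsub>P\<^esub> carrier (mod_kernel P X f) \<subseteq> carrier P"
        using submoduleD(1)[OF H(1)] by (auto simp: set_add_def' mod_kernel_def)
      show "carrier P \<subseteq> H <+>\<^bsub>P\<^esub> carrier (mod_kernel P X f)"
      proof
        fix x assume x: "x \<in> carrier P"
        then obtain h where h: "h \<in> H" "f h = f x" using fH mod_homD(1)[OF f(1) x] by (metis imageE)
        have hP: "h \<in> carrier P" using h(1) submoduleD(1)[OF H(1)] by blast
        define k where "k = x \<oplus>\<^bsub>P\<^esub> \<ominus>\<^bsub>P\<^esub> h"
        have k: "k \<in> carrier P" "x = h \<oplus>\<^bsub>P\<^esub> k"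
          using x hP by (simp_all add: k_def P.M.a_lcomm[of h x] P.M.r_neg)
        have "f h \<oplus>\<^bsub>X\<^esub> f k = f h" using mod_homD(2)[OF f(1) hP k(1)] k(2) h(2) by simp
        then have "f k = \<zero>\<^bsub>X\<^esub>"
          using mod_homD(1)[OF f(1)] hP k(1) by (metis X.M.add.l_cancel_one')
        then show "x \<in> H <+>\<^bsub>P\<^esub> carrier (mod_kernel P X f)"
          unfolding set_add_def' mod_kernel_def using h(1) k by auto
      qed
    qed
  qed
qed

lemma left_module_kernel:
  assumes "left_module R P" "left_module R X" "f \<in> mod_hom R P X"
  shows "left_module R (mod_kernel P X f)" "submodule {x \<in> carrier P. f x = \<zero>\<^bsub>X\<^esub>} R P"
proof -
  interpret X: left_module R X by fact
  show "submodule {x \<in> carrier P. f x = \<zero>\<^bsub>X\<^esub>} R P"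
    using submodule_vimage[OF assms X.submodule_zero] by simp
  then show "left_module R (mod_kernel P X f)"
    unfolding mod_kernel_def by (rule left_module_submodule[OF assms(1)])
qed

lemma syzygy_short_exact:
  fixes X :: "('r, 'm, 'v) module_scheme" and Y :: "('r, 'n, 'w) module_scheme"
  assumes "syzygy R X Y" and X: "fin_gen R X"
  obtains P :: "('r, nat \<Rightarrow> 'r) module" and i p where "short_exact R Y P X i p" "fg_projective R P"
    "short_exact.superfluous R Y P i"
proof -
  obtain P :: "('r, nat \<Rightarrow> 'r) module" and p where c: "projective_cover R P X p" and iso: "mod_iso R (mod_kernel P X p) Y"
    using assms(1) unfolding syzygy_def by blast
  have P: "projective R P" and XM: "left_module R X" and p: "p \<in> mod_hom R P X" "p ` carrier P = carrier X"
    and m: "\<And>H. submodule H R P \<Longrightarrow> H <+>\<^bsub>P\<^esub> carrier (mod_kernel P X p) = carrier P \<Longrightarrow> H = carrier P"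
    using c unfolding projective_cover_def by blast+
  then have PM: "left_module R P" by (simp add: projective_def)
  have YM: "left_module R Y" using iso by (simp add: mod_iso_def)
  obtain i where i: "i \<in> mod_hom R Y (mod_kernel P X p)" "bij_betw i (carrier Y) (carrier (mod_kernel P X p))"
    using mod_iso_sym[OF iso] unfolding mod_iso_def by blast
  have iP: "i \<in> mod_hom R Y P"
    using mod_homD[OF i(1)] by (intro mod_homI) (auto simp: mod_kernel_def)
  have ker: "carrier (mod_kernel P X p) = {x \<in> carrier P. p x = \<zero>\<^bsub>X\<^esub>}" by (simp add: mod_kernel_def)
  have se: "short_exact R Y P X i p"
    using i(2) by (intro short_exact.intro short_exact_axioms.intro YM PM XM iP p) (simp_all add: bij_betw_def ker)
  show thesis
  proof (rule that[OF se])
    show "fg_projective R P" by (rule projective_imp_fg_projective[OF P projective_cover_fin_gen[OF c X]])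
    show "short_exact.superfluous R Y P i"
      unfolding short_exact.superfluous_def[OF se] using i(2) m by (auto simp: bij_betw_def)
  qed
qed

lemma syzygy_unique:
  assumes "syzygy R X Y" "syzygy R X' Y'" "fin_gen R X" "fin_gen R X'" "stable_equiv R X X'"
  shows "mod_iso R Y Y'"
proof -
  obtain P :: "('a, nat \<Rightarrow> 'a) module" and i p where 1: "short_exact R Y P X i p" "fg_projective R P"
    "short_exact.superfluous R Y P i" by (rule syzygy_short_exact[OF assms(1,3)]) (rule that)
  obtain P' :: "('a, nat \<Rightarrow> 'a) module" and i' p' where 2: "short_exact R Y' P' X' i' p'" "fg_projective R P'"
    "short_exact.superfluous R Y' P' i'" by (rule syzygy_short_exact[OF assms(2,4)]) (rule that)
  show ?thesis by (rule short_exact_superfluous_iso[OF 1(1) 2(1) 1(2) 2(2) assms(5) 1(3) 2(3)])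
qed

lemma syzygy_mod_iso: "syzygy R X Y \<Longrightarrow> mod_iso R Y Y' \<Longrightarrow> syzygy R X Y'"
  unfolding syzygy_def by (blast intro: mod_iso_trans)

lemma syzygy_exists:
  fixes X :: "('r, 'm, 'v) module_scheme"
  assumes "finite_length R (regular_module R)" "fin_gen R X"
  shows "\<exists>Y :: ('r, nat \<Rightarrow> 'r) module. syzygy R X Y"
proof -
  obtain P :: "('r, nat \<Rightarrow> 'r) module" and f where c: "projective_cover R P X f"
    using projective_cover_exists[OF assms] by blast
  then have "left_module R (mod_kernel P X f)"
    by (intro left_module_kernel) (auto simp: projective_cover_def projective_def)
  from mod_iso_refl[OF this] c show ?thesis unfolding syzygy_def by blast
qed

lemma syzygy_fin_gen:
  assumes R: "finite_length R (regular_module R)" and X: "fin_gen R X" and s: "syzygy R X Y"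
  shows "fin_gen R Y"
proof -
  obtain P :: "('a, nat \<Rightarrow> 'a) module" and f where c: "projective_cover R P X f" and iso: "mod_iso R (mod_kernel P X f) Y"
    using s unfolding syzygy_def by blast
  have Pl: "finite_length R P" by (rule fin_gen_finite_length[OF R projective_cover_fin_gen[OF c X]])
  have "submodule {x \<in> carrier P. f x = \<zero>\<^bsub>X\<^esub>} R P"
    by (rule left_module_kernel(2)) (use c in \<open>auto simp: projective_cover_def projective_def\<close>)
  from finite_length_submodule[OF Pl this] have "finite_length R (mod_kernel P X f)" by (simp add: mod_kernel_def)
  from mod_iso_fin_gen[OF iso finite_length_fin_gen[OF this]] show ?thesis .
qed

text \<open>Fixing one sequence of representatives of the syzygies turns the relations \<open>nth_syzygy\<close>,
  \<open>periodic\<close> and \<open>period\<close> into statements about isomorphisms between its members.\<close>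

locale syzygy_sequence =
  fixes R :: "('r, 'u) ring_scheme" and X :: "('r, 'm, 'v) module_scheme" and W :: "nat \<Rightarrow> ('r, nat \<Rightarrow> 'r) module"
  assumes start: "mod_iso R X (W 0)" and fg: "\<And>i. fin_gen R (W i)" and step: "\<And>i. syzygy R (W i) (W (Suc i))"
begin

lemma W_left_module: "left_module R (W i)"
  using fg by (simp add: fin_gen_def)

lemma stable_shift: "stable_equiv R (W m) (W n) \<Longrightarrow> mod_iso R (W (Suc m)) (W (Suc n))"
  by (rule syzygy_unique[OF step step fg fg])

lemma shift: "mod_iso R (W m) (W n) \<Longrightarrow> mod_iso R (W (m + i)) (W (n + i))"
  by (induction i) (auto intro: stable_shift mod_iso_imp_stable_equiv)

lemma shift_mult: "mod_iso R (W m) (W (m + p)) \<Longrightarrow> mod_iso R (W m) (W (m + j * p))"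
proof (induction j)
  case 0 then show ?case using mod_iso_refl[OF W_left_module] by simp
next
  case (Suc j)
  from Suc shift[OF Suc.prems, of "j * p"] show ?case by (auto intro: mod_iso_trans simp: algebra_simps)
qed

lemma iter_syzygy_iff:
  fixes Y :: "('r, 'n, 'w) module_scheme"
  assumes "mod_iso R (W n) Y"
  shows "iter_syzygy R Y p Z \<longleftrightarrow> mod_iso R (W (n + p)) Z"
proof (induction p arbitrary: Z)
  case 0
  show ?case using assms by (auto intro: mod_iso_trans mod_iso_sym)
next
  case (Suc p)
  show ?case
  proof
    assume "iter_syzygy R Y (Suc p) Z"
    then obtain Z' :: "('r, nat \<Rightarrow> 'r) module" where Z': "mod_iso R (W (n + p)) Z'" "syzygy R Z' Z" using Suc by auto
    then show "mod_iso R (W (n + Suc p)) Z"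
      using syzygy_unique[OF step Z'(2) fg mod_iso_fin_gen[OF Z'(1) fg] mod_iso_imp_stable_equiv[OF Z'(1)]] by simp
  next
    assume "mod_iso R (W (n + Suc p)) Z"
    then have "syzygy R (W (n + p)) Z" using syzygy_mod_iso[OF step, of "n + p" Z] by simp
    then show "iter_syzygy R Y (Suc p) Z"
      using Suc[of "W (n + p)"] mod_iso_refl[OF W_left_module] by auto
  qed
qed

lemma nth_syzygy_iff: "nth_syzygy R n X Y \<longleftrightarrow> mod_iso R (W n) Y"
  unfolding nth_syzygy_def iter_syzygy_iff[OF mod_iso_sym[OF start]]
  using mod_iso_refl[OF W_left_module, of n] by (auto intro: mod_iso_trans)

lemma nth_syzygy_self_iff:
  assumes "mod_iso R (W n) Y"
  shows "nth_syzygy R p Y Y \<longleftrightarrow> mod_iso R (W n) (W (n + p))"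
  unfolding nth_syzygy_def iter_syzygy_iff[OF assms]
  using mod_iso_refl[OF W_left_module, of "n + p"] assms mod_iso_trans mod_iso_sym by metis

lemma zero_shift:
  assumes "carrier (W n) = {\<zero>\<^bsub>W n\<^esub>}"
  shows "carrier (W (n + i)) = {\<zero>\<^bsub>W (n + i)\<^esub>}"
proof (induction i)
  case 0 then show ?case using assms by simp
next
  case (Suc i)
  obtain P :: "('r, nat \<Rightarrow> 'r) module" and j p where 1: "short_exact R (W (Suc (n + i))) P (W (n + i)) j p" "fg_projective R P"
    "short_exact.superfluous R (W (Suc (n + i))) P j" by (rule syzygy_short_exact[OF step fg]) (rule that)
  have "fg_projective R (W (n + i))"
    using stable_equiv_zero_fg_projective[OF stable_equiv_refl[OF W_left_module] Suc] .
  from short_exact.fg_projective_kernel_zero[OF 1(1,3) this] show ?case by simp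
qed

lemma fg_projective_next_zero:
  assumes "fg_projective R (W n)"
  shows "carrier (W (Suc n)) = {\<zero>\<^bsub>W (Suc n)\<^esub>}"
proof -
  obtain P :: "('r, nat \<Rightarrow> 'r) module" and j p where 1: "short_exact R (W (Suc n)) P (W n) j p" "fg_projective R P"
    "short_exact.superfluous R (W (Suc n)) P j" by (rule syzygy_short_exact[OF step fg]) (rule that)
  from short_exact.fg_projective_kernel_zero[OF 1(1,3) assms] show ?thesis .
qed

end

lemma mod_iso_zero:
  assumes "mod_iso R M N" "carrier M = {\<zero>\<^bsub>M\<^esub>}"
  shows "carrier N = {\<zero>\<^bsub>N\<^esub>}"
proof -
  obtain f where f: "left_module R M" "left_module R N" "f \<in> mod_hom R M N" "bij_betw f (carrier M) (carrier N)"
    using assms(1) unfolding mod_iso_def by blast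
  then have "carrier N = f ` {\<zero>\<^bsub>M\<^esub>}" using assms(2) by (simp add: bij_betw_def)
  then show ?thesis using mod_hom_zero[OF f(1-3)] by simp
qed

lemma syzygy_sequence_exists:
  fixes X :: "('r, 'm, 'v) module_scheme"
  assumes R: "finite_length R (regular_module R)" and X: "fin_gen R X" and n: "nth_syzygy R n X Y"
  shows "\<exists>W :: nat \<Rightarrow> ('r, nat \<Rightarrow> 'r) module. syzygy_sequence R X W"
proof -
  have "\<exists>Z :: ('r, nat \<Rightarrow> 'r) module. mod_iso R X Z" if "iter_syzygy R X n Z" for n Z
    using that by (induction n arbitrary: Z) auto
  then obtain W0 :: "('r, nat \<Rightarrow> 'r) module" where W0: "mod_iso R X W0" using n unfolding nth_syzygy_def by blast
  have "\<exists>W :: nat \<Rightarrow> ('r, nat \<Rightarrow> 'r) module. \<forall>n. (fin_gen R (W n) \<and> (n = 0 \<longrightarrow> mod_iso R X (W n))) \<and> syzygy R (W n) (W (Suc n))"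
  proof (rule dependent_nat_choice)
    show "\<exists>W :: ('r, nat \<Rightarrow> 'r) module. fin_gen R W \<and> (0 = (0::nat) \<longrightarrow> mod_iso R X W)"
      using W0 mod_iso_fin_gen[OF W0 X] by blast
    fix V :: "('r, nat \<Rightarrow> 'r) module" and n :: nat
    assume V: "fin_gen R V \<and> (n = 0 \<longrightarrow> mod_iso R X V)"
    then show "\<exists>W :: ('r, nat \<Rightarrow> 'r) module. (fin_gen R W \<and> (Suc n = 0 \<longrightarrow> mod_iso R X W)) \<and> syzygy R V W"
      using syzygy_exists[OF R, of V] syzygy_fin_gen[OF R, of V] by blast
  qed
  then show ?thesis unfolding syzygy_sequence_def by blast
qed

section \<open>Finite length of tensor algebras\<close>

lemma field_finite_length:
  assumes "field k"
  shows "finite_length k (regular_module k)"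
proof -
  interpret field k by fact
  interpret reg: left_module k "regular_module k" by (rule left_module_regular)
  have full: "H = carrier k" if H: "submodule H k (regular_module k)" "H \<noteq> {\<zero>\<^bsub>k\<^esub>}" for H
  proof -
    note HD = submoduleD[OF H(1)]
    obtain x where x: "x \<in> H" "x \<noteq> \<zero>\<^bsub>k\<^esub>" using H(2) HD(2) by auto
    then have xk: "x \<in> carrier k" using HD(1) by auto
    then have "y = (y \<otimes>\<^bsub>k\<^esub> inv\<^bsub>k\<^esub> x) \<otimes>\<^bsub>k\<^esub> x" "inv\<^bsub>k\<^esub> x \<in> carrier k" if "y \<in> carrier k" for y
      using that x(2) by (simp_all add: m_assoc field_Units)
    then have "y \<in> H" if "y \<in> carrier k" for y
      using HD(4)[OF _ x(1), of "y \<otimes>\<^bsub>k\<^esub> inv\<^bsub>k\<^esub> x"] that by simp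
    then show ?thesis using HD(1) by auto
  qed
  have "(if H = {\<zero>\<^bsub>k\<^esub>} then 0 else 1::nat) < (if H' = {\<zero>\<^bsub>k\<^esub>} then 0 else 1)"
    if H: "submodule H k (regular_module k)" "submodule H' k (regular_module k)" "H \<subset> H'" for H H'
  proof -
    have "H = {\<zero>\<^bsub>k\<^esub>}" using full[OF H(1)] submoduleD(1)[OF H(2)] H(3) by auto
    then show ?thesis using H(3) by auto
  qed
  then show ?thesis
    unfolding finite_length_def using reg.left_module_axioms
    by (intro conjI exI[of _ "\<lambda>H. if H = {\<zero>\<^bsub>k\<^esub>} then 0 else 1"] allI impI)
qed

text \<open>Every \<open>R\<close>-submodule is a \<open>k\<close>-submodule by restriction of scalars along \<open>\<iota>\<close>, so a measure for the
  latter is one for the former.\<close>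

lemma finite_length_restrict_scalars:
  assumes M: "left_module R M" and M': "finite_length k M'"
    and eq: "carrier M' = carrier M" "\<zero>\<^bsub>M'\<^esub> = \<zero>\<^bsub>M\<^esub>" "add M' = add M"
    and \<iota>: "\<And>c. c \<in> carrier k \<Longrightarrow> \<iota> c \<in> carrier R"
    and sm: "\<And>c x. c \<in> carrier k \<Longrightarrow> x \<in> carrier M \<Longrightarrow> c \<odot>\<^bsub>M'\<^esub> x = \<iota> c \<odot>\<^bsub>M\<^esub> x"
  shows "finite_length R M"
proof -
  obtain d where d: "\<And>H H'. submodule H k M' \<Longrightarrow> submodule H' k M' \<Longrightarrow> H \<subset> H' \<Longrightarrow> (d H :: nat) < d H'"
    by (rule finite_lengthE[OF M']) (rule that)
  have "left_module k M'" using M' by (simp add: finite_length_def)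
  then have sub: "submodule H k M'" if "submodule H R M" for H
    by (rule left_module.submoduleI)
      (use submoduleD[OF that] in \<open>auto simp: eq sm \<iota> subset_iff\<close>)
  show ?thesis
    unfolding finite_length_def using d sub M by blast
qed

context two_algebras begin

abbreviation "TA \<equiv> tensor_algebra k A B"

lemma mul_pure:
  "a \<in> carrier A \<Longrightarrow> b \<in> carrier B \<Longrightarrow> a' \<in> carrier A \<Longrightarrow> b' \<in> carrier B \<Longrightarrow>
   mul (pure a b) (pure a' b') = pure (a \<otimes>\<^bsub>A\<^esub> a') (b \<otimes>\<^bsub>B\<^esub> b')"
  by (simp add: mul L)

text \<open>Left ideals are in particular subspaces of \<open>A \<otimes>\<^sub>k B\<close>, which is spanned by the pure tensors of
  generators.\<close>

lemma finite_length_tensor_algebra: "finite_length TA (regular_module TA)"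
proof -
  interpret TA: ring TA by (rule ring_tensor_algebra)
  let ?\<iota> = "\<lambda>c. pure (c \<odot>\<^bsub>A\<^esub> \<one>\<^bsub>A\<^esub>) \<one>\<^bsub>B\<^esub>"
  define T' :: "('k, ('a \<times> 'b \<Rightarrow>\<^sub>0 int) set) module" where
    "T' = \<lparr>carrier = carrier T, monoid.mult = undefined, one = undefined, ring.zero = \<zero>\<^bsub>T\<^esub>, add = add T,
       smult = (\<lambda>c t. mul (?\<iota> c) t)\<rparr>"
  have T'_simps: "carrier T' = carrier T" "\<zero>\<^bsub>T'\<^esub> = \<zero>\<^bsub>T\<^esub>" "add T' = add T" "\<And>c t. c \<odot>\<^bsub>T'\<^esub> t = mul (?\<iota> c) t"
    by (simp_all add: T'_def)
  have \<iota>: "?\<iota> c \<in> carrier T" if "c \<in> carrier k" for c using that by auto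
  have ab: "abelian_group T'"
    by (rule abelian_groupI) (use T.l_neg T.a_inv_closed in \<open>fastforce simp: T'_simps T.a_ac\<close>)+
  note TT = T.abelian_group_axioms
  have T'M: "left_module k T'"
    unfolding left_module_def left_module_axioms_def T'_simps
  proof (intro conjI allI impI A.k.ring_axioms ab)
    fix c d t assume *: "c \<in> carrier k" "d \<in> carrier k" "t \<in> carrier T"
    show "mul (?\<iota> (c \<oplus>\<^bsub>k\<^esub> d)) t = mul (?\<iota> c) t \<oplus>\<^bsub>T\<^esub> mul (?\<iota> d) t"
      using * additive_maps_props(2)[OF TT TT mul(1)[OF *(3)]] by (simp add: A.smult_l_distr pure_add_l)
    have "?\<iota> (c \<otimes>\<^bsub>k\<^esub> d) = mul (?\<iota> c) (?\<iota> d)"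
      using * by (simp add: mul_pure A.smult_mult_l A.smult_assoc1)
    then show "mul (?\<iota> (c \<otimes>\<^bsub>k\<^esub> d)) t = mul (?\<iota> c) (mul (?\<iota> d) t)"
      using * by (simp add: mul_assoc)
  next
    fix c s t assume *: "c \<in> carrier k" "s \<in> carrier T" "t \<in> carrier T"
    show "mul (?\<iota> c) (s \<oplus>\<^bsub>T\<^esub> t) = mul (?\<iota> c) s \<oplus>\<^bsub>T\<^esub> mul (?\<iota> c) t"
      using * additive_maps_props(2)[OF TT TT mul_r[OF \<iota>]] by simp
  qed (simp_all add: mul_closed mul_one)
  obtain SA where SA: "finite SA" "SA \<subseteq> carrier A" "\<And>H. submodule H k A \<Longrightarrow> SA \<subseteq> H \<Longrightarrow> H = carrier A"
    by (rule fin_genE[OF A.fin_dim]) (rule that)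
  obtain SB where SB: "finite SB" "SB \<subseteq> carrier B" "\<And>H. submodule H k B \<Longrightarrow> SB \<subseteq> H \<Longrightarrow> H = carrier B"
    by (rule fin_genE[OF B.fin_dim]) (rule that)
  note kA = A.left_module_k(1) and kB = B.left_module_k(1)
  have homA: "(\<lambda>a. pure a b) \<in> mod_hom k A T'" if "b \<in> carrier B" for b
    by (rule mod_homI) (use that in \<open>auto simp: T'_simps pure_add_l mul_pure A.smult_mult_l\<close>)
  have homB: "(\<lambda>b. pure a b) \<in> mod_hom k B T'" if "a \<in> carrier A" for a
    by (rule mod_homI)
      (use that in \<open>auto simp: T'_simps pure_add_r mul_pure A.smult_mult_l B.smult_mult_l pure_balanced\<close>)
  have "fin_gen k T'"
  proof (rule fin_genI[OF T'M])
    show "finite ((\<lambda>(a, b). pure a b) ` (SA \<times> SB))" using SA(1) SB(1) by simp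
    show "(\<lambda>(a, b). pure a b) ` (SA \<times> SB) \<subseteq> carrier T'" using SA(2) SB(2) by (auto simp: T'_simps)
    fix H assume H: "submodule H k T'" "(\<lambda>(a, b). pure a b) ` (SA \<times> SB) \<subseteq> H"
    have 1: "pure a b \<in> H" if "a \<in> carrier A" "b \<in> SB" for a b
    proof -
      have b: "b \<in> carrier B" using that SB(2) by blast
      have "{a \<in> carrier A. pure a b \<in> H} = carrier A"
        by (rule SA(3)[OF submodule_vimage[OF kA T'M homA[OF b] H(1)]])
          (use SA(2) H(2) that(2) in blast)
      then show ?thesis using that(1) by blast
    qed
    have 2: "pure a b \<in> H" if "a \<in> carrier A" "b \<in> carrier B" for a b
    proof -
      have "{b \<in> carrier B. pure a b \<in> H} = carrier B"
        by (rule SB(3)[OF submodule_vimage[OF kB T'M homB[OF that(1)] H(1)]])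
          (use SB(2) 1[OF that(1)] in blast)
      then show ?thesis using that(2) by blast
    qed
    have "t \<in> H" if "t \<in> carrier T" for t
      using that
    proof (induction t rule: tensor_induct)
      case zero then show ?case using submoduleD(2)[OF H(1)] by (simp add: T'_simps)
    next
      case (pure m n) then show ?case by (rule 2)
    next
      case (diff s t)
      have "\<ominus>\<^bsub>T\<^esub> t \<in> H"
      proof -
        interpret T': left_module k T' by (rule T'M)
        have "\<ominus>\<^bsub>T'\<^esub> t = \<ominus>\<^bsub>T\<^esub> t"
          by (rule T'.M.minus_equality) (use diff.hyps T.l_neg in \<open>auto simp: T'_simps\<close>)
        then show ?thesis using submoduleD(5)[OF H(1) diff.IH(2)] by simp
      qed
      then show ?case using submoduleD(3)[OF H(1) diff.IH(1)] by (simp add: T'_simps T.minus_eq)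
    qed
    then show "H = carrier T'" using submoduleD(1)[OF H(1)] by (auto simp: T'_simps)
  qed
  from fin_gen_finite_length[OF field_finite_length[OF A.k.field_axioms] this]
  show ?thesis
    by (rule finite_length_restrict_scalars[OF TA.left_module_regular, where \<iota> = ?\<iota>])
      (simp_all add: T'_simps tensor_algebra_simps regular_module_def)
qed

end

section \<open>External tensor products\<close>

text \<open>For a left \<open>A\<close>-module \<open>P\<close> and a left \<open>B\<close>-module \<open>Q\<close>, the left \<open>A \<otimes>\<^sub>k B\<close>-module \<open>P \<otimes>\<^sub>k Q\<close>. The
  underlying \<open>k\<close>-modules \<open>Pk\<close> and \<open>Qk\<close> are parameters, because the same group \<open>N \<otimes>\<^sub>k M\<close> has to carry a
  \<open>\<Gamma>\<^sup>e\<close>-module structure and a right \<open>\<Lambda>\<^sup>e\<close>-module structure, and \<open>k\<close> acts on \<open>N\<close> and \<open>M\<close> through either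
  algebra.\<close>

locale external_tensor = two_algebras k A B + P: left_module A P + Q: left_module B Q +
    U: tensor_pair k Pk Qk
  for k :: "('k, 'u) ring_scheme" and A :: "('k, 'a, 'v) module_scheme" and B :: "('k, 'b, 'w) module_scheme"
    and P :: "('a, 'p, 'x) module_scheme" and Q :: "('b, 'q, 'y) module_scheme"
    and Pk :: "('k, 'p, 'x1) module_scheme" and Qk :: "('k, 'q, 'y1) module_scheme" +
  assumes Pk: "carrier Pk = carrier P" "add Pk = add P"
      "\<And>c p. c \<in> carrier k \<Longrightarrow> p \<in> carrier P \<Longrightarrow> c \<odot>\<^bsub>Pk\<^esub> p = (c \<odot>\<^bsub>A\<^esub> \<one>\<^bsub>A\<^esub>) \<odot>\<^bsub>P\<^esub> p"
    and Qk: "carrier Qk = carrier Q" "add Qk = add Q"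
      "\<And>c q. c \<in> carrier k \<Longrightarrow> q \<in> carrier Q \<Longrightarrow> c \<odot>\<^bsub>Qk\<^esub> q = (c \<odot>\<^bsub>B\<^esub> \<one>\<^bsub>B\<^esub>) \<odot>\<^bsub>Q\<^esub> q"
begin

definition act1 :: "'a \<Rightarrow> 'b \<Rightarrow> ('p \<times> 'q \<Rightarrow>\<^sub>0 int) set \<Rightarrow> ('p \<times> 'q \<Rightarrow>\<^sub>0 int) set" where
  "act1 a b = tensor_lift k Pk Qk U.T (\<lambda>p q. U.pure (a \<odot>\<^bsub>P\<^esub> p) (b \<odot>\<^bsub>Q\<^esub> q))"

definition act :: "('a \<times> 'b \<Rightarrow>\<^sub>0 int) set \<Rightarrow> ('p \<times> 'q \<Rightarrow>\<^sub>0 int) set \<Rightarrow> ('p \<times> 'q \<Rightarrow>\<^sub>0 int) set" where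
  "act t u = tensor_lift k A B U.T (\<lambda>a b. act1 a b u) t"

definition E :: "(('a \<times> 'b \<Rightarrow>\<^sub>0 int) set, ('p \<times> 'q \<Rightarrow>\<^sub>0 int) set) module" where
  "E = \<lparr>carrier = carrier U.T, monoid.mult = undefined, one = undefined, ring.zero = \<zero>\<^bsub>U.T\<^esub>, add = add U.T,
     smult = act\<rparr>"

lemma E_simps: "carrier E = carrier U.T" "\<zero>\<^bsub>E\<^esub> = \<zero>\<^bsub>U.T\<^esub>" "add E = add U.T" "smult E = act"
  by (simp_all add: E_def)

lemma smult_P_comm:
  assumes "c \<in> carrier k" "a \<in> carrier A" "p \<in> carrier P"
  shows "a \<odot>\<^bsub>P\<^esub> (c \<odot>\<^bsub>Pk\<^esub> p) = c \<odot>\<^bsub>Pk\<^esub> (a \<odot>\<^bsub>P\<^esub> p)" "c \<odot>\<^bsub>Pk\<^esub> (a \<odot>\<^bsub>P\<^esub> p) = (c \<odot>\<^bsub>A\<^esub> a) \<odot>\<^bsub>P\<^esub> p"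
  using assms by (simp_all add: Pk P.smult_assoc1[symmetric] A.smult_mult_l A.smult_mult_r)

lemma smult_Q_comm:
  assumes "c \<in> carrier k" "b \<in> carrier B" "q \<in> carrier Q"
  shows "b \<odot>\<^bsub>Q\<^esub> (c \<odot>\<^bsub>Qk\<^esub> q) = c \<odot>\<^bsub>Qk\<^esub> (b \<odot>\<^bsub>Q\<^esub> q)" "c \<odot>\<^bsub>Qk\<^esub> (b \<odot>\<^bsub>Q\<^esub> q) = (c \<odot>\<^bsub>B\<^esub> b) \<odot>\<^bsub>Q\<^esub> q"
  using assms by (simp_all add: Qk Q.smult_assoc1[symmetric] B.smult_mult_l B.smult_mult_r)

lemma U_pure_closed: "p \<in> carrier P \<Longrightarrow> q \<in> carrier Q \<Longrightarrow> U.pure p q \<in> carrier U.T"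
  using U.pure_closed[of p q] by (simp add: Pk Qk)

lemma U_pure_add:
  "p \<in> carrier P \<Longrightarrow> p' \<in> carrier P \<Longrightarrow> q \<in> carrier Q \<Longrightarrow> U.pure (p \<oplus>\<^bsub>P\<^esub> p') q = U.pure p q \<oplus>\<^bsub>U.T\<^esub> U.pure p' q"
  "p \<in> carrier P \<Longrightarrow> q \<in> carrier Q \<Longrightarrow> q' \<in> carrier Q \<Longrightarrow> U.pure p (q \<oplus>\<^bsub>Q\<^esub> q') = U.pure p q \<oplus>\<^bsub>U.T\<^esub> U.pure p q'"
  using U.pure_add_l[of p p' q] U.pure_add_r[of p q q'] by (simp_all add: Pk Qk)

lemma U_balancedI:
  assumes "\<And>p q. p \<in> carrier P \<Longrightarrow> q \<in> carrier Q \<Longrightarrow> \<phi> p q \<in> carrier G"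
    "\<And>p p' q. p \<in> carrier P \<Longrightarrow> p' \<in> carrier P \<Longrightarrow> q \<in> carrier Q \<Longrightarrow> \<phi> (p \<oplus>\<^bsub>P\<^esub> p') q = \<phi> p q \<oplus>\<^bsub>G\<^esub> \<phi> p' q"
    "\<And>p q q'. p \<in> carrier P \<Longrightarrow> q \<in> carrier Q \<Longrightarrow> q' \<in> carrier Q \<Longrightarrow> \<phi> p (q \<oplus>\<^bsub>Q\<^esub> q') = \<phi> p q \<oplus>\<^bsub>G\<^esub> \<phi> p q'"
    "\<And>c p q. c \<in> carrier k \<Longrightarrow> p \<in> carrier P \<Longrightarrow> q \<in> carrier Q \<Longrightarrow>
       \<phi> ((c \<odot>\<^bsub>A\<^esub> \<one>\<^bsub>A\<^esub>) \<odot>\<^bsub>P\<^esub> p) q = \<phi> p ((c \<odot>\<^bsub>B\<^esub> \<one>\<^bsub>B\<^esub>) \<odot>\<^bsub>Q\<^esub> q)"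
  shows "U.balanced G \<phi>"
  unfolding U.balanced_def using assms by (simp add: Pk Qk)

lemma U_hom_eqI:
  assumes "abelian_group G" "f \<in> additive_maps U.T G" "g \<in> additive_maps U.T G"
    "\<And>p q. p \<in> carrier P \<Longrightarrow> q \<in> carrier Q \<Longrightarrow> f (U.pure p q) = g (U.pure p q)" "t \<in> carrier U.T"
  shows "f t = g t"
  by (rule U.tensor_hom_eqI[OF assms(1-3) _ assms(5)]) (simp add: assms(4) Pk Qk)

lemmas UT = U.T.abelian_group_axioms

lemma tensor_map_balanced:
  assumes f: "f \<in> mod_hom A P P" and g: "g \<in> mod_hom B Q Q"
  shows "U.balanced U.T (\<lambda>p q. U.pure (f p) (g q))"
proof (rule U_balancedI)
  fix c p q assume *: "c \<in> carrier k" "p \<in> carrier P" "q \<in> carrier Q"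
  have "U.pure (c \<odot>\<^bsub>Pk\<^esub> f p) (g q) = U.pure (f p) (c \<odot>\<^bsub>Qk\<^esub> g q)"
    using * mod_homD(1)[OF f] mod_homD(1)[OF g] by (intro U.pure_balanced) (simp_all add: Pk Qk)
  then show "U.pure (f ((c \<odot>\<^bsub>A\<^esub> \<one>\<^bsub>A\<^esub>) \<odot>\<^bsub>P\<^esub> p)) (g q) = U.pure (f p) (g ((c \<odot>\<^bsub>B\<^esub> \<one>\<^bsub>B\<^esub>) \<odot>\<^bsub>Q\<^esub> q))"
    using * mod_homD[OF f] mod_homD[OF g] by (simp add: Pk(3) Qk(3))
qed (use mod_homD[OF f] mod_homD[OF g] in \<open>auto simp: U_pure_closed U_pure_add\<close>)

lemma act1:
  assumes "a \<in> carrier A" "b \<in> carrier B"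
  shows "act1 a b \<in> additive_maps U.T U.T"
    and "p \<in> carrier P \<Longrightarrow> q \<in> carrier Q \<Longrightarrow> act1 a b (U.pure p q) = U.pure (a \<odot>\<^bsub>P\<^esub> p) (b \<odot>\<^bsub>Q\<^esub> q)"
proof -
  have "U.balanced U.T (\<lambda>p q. U.pure (a \<odot>\<^bsub>P\<^esub> p) (b \<odot>\<^bsub>Q\<^esub> q))"
  proof (rule U_balancedI)
    fix c p q assume *: "c \<in> carrier k" "p \<in> carrier P" "q \<in> carrier Q"
    have "U.pure (c \<odot>\<^bsub>Pk\<^esub> (a \<odot>\<^bsub>P\<^esub> p)) (b \<odot>\<^bsub>Q\<^esub> q) = U.pure (a \<odot>\<^bsub>P\<^esub> p) (c \<odot>\<^bsub>Qk\<^esub> (b \<odot>\<^bsub>Q\<^esub> q))"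
      using * assms by (intro U.pure_balanced) (simp_all add: Pk Qk)
    then show "U.pure (a \<odot>\<^bsub>P\<^esub> ((c \<odot>\<^bsub>A\<^esub> \<one>\<^bsub>A\<^esub>) \<odot>\<^bsub>P\<^esub> p)) (b \<odot>\<^bsub>Q\<^esub> q) = U.pure (a \<odot>\<^bsub>P\<^esub> p) (b \<odot>\<^bsub>Q\<^esub> ((c \<odot>\<^bsub>B\<^esub> \<one>\<^bsub>B\<^esub>) \<odot>\<^bsub>Q\<^esub> q))"
      using * assms smult_P_comm(1)[of c a p] smult_Q_comm(1)[of c b q] by (simp add: Pk(3) Qk(3))
  qed (use assms in \<open>auto simp: U_pure_closed U_pure_add P.smult_r_distr Q.smult_r_distr\<close>)
  from U.tensor_lift[OF UT this]
  show "act1 a b \<in> additive_maps U.T U.T"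
    and "p \<in> carrier P \<Longrightarrow> q \<in> carrier Q \<Longrightarrow> act1 a b (U.pure p q) = U.pure (a \<odot>\<^bsub>P\<^esub> p) (b \<odot>\<^bsub>Q\<^esub> q)"
    unfolding act1_def by (simp_all add: Pk Qk)
qed

lemma act:
  assumes u: "u \<in> carrier U.T"
  shows "(\<lambda>t. act t u) \<in> additive_maps T U.T"
    and "a \<in> carrier A \<Longrightarrow> b \<in> carrier B \<Longrightarrow> act (pure a b) u = act1 a b u"
proof -
  note eq = U_hom_eqI[OF UT _ _ _ u]
  have "balanced U.T (\<lambda>a b. act1 a b u)"
    unfolding balanced_def
  proof (intro conjI ballI)
    fix a a' b assume *: "a \<in> carrier A" "a' \<in> carrier A" "b \<in> carrier B"
    show "act1 (a \<oplus>\<^bsub>A\<^esub> a') b u = act1 a b u \<oplus>\<^bsub>U.T\<^esub> act1 a' b u"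
      by (rule eq) (use * in \<open>auto intro!: act1 additive_maps_add[OF UT] simp: act1 P.smult_l_distr U_pure_add\<close>)
  next
    fix a b b' assume *: "a \<in> carrier A" "b \<in> carrier B" "b' \<in> carrier B"
    show "act1 a (b \<oplus>\<^bsub>B\<^esub> b') u = act1 a b u \<oplus>\<^bsub>U.T\<^esub> act1 a b' u"
      by (rule eq) (use * in \<open>auto intro!: act1 additive_maps_add[OF UT] simp: act1 Q.smult_l_distr U_pure_add\<close>)
  next
    fix c a b assume *: "c \<in> carrier k" "a \<in> carrier A" "b \<in> carrier B"
    show "act1 (c \<odot>\<^bsub>A\<^esub> a) b u = act1 a (c \<odot>\<^bsub>B\<^esub> b) u"
    proof (rule eq)
      fix p q assume pq: "p \<in> carrier P" "q \<in> carrier Q"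
      have "U.pure (c \<odot>\<^bsub>Pk\<^esub> (a \<odot>\<^bsub>P\<^esub> p)) (b \<odot>\<^bsub>Q\<^esub> q) = U.pure (a \<odot>\<^bsub>P\<^esub> p) (c \<odot>\<^bsub>Qk\<^esub> (b \<odot>\<^bsub>Q\<^esub> q))"
        using * pq by (intro U.pure_balanced) (simp_all add: Pk Qk)
      then show "act1 (c \<odot>\<^bsub>A\<^esub> a) b (U.pure p q) = act1 a (c \<odot>\<^bsub>B\<^esub> b) (U.pure p q)"
        using * pq by (simp add: act1 smult_P_comm(2) smult_Q_comm(2))
    qed (use * in \<open>auto intro!: act1\<close>)
  qed (use additive_maps_props(4)[OF UT UT act1(1)] u in auto)
  from tensor_lift[OF UT this]
  show "(\<lambda>t. act t u) \<in> additive_maps T U.T"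
    and "a \<in> carrier A \<Longrightarrow> b \<in> carrier B \<Longrightarrow> act (pure a b) u = act1 a b u"
    unfolding act_def by auto
qed

lemma act_closed: "t \<in> carrier T \<Longrightarrow> u \<in> carrier U.T \<Longrightarrow> act t u \<in> carrier U.T"
  using additive_maps_props(4)[OF T.abelian_group_axioms UT act(1)] .

lemma act_pure:
  "a \<in> carrier A \<Longrightarrow> b \<in> carrier B \<Longrightarrow> p \<in> carrier P \<Longrightarrow> q \<in> carrier Q \<Longrightarrow>
    act (pure a b) (U.pure p q) = U.pure (a \<odot>\<^bsub>P\<^esub> p) (b \<odot>\<^bsub>Q\<^esub> q)"
  by (simp add: act act1 U_pure_closed)

lemma act_r:
  assumes t: "t \<in> carrier T"
  shows "act t \<in> additive_maps U.T U.T"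
proof -
  have "act t (u \<oplus>\<^bsub>U.T\<^esub> v) = act t u \<oplus>\<^bsub>U.T\<^esub> act t v" if *: "u \<in> carrier U.T" "v \<in> carrier U.T" for u v
  proof (rule tensor_hom_eqI[OF UT _ _ _ t])
    fix a b assume "a \<in> carrier A" "b \<in> carrier B"
    then show "act (pure a b) (u \<oplus>\<^bsub>U.T\<^esub> v) = act (pure a b) u \<oplus>\<^bsub>U.T\<^esub> act (pure a b) v"
      using * additive_maps_props(2)[OF UT UT act1(1)] by (simp add: act)
  qed (use * in \<open>auto intro!: act additive_maps_add[OF UT]\<close>)
  then show ?thesis using t act_closed by (fastforce simp: additive_maps_def)
qed

lemma act_mul:
  assumes s: "s \<in> carrier T" and t: "t \<in> carrier T" and u: "u \<in> carrier U.T"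
  shows "act (mul s t) u = act s (act t u)"
proof (rule tensor_hom_eqI[OF UT _ _ _ s])
  show "(\<lambda>s. act (mul s t) u) \<in> additive_maps T U.T" "(\<lambda>s. act s (act t u)) \<in> additive_maps T U.T"
    using additive_maps_comp[OF mul(1)[OF t] act(1)[OF u]] act(1)[OF act_closed[OF t u]] by auto
  fix a b assume ab: "a \<in> carrier A" "b \<in> carrier B"
  have "act (mul (pure a b) t) u = act1 a b (act t u)"
  proof (rule tensor_hom_eqI[OF UT _ _ _ t])
    show "(\<lambda>t. act (mul (pure a b) t) u) \<in> additive_maps T U.T" "(\<lambda>t. act1 a b (act t u)) \<in> additive_maps T U.T"
      using additive_maps_comp[OF mul_r act(1)[OF u]] additive_maps_comp[OF act(1)[OF u] act1(1)[OF ab]] ab by auto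
    fix c d assume cd: "c \<in> carrier A" "d \<in> carrier B"
    have "act1 (a \<otimes>\<^bsub>A\<^esub> c) (b \<otimes>\<^bsub>B\<^esub> d) u = act1 a b (act1 c d u)"
      by (rule U_hom_eqI[OF UT _ _ _ u])
        (use ab cd in \<open>auto intro!: act1 additive_maps_comp[OF act1(1) act1(1)] simp: act1 P.smult_assoc1 Q.smult_assoc1\<close>)
    then show "act (mul (pure a b) (pure c d)) u = act1 a b (act (pure c d) u)"
      using ab cd u by (simp add: mul_pure act)
  qed
  then show "act (mul (pure a b) t) u = act (pure a b) (act t u)"
    using ab t u by (simp add: act act_closed)
qed

lemma act_one:
  assumes "u \<in> carrier U.T"
  shows "act (pure \<one>\<^bsub>A\<^esub> \<one>\<^bsub>B\<^esub>) u = u"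
proof (rule U_hom_eqI[OF UT _ _ _ assms])
  show "act (pure \<one>\<^bsub>A\<^esub> \<one>\<^bsub>B\<^esub>) \<in> additive_maps U.T U.T" by (rule act_r) simp
qed (simp_all add: act_pure additive_maps_def)

lemma left_module_E: "left_module TA E"
proof -
  have ab: "abelian_group E"
    by (rule abelian_groupI) (use U.T.l_neg U.T.a_inv_closed in \<open>fastforce simp: E_simps U.T.a_ac\<close>)+
  show ?thesis
    unfolding left_module_def left_module_axioms_def
    using ring_tensor_algebra ab act_closed act_mul act_one additive_maps_props(2)[OF T.abelian_group_axioms UT act(1)]
      additive_maps_props(2)[OF UT UT act_r]
    by (simp add: E_simps tensor_algebra_simps)
qed

lemma E_hom:
  assumes f: "f \<in> additive_maps U.T G" and G: "left_module TA G"
    and sm: "\<And>a b p q. a \<in> carrier A \<Longrightarrow> b \<in> carrier B \<Longrightarrow> p \<in> carrier P \<Longrightarrow> q \<in> carrier Q \<Longrightarrow>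
       f (U.pure (a \<odot>\<^bsub>P\<^esub> p) (b \<odot>\<^bsub>Q\<^esub> q)) = pure a b \<odot>\<^bsub>G\<^esub> f (U.pure p q)"
  shows "f \<in> mod_hom TA E G"
proof -
  interpret G: left_module TA G by fact
  note GA = G.M.abelian_group_axioms and TT = T.abelian_group_axioms
  note fD = additive_maps_props(2,4)[OF UT GA f]
  have "f (act t u) = t \<odot>\<^bsub>G\<^esub> f u" if t: "t \<in> carrier T" and u: "u \<in> carrier U.T" for t u
  proof (rule tensor_hom_eqI[OF GA _ _ _ t])
    show "(\<lambda>t. f (act t u)) \<in> additive_maps T G" by (rule additive_maps_comp[OF act(1)[OF u] f])
    show "(\<lambda>t. t \<odot>\<^bsub>G\<^esub> f u) \<in> additive_maps T G"
      using fD(2)[OF u] G.smult_closed G.smult_l_distr by (auto simp: additive_maps_def tensor_algebra_simps)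
    fix a b assume ab: "a \<in> carrier A" "b \<in> carrier B"
    have p: "pure a b \<in> carrier TA" using ab by (simp add: tensor_algebra_simps)
    have "f (act1 a b u) = pure a b \<odot>\<^bsub>G\<^esub> f u"
    proof (rule U_hom_eqI[OF GA _ _ _ u])
      show "(\<lambda>u. f (act1 a b u)) \<in> additive_maps U.T G" by (rule additive_maps_comp[OF act1(1)[OF ab] f])
      show "(\<lambda>u. pure a b \<odot>\<^bsub>G\<^esub> f u) \<in> additive_maps U.T G"
        using p fD by (auto simp: additive_maps_def G.smult_r_distr)
    qed (use ab sm in \<open>simp add: act1\<close>)
    then show "f (act (pure a b) u) = pure a b \<odot>\<^bsub>G\<^esub> f u" using ab u by (simp add: act)
  qed
  then show ?thesis using fD by (intro mod_homI) (simp_all add: E_simps tensor_algebra_simps)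
qed

definition tensor_map :: "('p \<Rightarrow> 'p) \<Rightarrow> ('q \<Rightarrow> 'q) \<Rightarrow> ('p \<times> 'q \<Rightarrow>\<^sub>0 int) set \<Rightarrow> ('p \<times> 'q \<Rightarrow>\<^sub>0 int) set" where
  "tensor_map f g = tensor_lift k Pk Qk U.T (\<lambda>p q. U.pure (f p) (g q))"

lemma tensor_map:
  assumes "f \<in> mod_hom A P P" "g \<in> mod_hom B Q Q"
  shows "tensor_map f g \<in> additive_maps U.T U.T"
    and "p \<in> carrier P \<Longrightarrow> q \<in> carrier Q \<Longrightarrow> tensor_map f g (U.pure p q) = U.pure (f p) (g q)"
  using U.tensor_lift[OF UT tensor_map_balanced[OF assms]] unfolding tensor_map_def by (simp_all add: Pk Qk)

lemma U_pure_zero: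
  assumes "p \<in> carrier P" "q \<in> carrier Q"
  shows "U.pure \<zero>\<^bsub>P\<^esub> q = \<zero>\<^bsub>U.T\<^esub>" "U.pure p \<zero>\<^bsub>Q\<^esub> = \<zero>\<^bsub>U.T\<^esub>"
  using U_pure_add(1)[of "\<zero>\<^bsub>P\<^esub>" "\<zero>\<^bsub>P\<^esub>" q] U_pure_add(2)[of p "\<zero>\<^bsub>Q\<^esub>" "\<zero>\<^bsub>Q\<^esub>"] assms
    U.T.add.l_cancel_one'[OF U_pure_closed U_pure_closed] by auto

text \<open>The functional of the tensor product is \<open>p \<otimes> q \<mapsto> \<phi>(p) \<otimes> \<psi>(q)\<close>, and its value is multiplied with
  \<open>p0 \<otimes> q0\<close>.\<close>

lemma finite_rank_tensor_map_functionals: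
  assumes \<phi>: "\<phi> \<in> mod_hom A P (regular_module A)" and \<psi>: "\<psi> \<in> mod_hom B Q (regular_module B)"
    and p0: "p0 \<in> carrier P" and q0: "q0 \<in> carrier Q"
  shows "finite_rank TA E E (tensor_map (\<lambda>p. \<phi> p \<odot>\<^bsub>P\<^esub> p0) (\<lambda>q. \<psi> q \<odot>\<^bsub>Q\<^esub> q0))"
proof -
  interpret TA: ring TA by (rule ring_tensor_algebra)
  note \<phi>D = mod_homD[OF \<phi>, simplified] and \<psi>D = mod_homD[OF \<psi>, simplified] and TT = T.abelian_group_axioms
  define \<chi> where "\<chi> = tensor_lift k Pk Qk T (\<lambda>p q. pure (\<phi> p) (\<psi> q))"
  have bal: "U.balanced T (\<lambda>p q. pure (\<phi> p) (\<psi> q))"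
  proof (rule U_balancedI)
    fix c p q assume *: "c \<in> carrier k" "p \<in> carrier P" "q \<in> carrier Q"
    have "pure (c \<odot>\<^bsub>A\<^esub> \<phi> p) (\<psi> q) = pure (\<phi> p) (c \<odot>\<^bsub>B\<^esub> \<psi> q)"
      using * \<phi>D(1) \<psi>D(1) by (intro pure_balanced) auto
    then show "pure (\<phi> ((c \<odot>\<^bsub>A\<^esub> \<one>\<^bsub>A\<^esub>) \<odot>\<^bsub>P\<^esub> p)) (\<psi> q) = pure (\<phi> p) (\<psi> ((c \<odot>\<^bsub>B\<^esub> \<one>\<^bsub>B\<^esub>) \<odot>\<^bsub>Q\<^esub> q))"
      using * \<phi>D(1) \<psi>D(1) by (simp add: \<phi>D(3) \<psi>D(3) A.smult_mult_l B.smult_mult_l)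
  qed (auto simp: \<phi>D \<psi>D pure_add_l pure_add_r)
  have \<chi>p: "\<chi> (U.pure p q) = pure (\<phi> p) (\<psi> q)" if "p \<in> carrier P" "q \<in> carrier Q" for p q
    using U.tensor_lift(2)[OF TT bal] that unfolding \<chi>_def by (simp add: Pk Qk)
  have \<chi>add: "\<chi> \<in> additive_maps U.T T" unfolding \<chi>_def by (rule U.tensor_lift(1)[OF TT bal])
  have \<chi>: "\<chi> \<in> mod_hom TA E (regular_module TA)"
  proof (rule E_hom[OF _ TA.left_module_regular])
    show "\<chi> \<in> additive_maps U.T (regular_module TA)"
      using \<chi>add by (simp add: additive_maps_def tensor_algebra_simps)
  qed (simp add: \<chi>p \<phi>D \<psi>D mul_pure tensor_algebra_simps)
  have e0: "U.pure p0 q0 \<in> carrier E" using p0 q0 by (simp add: E_simps U_pure_closed)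
  show ?thesis
  proof (rule finite_rank_cong[OF finite_rank_functional[OF left_module_E \<chi> e0]])
    fix t assume t: "t \<in> carrier E"
    show "tensor_map (\<lambda>p. \<phi> p \<odot>\<^bsub>P\<^esub> p0) (\<lambda>q. \<psi> q \<odot>\<^bsub>Q\<^esub> q0) t = \<chi> t \<odot>\<^bsub>E\<^esub> U.pure p0 q0"
      unfolding E_simps
      by (rule U_hom_eqI[OF UT tensor_map(1)[OF P.mod_hom_functional[OF \<phi> p0] Q.mod_hom_functional[OF \<psi> q0]]
            additive_maps_comp[OF \<chi>add act(1)[OF U_pure_closed[OF p0 q0]]]])
        (use t p0 q0 in \<open>simp_all add: E_simps tensor_map(2)[OF P.mod_hom_functional[OF \<phi> p0] Q.mod_hom_functional[OF \<psi> q0]]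
            \<chi>p act_pure \<phi>D \<psi>D\<close>)
  qed
qed

text \<open>Expanding both maps leaves sums of maps as in the preceding lemma.\<close>

lemma finite_rank_tensor_map:
  assumes f: "finite_rank A P P f" and g: "finite_rank B Q Q g"
  shows "finite_rank TA E E (tensor_map f g)"
proof -
  note PM = P.left_module_axioms and QM = Q.left_module_axioms
  have cong: "finite_rank TA E E (tensor_map f g)"
    if "finite_rank TA E E h" "finite_rank TA E E h'" "f \<in> mod_hom A P P" "g \<in> mod_hom B Q Q"
      "h \<in> additive_maps U.T U.T" "h' \<in> additive_maps U.T U.T"
      "\<And>p q. p \<in> carrier P \<Longrightarrow> q \<in> carrier Q \<Longrightarrow> U.pure (f p) (g q) = h (U.pure p q) \<oplus>\<^bsub>U.T\<^esub> h' (U.pure p q)"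
    for f g h h'
  proof (rule finite_rank_cong[OF finite_rank_add[OF left_module_E left_module_E that(1,2)]])
    fix t assume t: "t \<in> carrier E"
    show "tensor_map f g t = h t \<oplus>\<^bsub>E\<^esub> h' t"
      unfolding E_simps
      by (rule U_hom_eqI[OF UT tensor_map(1)[OF that(3,4)] additive_maps_add[OF UT that(5,6)]])
        (use t that in \<open>simp_all add: tensor_map(2) E_simps\<close>)
  qed
  have null: "finite_rank TA E E (tensor_map f g)"
    if "f \<in> mod_hom A P P" "g \<in> mod_hom B Q Q"
      "\<And>p q. p \<in> carrier P \<Longrightarrow> q \<in> carrier Q \<Longrightarrow> U.pure (f p) (g q) = \<zero>\<^bsub>U.T\<^esub>" for f g
  proof (rule finite_rank.zero)
    fix t assume t: "t \<in> carrier E"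
    show "tensor_map f g t = \<zero>\<^bsub>E\<^esub>"
      unfolding E_simps
      by (rule U_hom_eqI[OF UT tensor_map(1)[OF that(1,2)], of "\<lambda>_. \<zero>\<^bsub>U.T\<^esub>"])
        (use t that in \<open>simp_all add: tensor_map(2) E_simps additive_maps_def\<close>)
  qed
  have inner: "finite_rank TA E E (tensor_map (\<lambda>p. \<phi> p \<odot>\<^bsub>P\<^esub> p0) g)"
    if \<phi>: "\<phi> \<in> mod_hom A P (regular_module A)" and p0: "p0 \<in> carrier P" for \<phi> p0
    using g
  proof induction
    case (zero g)
    note fh = P.mod_hom_functional[OF \<phi> p0]
    show ?case
      by (rule null[OF fh mod_hom_cong[OF QM Q.mod_hom_zero_map]])
        (use zero mod_homD(1)[OF fh] in \<open>auto simp: U_pure_zero\<close>)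
  next
    case (add g \<psi> q0 h)
    note fh = P.mod_hom_functional[OF \<phi> p0]
    note gh = finite_rank_hom[OF QM QM add.hyps(1)] and \<psi>h = Q.mod_hom_functional[OF add.hyps(2,3)]
    note hh = finite_rank_hom[OF QM QM finite_rank.add[OF add.hyps]]
    show ?case
      by (rule cong[OF add.IH finite_rank_tensor_map_functionals[OF \<phi> add.hyps(2) p0 add.hyps(3)] fh hh
            tensor_map(1)[OF fh gh] tensor_map(1)[OF fh \<psi>h]])
        (use add.hyps(4) mod_homD(1)[OF fh] mod_homD(1)[OF gh] mod_homD(1)[OF \<psi>h] in
          \<open>simp_all add: tensor_map(2)[OF fh gh] tensor_map(2)[OF fh \<psi>h] U_pure_add\<close>)
  qed
  note gh = finite_rank_hom[OF QM QM g]
  show ?thesis using f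
  proof induction
    case (zero f)
    show ?case
      by (rule null[OF mod_hom_cong[OF PM P.mod_hom_zero_map] gh])
        (use zero mod_homD(1)[OF gh] in \<open>auto simp: U_pure_zero\<close>)
  next
    case (add f \<phi> p0 h)
    note fh = finite_rank_hom[OF PM PM add.hyps(1)] and \<phi>h = P.mod_hom_functional[OF add.hyps(2,3)]
    note hh = finite_rank_hom[OF PM PM finite_rank.add[OF add.hyps]]
    show ?case
      by (rule cong[OF add.IH inner[OF add.hyps(2,3)] hh gh tensor_map(1)[OF fh gh] tensor_map(1)[OF \<phi>h gh]])
        (use add.hyps(4) mod_homD(1)[OF fh] mod_homD(1)[OF gh] mod_homD(1)[OF \<phi>h] in
          \<open>simp_all add: tensor_map(2)[OF fh gh] tensor_map(2)[OF \<phi>h gh] U_pure_add\<close>)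
  qed
qed

theorem fg_projective_E:
  assumes "fg_projective A P" "fg_projective B Q"
  shows "fg_projective TA E"
proof -
  have "finite_rank TA E E (\<lambda>t. t)"
  proof (rule finite_rank_cong[OF finite_rank_tensor_map])
    show "finite_rank A P P (\<lambda>p. p)" "finite_rank B Q Q (\<lambda>q. q)" using assms by (auto simp: fg_projective_def)
    fix t assume t: "t \<in> carrier E"
    show "t = tensor_map (\<lambda>p. p) (\<lambda>q. q) t"
      by (rule U_hom_eqI[OF UT, of "\<lambda>t. t" "tensor_map (\<lambda>p. p) (\<lambda>q. q)"])
        (use t tensor_map[OF mod_hom_ident mod_hom_ident] in \<open>auto simp: E_simps additive_maps_def\<close>)
  qed
  then show ?thesis using left_module_E by (simp add: fg_projective_def)
qed

end

section \<open>Tensoring with a bimodule\<close>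

text \<open>The functor \<open>U \<otimes>\<^sub>R -\<close> of an \<open>S\<close>-\<open>R\<close>-bimodule. The two module structures are separate records \<open>U\<close> and
  \<open>V\<close> on one group, since they arise from two different instances of \<open>external_tensor\<close>.\<close>

locale tensor_functor = U: left_module S U + V: left_module "op_ring R" V
  for S :: "('s, 'u1) ring_scheme" and R :: "('r, 'u2) ring_scheme"
    and U :: "('s, 'm, 'v1) module_scheme" and V :: "('r, 'm, 'v2) module_scheme" +
  assumes V: "carrier V = carrier U" "add V = add U"
    and commute: "\<And>s r u. s \<in> carrier S \<Longrightarrow> r \<in> carrier R \<Longrightarrow> u \<in> carrier U \<Longrightarrow>
      s \<odot>\<^bsub>U\<^esub> (r \<odot>\<^bsub>V\<^esub> u) = r \<odot>\<^bsub>V\<^esub> (s \<odot>\<^bsub>U\<^esub> u)"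
begin

definition F :: "('r, 'y, 'w) module_scheme \<Rightarrow> ('s, ('m \<times> 'y \<Rightarrow>\<^sub>0 int) set) module" where
  "F Y = \<lparr>carrier = carrier (tensor R V Y), monoid.mult = undefined, one = undefined,
     ring.zero = \<zero>\<^bsub>tensor R V Y\<^esub>, add = add (tensor R V Y),
     smult = (\<lambda>s. tensor_lift R V Y (tensor R V Y) (\<lambda>u y. pure_tensor R V Y (s \<odot>\<^bsub>U\<^esub> u) y))\<rparr>"

definition F_map :: "('r, 'y, 'w) module_scheme \<Rightarrow> ('r, 'z, 'w1) module_scheme \<Rightarrow> ('y \<Rightarrow> 'z)
    \<Rightarrow> ('m \<times> 'y \<Rightarrow>\<^sub>0 int) set \<Rightarrow> ('m \<times> 'z \<Rightarrow>\<^sub>0 int) set" where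
  "F_map Y Z f = tensor_lift R V Y (tensor R V Z) (\<lambda>u y. pure_tensor R V Z u (f y))"

lemma F_simps: "carrier (F Y) = carrier (tensor R V Y)" "\<zero>\<^bsub>F Y\<^esub> = \<zero>\<^bsub>tensor R V Y\<^esub>" "add (F Y) = add (tensor R V Y)"
  by (simp_all add: F_def)

lemma tensor_pair_V: "left_module R Y \<Longrightarrow> tensor_pair R V Y"
  by (intro tensor_pair.intro V.left_module_axioms)

lemma abelian_group_F:
  assumes "left_module R Y" shows "abelian_group (F Y)"
proof -
  interpret Q: tensor_pair R V Y by (rule tensor_pair_V[OF assms])
  show ?thesis by (rule abelian_groupI) (use Q.T.l_neg Q.T.a_inv_closed in \<open>fastforce simp: F_simps Q.T.a_ac\<close>)+
qed

lemma lift: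
  assumes Y: "left_module R Y" and G: "abelian_group G"
    and bal: "\<And>u y. u \<in> carrier U \<Longrightarrow> y \<in> carrier Y \<Longrightarrow> \<phi> u y \<in> carrier G"
      "\<And>u u' y. u \<in> carrier U \<Longrightarrow> u' \<in> carrier U \<Longrightarrow> y \<in> carrier Y \<Longrightarrow> \<phi> (u \<oplus>\<^bsub>U\<^esub> u') y = \<phi> u y \<oplus>\<^bsub>G\<^esub> \<phi> u' y"
      "\<And>u y y'. u \<in> carrier U \<Longrightarrow> y \<in> carrier Y \<Longrightarrow> y' \<in> carrier Y \<Longrightarrow> \<phi> u (y \<oplus>\<^bsub>Y\<^esub> y') = \<phi> u y \<oplus>\<^bsub>G\<^esub> \<phi> u y'"
      "\<And>r u y. r \<in> carrier R \<Longrightarrow> u \<in> carrier U \<Longrightarrow> y \<in> carrier Y \<Longrightarrow> \<phi> (r \<odot>\<^bsub>V\<^esub> u) y = \<phi> u (r \<odot>\<^bsub>Y\<^esub> y)"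
  shows "tensor_lift R V Y G \<phi> \<in> additive_maps (F Y) G"
    and "u \<in> carrier U \<Longrightarrow> y \<in> carrier Y \<Longrightarrow> tensor_lift R V Y G \<phi> (pure_tensor R V Y u y) = \<phi> u y"
proof -
  interpret Q: tensor_pair R V Y by (rule tensor_pair_V[OF Y])
  have b: "Q.balanced G \<phi>" unfolding Q.balanced_def using bal by (simp add: V)
  show "tensor_lift R V Y G \<phi> \<in> additive_maps (F Y) G"
    using Q.tensor_lift(1)[OF G b] by (simp add: additive_maps_def F_simps)
  show "u \<in> carrier U \<Longrightarrow> y \<in> carrier Y \<Longrightarrow> tensor_lift R V Y G \<phi> (pure_tensor R V Y u y) = \<phi> u y"
    using Q.tensor_lift(2)[OF G b] by (simp add: V)
qed

lemma hom_eqI: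
  assumes Y: "left_module R Y" and "abelian_group G" "f \<in> additive_maps (F Y) G" "g \<in> additive_maps (F Y) G"
    "\<And>u y. u \<in> carrier U \<Longrightarrow> y \<in> carrier Y \<Longrightarrow> f (pure_tensor R V Y u y) = g (pure_tensor R V Y u y)" "t \<in> carrier (F Y)"
  shows "f t = g t"
proof -
  interpret Q: tensor_pair R V Y by (rule tensor_pair_V[OF Y])
  show ?thesis
    by (rule Q.tensor_hom_eqI[OF assms(2)]) (use assms(3-) in \<open>simp_all add: additive_maps_def F_simps V\<close>)
qed

lemma pure:
  assumes Y: "left_module R Y"
  shows "u \<in> carrier U \<Longrightarrow> y \<in> carrier Y \<Longrightarrow> pure_tensor R V Y u y \<in> carrier (F Y)"
    "u \<in> carrier U \<Longrightarrow> u' \<in> carrier U \<Longrightarrow> y \<in> carrier Y \<Longrightarrow>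
      pure_tensor R V Y (u \<oplus>\<^bsub>U\<^esub> u') y = pure_tensor R V Y u y \<oplus>\<^bsub>F Y\<^esub> pure_tensor R V Y u' y"
    "u \<in> carrier U \<Longrightarrow> y \<in> carrier Y \<Longrightarrow> y' \<in> carrier Y \<Longrightarrow>
      pure_tensor R V Y u (y \<oplus>\<^bsub>Y\<^esub> y') = pure_tensor R V Y u y \<oplus>\<^bsub>F Y\<^esub> pure_tensor R V Y u y'"
    "r \<in> carrier R \<Longrightarrow> u \<in> carrier U \<Longrightarrow> y \<in> carrier Y \<Longrightarrow>
      pure_tensor R V Y (r \<odot>\<^bsub>V\<^esub> u) y = pure_tensor R V Y u (r \<odot>\<^bsub>Y\<^esub> y)"
proof -
  interpret Q: tensor_pair R V Y by (rule tensor_pair_V[OF Y])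
  show "u \<in> carrier U \<Longrightarrow> y \<in> carrier Y \<Longrightarrow> pure_tensor R V Y u y \<in> carrier (F Y)"
    using Q.pure_closed by (simp add: F_simps V)
  show "u \<in> carrier U \<Longrightarrow> u' \<in> carrier U \<Longrightarrow> y \<in> carrier Y \<Longrightarrow>
      pure_tensor R V Y (u \<oplus>\<^bsub>U\<^esub> u') y = pure_tensor R V Y u y \<oplus>\<^bsub>F Y\<^esub> pure_tensor R V Y u' y"
    using Q.pure_add_l[of u u' y] by (simp add: F_simps V)
  show "u \<in> carrier U \<Longrightarrow> y \<in> carrier Y \<Longrightarrow> y' \<in> carrier Y \<Longrightarrow>
      pure_tensor R V Y u (y \<oplus>\<^bsub>Y\<^esub> y') = pure_tensor R V Y u y \<oplus>\<^bsub>F Y\<^esub> pure_tensor R V Y u y'"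
    using Q.pure_add_r[of u y y'] by (simp add: F_simps V)
  show "r \<in> carrier R \<Longrightarrow> u \<in> carrier U \<Longrightarrow> y \<in> carrier Y \<Longrightarrow>
      pure_tensor R V Y (r \<odot>\<^bsub>V\<^esub> u) y = pure_tensor R V Y u (r \<odot>\<^bsub>Y\<^esub> y)"
    using Q.pure_balanced[of u y r] by (simp add: V)
qed

lemma V_smult_closed: "r \<in> carrier R \<Longrightarrow> u \<in> carrier U \<Longrightarrow> r \<odot>\<^bsub>V\<^esub> u \<in> carrier U"
  using V.smult_closed[of r u] by (simp add: V)

lemma smult_F:
  assumes Y: "left_module R Y" and s: "s \<in> carrier S"
  shows "smult (F Y) s \<in> additive_maps (F Y) (F Y)"
    and "u \<in> carrier U \<Longrightarrow> y \<in> carrier Y \<Longrightarrow> s \<odot>\<^bsub>F Y\<^esub> pure_tensor R V Y u y = pure_tensor R V Y (s \<odot>\<^bsub>U\<^esub> u) y"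
proof -
  interpret Y: left_module R Y by fact
  have eq: "smult (F Y) s = tensor_lift R V Y (F Y) (\<lambda>u y. pure_tensor R V Y (s \<odot>\<^bsub>U\<^esub> u) y)"
    by (simp add: F_def tensor_lift_def additive_maps_def)
  note l = lift[OF Y abelian_group_F[OF Y], of "\<lambda>u y. pure_tensor R V Y (s \<odot>\<^bsub>U\<^esub> u) y"]
  show "smult (F Y) s \<in> additive_maps (F Y) (F Y)"
    unfolding eq by (rule l(1)) (use s in \<open>simp_all add: pure[OF Y] U.smult_r_distr commute\<close>)
  show "u \<in> carrier U \<Longrightarrow> y \<in> carrier Y \<Longrightarrow> s \<odot>\<^bsub>F Y\<^esub> pure_tensor R V Y u y = pure_tensor R V Y (s \<odot>\<^bsub>U\<^esub> u) y"
    unfolding eq by (rule l(2)) (use s in \<open>simp_all add: pure[OF Y] U.smult_r_distr commute\<close>)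
qed

lemma left_module_F:
  assumes Y: "left_module R Y"
  shows "left_module S (F Y)"
proof -
  note AF = abelian_group_F[OF Y]
  interpret AF: abelian_group "F Y" by (rule AF)
  note sD = additive_maps_props(2,4)[OF AF AF smult_F(1)[OF Y]]
  have id: "(\<lambda>t. t) \<in> additive_maps (F Y) (F Y)" by (simp add: additive_maps_def)
  show ?thesis
    unfolding left_module_def left_module_axioms_def
  proof (intro conjI allI impI U.R.ring_axioms AF)
    fix a b t assume *: "a \<in> carrier S" "b \<in> carrier S" "t \<in> carrier (F Y)"
    show "(a \<oplus>\<^bsub>S\<^esub> b) \<odot>\<^bsub>F Y\<^esub> t = a \<odot>\<^bsub>F Y\<^esub> t \<oplus>\<^bsub>F Y\<^esub> b \<odot>\<^bsub>F Y\<^esub> t"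
      by (rule hom_eqI[OF Y AF smult_F(1)[OF Y] additive_maps_add[OF AF smult_F(1)[OF Y] smult_F(1)[OF Y]]])
        (use * in \<open>simp_all add: smult_F(2)[OF Y] pure[OF Y] U.smult_l_distr\<close>)
    show "(a \<otimes>\<^bsub>S\<^esub> b) \<odot>\<^bsub>F Y\<^esub> t = a \<odot>\<^bsub>F Y\<^esub> (b \<odot>\<^bsub>F Y\<^esub> t)"
      by (rule hom_eqI[OF Y AF smult_F(1)[OF Y] additive_maps_comp[OF smult_F(1)[OF Y] smult_F(1)[OF Y]]])
        (use * in \<open>simp_all add: smult_F(2)[OF Y] pure[OF Y] U.smult_assoc1\<close>)
  next
    fix t assume *: "t \<in> carrier (F Y)"
    show "\<one>\<^bsub>S\<^esub> \<odot>\<^bsub>F Y\<^esub> t = t"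
      by (rule hom_eqI[OF Y AF smult_F(1)[OF Y] id])
        (use * in \<open>simp_all add: smult_F(2)[OF Y] pure[OF Y]\<close>)
  qed (use sD in simp_all)
qed

lemma F_hom:
  assumes Y: "left_module R Y" and G: "left_module S G" and f: "f \<in> additive_maps (F Y) G"
    and sm: "\<And>s u y. s \<in> carrier S \<Longrightarrow> u \<in> carrier U \<Longrightarrow> y \<in> carrier Y \<Longrightarrow>
      f (pure_tensor R V Y (s \<odot>\<^bsub>U\<^esub> u) y) = s \<odot>\<^bsub>G\<^esub> f (pure_tensor R V Y u y)"
  shows "f \<in> mod_hom S (F Y) G"
proof -
  interpret G: left_module S G by fact
  note AG = G.M.abelian_group_axioms and AF = abelian_group_F[OF Y]
  note fD = additive_maps_props(2,4)[OF AF AG f]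
  have "f (s \<odot>\<^bsub>F Y\<^esub> t) = s \<odot>\<^bsub>G\<^esub> f t" if s: "s \<in> carrier S" and t: "t \<in> carrier (F Y)" for s t
  proof (rule hom_eqI[OF Y AG additive_maps_comp[OF smult_F(1)[OF Y s] f] _ _ t])
    show "(\<lambda>t. s \<odot>\<^bsub>G\<^esub> f t) \<in> additive_maps (F Y) G"
      using s fD by (auto simp: additive_maps_def G.smult_r_distr)
  qed (use s sm in \<open>simp add: smult_F(2)[OF Y]\<close>)
  then show ?thesis using fD by (intro mod_homI)
qed

lemma F_map:
  assumes Y: "left_module R Y" and Z: "left_module R Z" and f: "f \<in> mod_hom R Y Z"
  shows "F_map Y Z f \<in> mod_hom S (F Y) (F Z)"
    and "u \<in> carrier U \<Longrightarrow> y \<in> carrier Y \<Longrightarrow> F_map Y Z f (pure_tensor R V Y u y) = pure_tensor R V Z u (f y)"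
proof -
  have eq: "F_map Y Z f = tensor_lift R V Y (F Z) (\<lambda>u y. pure_tensor R V Z u (f y))"
    by (simp add: F_map_def tensor_lift_def additive_maps_def F_simps)
  note l = lift[OF Y abelian_group_F[OF Z], of "\<lambda>u y. pure_tensor R V Z u (f y)"]
  have 1: "F_map Y Z f \<in> additive_maps (F Y) (F Z)"
    unfolding eq by (rule l(1)) (use mod_homD[OF f] in \<open>simp_all add: pure[OF Z]\<close>)
  show 2: "F_map Y Z f (pure_tensor R V Y u y) = pure_tensor R V Z u (f y)" if "u \<in> carrier U" "y \<in> carrier Y" for u y
    unfolding eq by (rule l(2)) (use mod_homD[OF f] that in \<open>simp_all add: pure[OF Z]\<close>)
  show "F_map Y Z f \<in> mod_hom S (F Y) (F Z)"
    by (rule F_hom[OF Y left_module_F[OF Z] 1]) (use mod_homD[OF f] in \<open>simp add: 2 smult_F(2)[OF Z]\<close>)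
qed

lemma hom_additive: "f \<in> mod_hom S M N \<Longrightarrow> f \<in> additive_maps M N"
  by (simp add: mod_hom_def)

lemma F_mod_iso:
  assumes "mod_iso R Y Z"
  shows "mod_iso S (F Y) (F Z)"
proof -
  have Y: "left_module R Y" and Z: "left_module R Z" using assms by (auto simp: mod_iso_def)
  obtain f g where fg: "f \<in> mod_hom R Y Z" "g \<in> mod_hom R Z Y"
    "\<And>x. x \<in> carrier Y \<Longrightarrow> g (f x) = x" "\<And>y. y \<in> carrier Z \<Longrightarrow> f (g y) = y"
    by (rule mod_isoE[OF assms]) (rule that)
  note Ff = F_map[OF Y Z fg(1)] and Fg = F_map[OF Z Y fg(2)]
  show ?thesis
  proof (rule mod_isoI[OF left_module_F[OF Y] left_module_F[OF Z] Ff(1) Fg(1)])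
    fix t assume t: "t \<in> carrier (F Y)"
    show "F_map Z Y g (F_map Y Z f t) = t"
      by (rule hom_eqI[OF Y abelian_group_F[OF Y] hom_additive[OF mod_hom_comp[OF Ff(1) Fg(1)]] hom_additive[OF mod_hom_ident] _ t])
        (simp add: Ff(2) Fg(2) fg(3) mod_homD(1)[OF fg(1)])
  next
    fix t assume t: "t \<in> carrier (F Z)"
    show "F_map Y Z f (F_map Z Y g t) = t"
      by (rule hom_eqI[OF Z abelian_group_F[OF Z] hom_additive[OF mod_hom_comp[OF Fg(1) Ff(1)]] hom_additive[OF mod_hom_ident] _ t])
        (simp add: Ff(2) Fg(2) fg(4) mod_homD(1)[OF fg(2)])
  qed
qed

lemma pure_zero:
  assumes Y: "left_module R Y" and u: "u \<in> carrier U"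
  shows "pure_tensor R V Y u \<zero>\<^bsub>Y\<^esub> = \<zero>\<^bsub>F Y\<^esub>"
proof -
  interpret Y: left_module R Y by fact
  interpret F: left_module S "F Y" by (rule left_module_F[OF Y])
  show ?thesis
    using pure(3)[OF Y u, of "\<zero>\<^bsub>Y\<^esub>" "\<zero>\<^bsub>Y\<^esub>"] F.M.add.l_cancel_one'[OF pure(1)[OF Y u] pure(1)[OF Y u]] by auto
qed

lemma F_zero:
  assumes Y: "left_module R Y" and z: "carrier Y = {\<zero>\<^bsub>Y\<^esub>}"
  shows "carrier (F Y) = {\<zero>\<^bsub>F Y\<^esub>}"
proof -
  interpret Y: left_module R Y by fact
  interpret F: left_module S "F Y" by (rule left_module_F[OF Y])
  have "t = \<zero>\<^bsub>F Y\<^esub>" if "t \<in> carrier (F Y)" for t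
    by (rule hom_eqI[OF Y abelian_group_F[OF Y] hom_additive[OF mod_hom_ident] hom_additive[OF F.mod_hom_zero_map]])
      (use that z pure_zero[OF Y] in auto)
  then show ?thesis by auto
qed

lemma finite_rank_F_map:
  assumes U: "fg_projective S U" and X: "left_module R X" and Y: "left_module R Y" and h: "finite_rank R X Y h"
  shows "finite_rank S (F X) (F Y) (F_map X Y h)"
  using h
proof induction
  interpret Y: left_module R Y by fact
  interpret FY: left_module S "F Y" by (rule left_module_F[OF Y])
  case (zero h)
  have h: "h \<in> mod_hom R X Y" by (rule mod_hom_cong[OF X Y.mod_hom_zero_map zero])
  have "F_map X Y h t = \<zero>\<^bsub>F Y\<^esub>" if "t \<in> carrier (F X)" for t
    by (rule hom_eqI[OF X abelian_group_F[OF Y] hom_additive[OF F_map(1)[OF X Y h]] hom_additive[OF FY.mod_hom_zero_map]])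
      (use that zero pure_zero[OF Y] in \<open>auto simp: F_map(2)[OF X Y h]\<close>)
  then show ?case by (rule finite_rank.zero)
next
  interpret X: left_module R X by fact
  interpret Y: left_module R Y by fact
  case (add g \<phi> y h)
  note FX = left_module_F[OF X] and FY = left_module_F[OF Y] and UM = U.left_module_axioms
  interpret FY: left_module S "F Y" by (rule FY)
  note gh = finite_rank_hom[OF X Y add.hyps(1)] and hh = finite_rank_hom[OF X Y finite_rank.add[OF add.hyps]]
  note \<phi>D = mod_homD[OF add.hyps(2), simplified]
  \<comment> \<open>On \<open>U \<otimes> X\<close> the summand \<open>x \<mapsto> \<phi>(x) y\<close> becomes the composite
    \<open>u \<otimes> x \<mapsto> u \<phi>(x) \<mapsto> u \<phi>(x) \<otimes> y\<close> through \<open>U\<close>.\<close>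
  define \<mu> where "\<mu> = tensor_lift R V X U (\<lambda>u x. \<phi> x \<odot>\<^bsub>V\<^esub> u)"
  have bal: "\<And>u u' x. u \<in> carrier U \<Longrightarrow> u' \<in> carrier U \<Longrightarrow> x \<in> carrier X \<Longrightarrow>
        \<phi> x \<odot>\<^bsub>V\<^esub> (u \<oplus>\<^bsub>U\<^esub> u') = \<phi> x \<odot>\<^bsub>V\<^esub> u \<oplus>\<^bsub>U\<^esub> \<phi> x \<odot>\<^bsub>V\<^esub> u'"
      "\<And>u x x'. u \<in> carrier U \<Longrightarrow> x \<in> carrier X \<Longrightarrow> x' \<in> carrier X \<Longrightarrow>
        \<phi> (x \<oplus>\<^bsub>X\<^esub> x') \<odot>\<^bsub>V\<^esub> u = \<phi> x \<odot>\<^bsub>V\<^esub> u \<oplus>\<^bsub>U\<^esub> \<phi> x' \<odot>\<^bsub>V\<^esub> u"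
      "\<And>r u x. r \<in> carrier R \<Longrightarrow> u \<in> carrier U \<Longrightarrow> x \<in> carrier X \<Longrightarrow>
        \<phi> x \<odot>\<^bsub>V\<^esub> (r \<odot>\<^bsub>V\<^esub> u) = \<phi> (r \<odot>\<^bsub>X\<^esub> x) \<odot>\<^bsub>V\<^esub> u"
    using V.smult_r_distr V.smult_l_distr V.smult_assoc1 by (simp_all add: V \<phi>D)
  note l = lift[OF X U.M.abelian_group_axioms, of "\<lambda>u x. \<phi> x \<odot>\<^bsub>V\<^esub> u"]
  have \<mu>a: "\<mu> \<in> additive_maps (F X) U"
    unfolding \<mu>_def by (rule l(1)) (simp_all add: bal V_smult_closed \<phi>D(1))
  have \<mu>p: "\<mu> (pure_tensor R V X u x) = \<phi> x \<odot>\<^bsub>V\<^esub> u" if "u \<in> carrier U" "x \<in> carrier X" for u x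
    unfolding \<mu>_def by (rule l(2)) (use that in \<open>simp_all add: bal V_smult_closed \<phi>D(1)\<close>)
  have \<mu>: "\<mu> \<in> mod_hom S (F X) U"
    by (rule F_hom[OF X UM \<mu>a]) (simp add: \<mu>p commute \<phi>D(1))
  have \<nu>: "(\<lambda>u. pure_tensor R V Y u y) \<in> mod_hom S U (F Y)"
    by (rule mod_homI) (use add.hyps(3) in \<open>simp_all add: pure[OF Y] smult_F(2)[OF Y]\<close>)
  have fr: "finite_rank S (F X) (F Y) (\<lambda>t. pure_tensor R V Y (\<mu> t) y)"
    using finite_rank_comp_left[OF UM FY FX \<nu> finite_rank_comp_right[OF \<mu>, of U "\<lambda>u. u"]] U
    by (simp add: fg_projective_def)
  show ?case
  proof (rule finite_rank_cong[OF finite_rank_add[OF FX FY add.IH fr]])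
    fix t assume t: "t \<in> carrier (F X)"
    show "F_map X Y h t = F_map X Y g t \<oplus>\<^bsub>F Y\<^esub> pure_tensor R V Y (\<mu> t) y"
    proof (rule hom_eqI[OF X abelian_group_F[OF Y] hom_additive[OF F_map(1)[OF X Y hh]]
            hom_additive[OF FY.mod_hom_add[OF F_map(1)[OF X Y gh] mod_hom_comp[OF \<mu> \<nu>]]] _ t])
      fix u x assume ux: "u \<in> carrier U" "x \<in> carrier X"
      have "F_map X Y h (pure_tensor R V X u x) = pure_tensor R V Y u (g x \<oplus>\<^bsub>Y\<^esub> \<phi> x \<odot>\<^bsub>Y\<^esub> y)"
        using F_map(2)[OF X Y hh ux] add.hyps(4)[OF ux(2)] by simp
      also have "\<dots> = F_map X Y g (pure_tensor R V X u x) \<oplus>\<^bsub>F Y\<^esub> pure_tensor R V Y (\<mu> (pure_tensor R V X u x)) y"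
        using ux add.hyps(3) mod_homD(1)[OF gh ux(2)] F_map(2)[OF X Y gh ux] by (simp add: \<mu>p pure[OF Y] \<phi>D(1))
      finally show "F_map X Y h (pure_tensor R V X u x) =
          F_map X Y g (pure_tensor R V X u x) \<oplus>\<^bsub>F Y\<^esub> pure_tensor R V Y (\<mu> (pure_tensor R V X u x)) y" .
    qed
  qed
qed

lemma F_fg_projective:
  assumes U: "fg_projective S U" and P: "fg_projective R P"
  shows "fg_projective S (F P)"
proof -
  have PM: "left_module R P" using P by (simp add: fg_projective_def)
  note FP = left_module_F[OF PM] and id = F_map[OF PM PM mod_hom_ident]
  have "finite_rank S (F P) (F P) (\<lambda>t. t)"
  proof (rule finite_rank_cong[OF finite_rank_F_map[OF U PM PM]])
    show "finite_rank R P P (\<lambda>x. x)" using P by (simp add: fg_projective_def)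
    fix t assume t: "t \<in> carrier (F P)"
    show "t = F_map P P (\<lambda>x. x) t"
      by (rule hom_eqI[OF PM abelian_group_F[OF PM] hom_additive[OF mod_hom_ident] hom_additive[OF id(1)] _ t])
        (simp add: id(2))
  qed
  then show ?thesis using FP by (simp add: fg_projective_def)
qed

text \<open>The map \<open>h \<otimes> 1\<close> on \<open>U \<otimes> Y\<close>.\<close>

definition twist :: "('r, 'y, 'w) module_scheme \<Rightarrow> ('m \<Rightarrow> 'm) \<Rightarrow> ('m \<times> 'y \<Rightarrow>\<^sub>0 int) set \<Rightarrow> ('m \<times> 'y \<Rightarrow>\<^sub>0 int) set" where
  "twist Y h = tensor_lift R V Y (F Y) (\<lambda>u y. pure_tensor R V Y (h u) y)"

lemma twist:
  assumes Y: "left_module R Y" and h: "h \<in> mod_hom (op_ring R) V V"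
  shows "twist Y h \<in> additive_maps (F Y) (F Y)"
    and "u \<in> carrier U \<Longrightarrow> y \<in> carrier Y \<Longrightarrow> twist Y h (pure_tensor R V Y u y) = pure_tensor R V Y (h u) y"
proof -
  interpret Y: left_module R Y by fact
  note hD = mod_homD[OF h, simplified V op_ring_simps]
  note l = lift[OF Y abelian_group_F[OF Y], of "\<lambda>u y. pure_tensor R V Y (h u) y"]
  show "twist Y h \<in> additive_maps (F Y) (F Y)"
    unfolding twist_def by (rule l(1)) (use hD in \<open>simp_all add: pure[OF Y]\<close>)
  show "u \<in> carrier U \<Longrightarrow> y \<in> carrier Y \<Longrightarrow> twist Y h (pure_tensor R V Y u y) = pure_tensor R V Y (h u) y"
    unfolding twist_def by (rule l(2)) (use hD in \<open>simp_all add: pure[OF Y]\<close>)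
qed

text \<open>The map \<open>u \<otimes> y \<mapsto> \<phi>(u) y\<close> from \<open>U \<otimes> Y\<close> to \<open>Y\<close>, a coordinate function if \<open>\<phi>\<close> belongs to a dual basis.\<close>

definition contract :: "('r, 'y, 'w) module_scheme \<Rightarrow> ('m \<Rightarrow> 'r) \<Rightarrow> ('m \<times> 'y \<Rightarrow>\<^sub>0 int) set \<Rightarrow> 'y" where
  "contract Y \<phi> = tensor_lift R V Y Y (\<lambda>u y. \<phi> u \<odot>\<^bsub>Y\<^esub> y)"

lemma contract:
  assumes Y: "left_module R Y" and \<phi>: "\<phi> \<in> mod_hom (op_ring R) V (regular_module (op_ring R))"
  shows "contract Y \<phi> \<in> additive_maps (F Y) Y"
    and "u \<in> carrier U \<Longrightarrow> y \<in> carrier Y \<Longrightarrow> contract Y \<phi> (pure_tensor R V Y u y) = \<phi> u \<odot>\<^bsub>Y\<^esub> y"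
proof -
  interpret Y: left_module R Y by fact
  note \<phi>D = mod_homD[OF \<phi>, simplified V op_ring_simps regular_module_simps]
  note l = lift[OF Y Y.M.abelian_group_axioms, of "\<lambda>u y. \<phi> u \<odot>\<^bsub>Y\<^esub> y"]
  show "contract Y \<phi> \<in> additive_maps (F Y) Y"
    unfolding contract_def
    by (rule l(1)) (simp_all add: \<phi>D Y.smult_l_distr Y.smult_r_distr Y.smult_assoc1)
  show "u \<in> carrier U \<Longrightarrow> y \<in> carrier Y \<Longrightarrow> contract Y \<phi> (pure_tensor R V Y u y) = \<phi> u \<odot>\<^bsub>Y\<^esub> y"
    unfolding contract_def
    by (rule l(2)) (simp_all add: \<phi>D Y.smult_l_distr Y.smult_r_distr Y.smult_assoc1)
qed

lemma twist_add:
  assumes Y: "left_module R Y" and g: "g \<in> mod_hom (op_ring R) V V"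
    and \<phi>: "\<phi> \<in> mod_hom (op_ring R) V (regular_module (op_ring R))" and v: "v \<in> carrier V"
    and h: "\<And>u. u \<in> carrier V \<Longrightarrow> h u = g u \<oplus>\<^bsub>V\<^esub> \<phi> u \<odot>\<^bsub>V\<^esub> v" and t: "t \<in> carrier (F Y)"
  shows "twist Y h t = twist Y g t \<oplus>\<^bsub>F Y\<^esub> pure_tensor R V Y v (contract Y \<phi> t)"
proof -
  interpret FY: left_module S "F Y" by (rule left_module_F[OF Y])
  have hh: "h \<in> mod_hom (op_ring R) V V"
    by (rule mod_hom_cong[OF V.left_module_axioms V.mod_hom_add[OF g V.mod_hom_functional[OF \<phi> v]] h])
  have pv: "(\<lambda>y. pure_tensor R V Y v y) \<in> additive_maps Y (F Y)"
    using v pure(1,3)[OF Y] by (auto simp: additive_maps_def V)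
  show ?thesis
    by (rule hom_eqI[OF Y abelian_group_F[OF Y] twist(1)[OF Y hh]
          additive_maps_add[OF abelian_group_F[OF Y] twist(1)[OF Y g] additive_maps_comp[OF contract(1)[OF Y \<phi>] pv]] _ t])
      (use h v mod_homD(1)[OF g] mod_homD(1)[OF \<phi>] in
        \<open>simp add: twist(2)[OF Y hh] twist(2)[OF Y g] contract(2)[OF Y \<phi>] V pure[OF Y] V_smult_closed\<close>)
qed

lemma twist_zero:
  assumes Y: "left_module R Y" and h: "\<And>u. u \<in> carrier V \<Longrightarrow> h u = \<zero>\<^bsub>V\<^esub>" and t: "t \<in> carrier (F Y)"
  shows "twist Y h t = \<zero>\<^bsub>F Y\<^esub>"
proof -
  interpret FY: left_module S "F Y" by (rule left_module_F[OF Y])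
  have hh: "h \<in> mod_hom (op_ring R) V V" by (rule mod_hom_cong[OF V.left_module_axioms V.mod_hom_zero_map h])
  have z: "\<zero>\<^bsub>V\<^esub> \<in> carrier U" "\<zero>\<^bsub>V\<^esub> \<oplus>\<^bsub>U\<^esub> \<zero>\<^bsub>V\<^esub> = \<zero>\<^bsub>V\<^esub>" using V.M.zero_closed V.M.l_zero[of "\<zero>\<^bsub>V\<^esub>"] by (simp_all add: V)
  have p0: "pure_tensor R V Y \<zero>\<^bsub>V\<^esub> y = \<zero>\<^bsub>F Y\<^esub>" if "y \<in> carrier Y" for y
    using pure(2)[OF Y z(1,1) that] z(2) FY.M.add.l_cancel_one'[OF pure(1)[OF Y z(1) that] pure(1)[OF Y z(1) that]] by auto
  show ?thesis
    by (rule hom_eqI[OF Y abelian_group_F[OF Y] twist(1)[OF Y hh] hom_additive[OF FY.mod_hom_zero_map] _ t])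
      (simp add: twist(2)[OF Y hh] h V p0)
qed

text \<open>Let \<open>h = \<Sum>\<^sub>i \<phi>\<^sub>i(-) v\<^sub>i\<close> be the identity of the right module \<open>U\<close>. An element \<open>t\<close> of \<open>U \<otimes> Y\<close> is then
  \<open>\<Sum>\<^sub>i v\<^sub>i \<otimes> (\<phi>\<^sub>i \<otimes> 1)(t)\<close> with coordinates in \<open>Y\<close> that are natural in \<open>Y\<close>. If \<open>t\<close> becomes zero in
  \<open>U \<otimes> P\<close> or in \<open>U \<otimes> X\<close>, then so do its coordinates in \<open>P\<close> or in \<open>X\<close>, and exactness of the given
  sequence applies to them.\<close>

theorem F_short_exact:
  assumes Vp: "fg_projective (op_ring R) V" and ex: "short_exact R K P X i p"
  shows "short_exact S (F K) (F P) (F X) (F_map K P i) (F_map P X p)"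
proof -
  interpret E: short_exact R K P X i p by fact
  note KM = E.K.left_module_axioms and PM = E.P.left_module_axioms and XM = E.X.left_module_axioms
  note VM = V.left_module_axioms
  interpret FK: left_module S "F K" by (rule left_module_F[OF KM])
  interpret FP: left_module S "F P" by (rule left_module_F[OF PM])
  interpret FX: left_module S "F X" by (rule left_module_F[OF XM])
  note FKM = FK.left_module_axioms and FPM = FP.left_module_axioms and FXM = FX.left_module_axioms
  note Fi = F_map[OF KM PM E.i(1)] and Fp = F_map[OF PM XM E.p(1)]
  have fr: "finite_rank (op_ring R) V V (\<lambda>u. u)" using Vp by (simp add: fg_projective_def)
  have twist_id: "twist Y (\<lambda>u. u) t = t" if Y: "left_module R Y" and t: "t \<in> carrier (F Y)"
    for t and Y :: "('r, 'yy, 'ww) module_scheme"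
    by (rule hom_eqI[OF Y abelian_group_F[OF Y] twist(1)[OF Y mod_hom_ident] hom_additive[OF mod_hom_ident] _ t])
      (simp add: twist(2)[OF Y mod_hom_ident])
  have contract_map: "contract Z \<phi> (F_map Y Z f t) = f (contract Y \<phi> t)"
    if Y: "left_module R Y" and Z: "left_module R Z" and f: "f \<in> mod_hom R Y Z" and t: "t \<in> carrier (F Y)"
      and \<phi>: "\<phi> \<in> mod_hom (op_ring R) V (regular_module (op_ring R))"
    for t \<phi> f and Y :: "('r, 'yy, 'ww) module_scheme" and Z :: "('r, 'zz, 'ww1) module_scheme"
  proof -
    interpret Z: left_module R Z by fact
    have fa: "f \<in> additive_maps Y Z" using f by (simp add: mod_hom_def)
    show ?thesis
      by (rule hom_eqI[OF Y Z.M.abelian_group_axioms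
            additive_maps_comp[OF hom_additive[OF F_map(1)[OF Y Z f]] contract(1)[OF Z \<phi>]]
            additive_maps_comp[OF contract(1)[OF Y \<phi>] fa] _ t])
        (use mod_homD[OF f] mod_homD(1)[OF \<phi>] in
          \<open>simp add: F_map(2)[OF Y Z f] contract(2)[OF Z \<phi>] contract(2)[OF Y \<phi>] V\<close>)
  qed
  have FpFi: "F_map P X p (F_map K P i t) = \<zero>\<^bsub>F X\<^esub>" if t: "t \<in> carrier (F K)" for t
    by (rule hom_eqI[OF KM abelian_group_F[OF XM] hom_additive[OF mod_hom_comp[OF Fi(1) Fp(1)]] hom_additive[OF FX.mod_hom_zero_map] _ t])
      (use mod_homD(1)[OF E.i(1)] pure_zero[OF XM] in \<open>simp add: Fi Fp V\<close>)
  have inj0: "twist K h t = \<zero>\<^bsub>F K\<^esub>"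
    if h: "finite_rank (op_ring R) V V h" and t: "t \<in> carrier (F K)" "F_map K P i t = \<zero>\<^bsub>F P\<^esub>" for h t
    using h
  proof induction
    case (zero h) then show ?case by (intro twist_zero[OF KM _ t(1)])
  next
    case (add g \<phi> v h)
    note gh = finite_rank_hom[OF VM VM add.hyps(1)]
    have c: "contract K \<phi> t \<in> carrier K"
      using additive_maps_props(4)[OF abelian_group_F[OF KM] E.K.M.abelian_group_axioms contract(1)[OF KM add.hyps(2)] t(1)] .
    have "i (contract K \<phi> t) = contract P \<phi> \<zero>\<^bsub>F P\<^esub>"
      using contract_map[OF KM PM E.i(1) t(1) add.hyps(2)] t(2) by simp
    also have "\<dots> = i \<zero>\<^bsub>K\<^esub>"
      using additive_maps_props(1)[OF abelian_group_F[OF PM] E.P.M.abelian_group_axioms contract(1)[OF PM add.hyps(2)]]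
        mod_hom_zero[OF KM PM E.i(1)] by simp
    finally have "contract K \<phi> t = \<zero>\<^bsub>K\<^esub>" using E.i(2) c by (simp add: inj_on_eq_iff)
    then show ?case
      using twist_add[OF KM gh add.hyps(2,3,4) t(1)] add.IH pure_zero[OF KM, of v] add.hyps(3) by (simp add: V)
  qed
  have mid: "twist P h t \<in> F_map K P i ` carrier (F K)"
    if h: "finite_rank (op_ring R) V V h" and t: "t \<in> carrier (F P)" "F_map P X p t = \<zero>\<^bsub>F X\<^esub>" for h t
    using h
  proof induction
    case (zero h)
    have "twist P h t = F_map K P i \<zero>\<^bsub>F K\<^esub>"
      using twist_zero[OF PM zero t(1)] mod_hom_zero[OF FKM FPM Fi(1)] by simp
    then show ?case using FK.M.zero_closed by blast
  next
    case (add g \<phi> v h)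
    note gh = finite_rank_hom[OF VM VM add.hyps(1)]
    have c: "contract P \<phi> t \<in> carrier P"
      using additive_maps_props(4)[OF abelian_group_F[OF PM] E.P.M.abelian_group_axioms contract(1)[OF PM add.hyps(2)] t(1)] .
    have "p (contract P \<phi> t) = contract X \<phi> \<zero>\<^bsub>F X\<^esub>"
      using contract_map[OF PM XM E.p(1) t(1) add.hyps(2)] t(2) by simp
    also have "\<dots> = \<zero>\<^bsub>X\<^esub>"
      by (rule additive_maps_props(1)[OF abelian_group_F[OF XM] E.X.M.abelian_group_axioms contract(1)[OF XM add.hyps(2)]])
    finally obtain k where k: "k \<in> carrier K" "contract P \<phi> t = i k" using E.exact c by blast
    obtain s where s: "s \<in> carrier (F K)" "twist P g t = F_map K P i s" using add.IH by blast
    have v: "v \<in> carrier U" using add.hyps(3) by (simp add: V)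
    have "twist P h t = F_map K P i (s \<oplus>\<^bsub>F K\<^esub> pure_tensor R V K v k)"
      using twist_add[OF PM gh add.hyps(2,3,4) t(1)] s k v mod_homD(2)[OF Fi(1)] pure(1)[OF KM] by (simp add: Fi(2))
    then show ?case using s(1) pure(1)[OF KM v k(1)] by blast
  qed
  have surj: "F_map P X p ` carrier (F P) = carrier (F X)"
  proof
    show "F_map P X p ` carrier (F P) \<subseteq> carrier (F X)" using mod_homD(1)[OF Fp(1)] by blast
    interpret Q: tensor_pair R V X by (rule tensor_pair_V[OF XM])
    have im: "submodule (F_map P X p ` carrier (F P)) S (F X)"
      by (rule submodule_image[OF FPM FXM Fp(1) FP.submodule_carrier])
    have "t \<in> F_map P X p ` carrier (F P)" if "t \<in> carrier Q.T" for t
      using that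
    proof (induction t rule: Q.tensor_induct)
      case zero then show ?case using submoduleD(2)[OF im] by (simp add: F_simps)
    next
      case (pure u x)
      then obtain y where "y \<in> carrier P" "x = p y" using E.p(2) by (metis imageE)
      moreover have "u \<in> carrier U" using pure(1) by (simp add: V)
      ultimately show ?case using Fp(2)[of u y] tensor_functor.pure(1)[OF tensor_functor_axioms PM, of u y] by (metis imageI)
    next
      case (diff s t)
      have "\<ominus>\<^bsub>Q.T\<^esub> t = \<ominus>\<^bsub>F X\<^esub> t"
        by (rule FX.M.minus_equality[symmetric]) (use diff.hyps Q.T.l_neg in \<open>auto simp: F_simps\<close>)
      then have "\<ominus>\<^bsub>Q.T\<^esub> t \<in> F_map P X p ` carrier (F P)" using submoduleD(5)[OF im diff.IH(2)] by simp
      then show ?case using submoduleD(3)[OF im diff.IH(1)] by (simp add: F_simps Q.T.minus_eq)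
    qed
    then show "carrier (F X) \<subseteq> F_map P X p ` carrier (F P)" by (auto simp: F_simps)
  qed
  show ?thesis
  proof (intro short_exact.intro short_exact_axioms.intro FKM FPM FXM Fi(1) Fp(1) surj)
    show "inj_on (F_map K P i) (carrier (F K))"
      by (rule mod_hom_injI[OF FKM FPM Fi(1)]) (use inj0[OF fr] twist_id[OF KM] in metis)
    show "F_map K P i ` carrier (F K) = {t \<in> carrier (F P). F_map P X p t = \<zero>\<^bsub>F X\<^esub>}"
    proof
      show "F_map K P i ` carrier (F K) \<subseteq> {t \<in> carrier (F P). F_map P X p t = \<zero>\<^bsub>F X\<^esub>}"
        using mod_homD(1)[OF Fi(1)] FpFi by blast
      show "{t \<in> carrier (F P). F_map P X p t = \<zero>\<^bsub>F X\<^esub>} \<subseteq> F_map K P i ` carrier (F K)"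
      proof
        fix t assume "t \<in> {t \<in> carrier (F P). F_map P X p t = \<zero>\<^bsub>F X\<^esub>}"
        then show "t \<in> F_map K P i ` carrier (F K)" using mid[OF fr, of t] twist_id[OF PM, of t] by simp
      qed
    qed
  qed
qed

end

section \<open>The tensor functor of a pair of bimodules\<close>

text \<open>The opposite of an enveloping algebra and the tensor algebra \<open>A\<^sup>o\<^sup>p \<otimes> A\<close> have multiplications that
  agree on the carrier only, so module structures are transported between them.\<close>

lemma left_module_ring_cong:
  assumes "left_module R M" "ring R'" "carrier R' = carrier R" "add R' = add R" "\<one>\<^bsub>R'\<^esub> = \<one>\<^bsub>R\<^esub>"
    "\<And>a b. a \<in> carrier R \<Longrightarrow> b \<in> carrier R \<Longrightarrow> a \<otimes>\<^bsub>R'\<^esub> b = a \<otimes>\<^bsub>R\<^esub> b"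
  shows "left_module R' M"
proof -
  interpret M: left_module R M by fact
  show ?thesis
    unfolding left_module_def left_module_axioms_def using assms(2-) M.M.abelian_group_axioms
    by (auto simp: M.smult_l_distr M.smult_r_distr M.smult_assoc1)
qed

lemma fg_projective_ring_cong:
  assumes "fg_projective R M" "ring R'" "carrier R' = carrier R" "add R' = add R" "\<one>\<^bsub>R'\<^esub> = \<one>\<^bsub>R\<^esub>"
    "\<And>a b. a \<in> carrier R \<Longrightarrow> b \<in> carrier R \<Longrightarrow> a \<otimes>\<^bsub>R'\<^esub> b = a \<otimes>\<^bsub>R\<^esub> b"
  shows "fg_projective R' M"
proof -
  have M: "left_module R M" "finite_rank R M M (\<lambda>x. x)" using assms(1) by (auto simp: fg_projective_def)
  have "finite_rank R' M M h" if "finite_rank R M M h" for h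
    using that
  proof induction
    case (zero h) then show ?case by (rule finite_rank.zero)
  next
    case (add g \<phi> y h)
    note \<phi>D = mod_homD[OF add.hyps(2), simplified]
    have "\<phi> \<in> mod_hom R' M (regular_module R')"
      by (rule mod_homI) (use \<phi>D assms(3,4,6) in auto)
    then show ?case by (rule finite_rank.add[OF add.IH _ add.hyps(3,4)])
  qed
  then show ?thesis
    using M left_module_ring_cong[OF M(1) assms(2-)] by (simp add: fg_projective_def)
qed

definition restrict_scalars :: "('k, 'a, 'v) module_scheme \<Rightarrow> ('a, 'p, 'w) module_scheme \<Rightarrow> ('k, 'p) module" where
  "restrict_scalars A P = \<lparr>carrier = carrier P, monoid.mult = undefined, one = undefined, ring.zero = \<zero>\<^bsub>P\<^esub>,
     add = add P, smult = (\<lambda>c p. (c \<odot>\<^bsub>A\<^esub> \<one>\<^bsub>A\<^esub>) \<odot>\<^bsub>P\<^esub> p)\<rparr>"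

lemma restrict_scalars_simps:
  "carrier (restrict_scalars A P) = carrier P" "\<zero>\<^bsub>restrict_scalars A P\<^esub> = \<zero>\<^bsub>P\<^esub>"
  "add (restrict_scalars A P) = add P" "c \<odot>\<^bsub>restrict_scalars A P\<^esub> p = (c \<odot>\<^bsub>A\<^esub> \<one>\<^bsub>A\<^esub>) \<odot>\<^bsub>P\<^esub> p"
  by (simp_all add: restrict_scalars_def)

lemma (in fd_algebra) left_module_restrict_scalars:
  assumes "left_module A P"
  shows "left_module k (restrict_scalars A P)" "left_module (op_ring k) (restrict_scalars A P)"
proof -
  interpret P: left_module A P by fact
  have ab: "abelian_group (restrict_scalars A P)"
    by (rule abelian_groupI) (use P.M.l_neg P.M.a_inv_closed in \<open>fastforce simp: restrict_scalars_simps P.M.a_ac\<close>)+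
  have mul: "(c \<otimes>\<^bsub>k\<^esub> d) \<odot>\<^bsub>A\<^esub> \<one>\<^bsub>A\<^esub> = (c \<odot>\<^bsub>A\<^esub> \<one>\<^bsub>A\<^esub>) \<otimes>\<^bsub>A\<^esub> (d \<odot>\<^bsub>A\<^esub> \<one>\<^bsub>A\<^esub>)" if "c \<in> carrier k" "d \<in> carrier k" for c d
    using that by (simp add: smult_mult_l smult_assoc1)
  show k: "left_module k (restrict_scalars A P)"
    unfolding left_module_def left_module_axioms_def
    by (simp add: ab k.ring_axioms restrict_scalars_simps mul smult_l_distr P.smult_l_distr P.smult_r_distr P.smult_assoc1)
  show "left_module (op_ring k) (restrict_scalars A P)"
    by (rule left_module_ring_cong[OF k ring_op_ring[OF k.ring_axioms]]) (auto simp: k.m_comm op_ring_def)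
qed

lemma tensor_op_swap:
  "tensor k (op_ring A) A = tensor k A (op_ring A)" "pure_tensor k (op_ring A) A = pure_tensor k A (op_ring A)"
  for A :: "('k, 'a, 'v) module_scheme"
  by (simp_all add: tensor_def tensor_quotient_def tensor_kernel_def tensor_relations_def pure_tensor_def fun_eq_iff)

text \<open>The opposite of \<open>A \<otimes> A\<^sup>o\<^sup>p\<close> is \<open>A\<^sup>o\<^sup>p \<otimes> A\<close>. External tensor
  products of a right and a left \<open>A\<close>-module are therefore right modules over the enveloping algebra.\<close>

lemma (in fd_algebra) op_enveloping_algebra:
  assumes s: "s \<in> carrier (enveloping_algebra k A)" and t: "t \<in> carrier (enveloping_algebra k A)"
  shows "s \<otimes>\<^bsub>op_ring (enveloping_algebra k A)\<^esub> t = s \<otimes>\<^bsub>tensor_algebra k (op_ring A) A\<^esub> t"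
proof -
  interpret E1: two_algebras k A "op_ring A"
    using fd_algebra_op_ring fd_algebra_axioms by (simp add: two_algebras_def)
  interpret E2: two_algebras k "op_ring A" A
    using fd_algebra_op_ring fd_algebra_axioms by (simp add: two_algebras_def)
  note TT = E1.T.abelian_group_axioms
  have st: "s \<in> carrier E1.T" "t \<in> carrier E1.T"
    using s t by (simp_all add: enveloping_algebra_def E1.tensor_algebra_simps)
  have T2: "x \<in> carrier E2.T \<longleftrightarrow> x \<in> carrier E1.T" for x by (simp add: tensor_op_swap)
  have m2: "(\<lambda>s. E2.mul s u) \<in> additive_maps E1.T E1.T" "E2.mul u \<in> additive_maps E1.T E1.T" if "u \<in> carrier E1.T" for u
    using E2.mul(1)[of u] E2.mul_r[of u] that by (simp_all add: tensor_op_swap)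
  have "E1.mul t s = E2.mul s t"
  proof (rule E1.tensor_hom_eqI[OF TT E1.mul_r[OF st(2)] m2(1)[OF st(2)] _ st(1)])
    fix a b assume ab: "a \<in> carrier A" "b \<in> carrier (op_ring A)"
    have p: "E1.pure a b \<in> carrier E1.T" using ab by simp
    show "E1.mul t (E1.pure a b) = E2.mul (E1.pure a b) t"
    proof (rule E1.tensor_hom_eqI[OF TT E1.mul(1)[OF p] m2(2)[OF p] _ st(2)])
      fix c d assume cd: "c \<in> carrier A" "d \<in> carrier (op_ring A)"
      have "E2.mul (E2.pure a b) (E2.pure c d) = E2.pure (c \<otimes>\<^bsub>A\<^esub> a) (b \<otimes>\<^bsub>A\<^esub> d)"
        using ab cd by (simp add: E2.mul_pure)
      then show "E1.mul (E1.pure c d) (E1.pure a b) = E2.mul (E1.pure a b) (E1.pure c d)"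
        using ab cd by (simp add: E1.mul_pure tensor_op_swap)
    qed
  qed
  then show ?thesis
    by (simp add: enveloping_algebra_def E1.tensor_algebra_simps E2.tensor_algebra_simps)
qed

lemma (in fd_algebra) op_enveloping_algebra_simps:
  "carrier (op_ring (enveloping_algebra k A)) = carrier (tensor_algebra k (op_ring A) A)"
  "add (op_ring (enveloping_algebra k A)) = add (tensor_algebra k (op_ring A) A)"
  "\<one>\<^bsub>op_ring (enveloping_algebra k A)\<^esub> = \<one>\<^bsub>tensor_algebra k (op_ring A) A\<^esub>"
proof -
  interpret E1: two_algebras k A "op_ring A"
    using fd_algebra_op_ring fd_algebra_axioms by (simp add: two_algebras_def)
  interpret E2: two_algebras k "op_ring A" A
    using fd_algebra_op_ring fd_algebra_axioms by (simp add: two_algebras_def)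
  show "carrier (op_ring (enveloping_algebra k A)) = carrier (tensor_algebra k (op_ring A) A)"
    "add (op_ring (enveloping_algebra k A)) = add (tensor_algebra k (op_ring A) A)"
    "\<one>\<^bsub>op_ring (enveloping_algebra k A)\<^esub> = \<one>\<^bsub>tensor_algebra k (op_ring A) A\<^esub>"
    using E1.tensor_algebra_simps E2.tensor_algebra_simps
    by (simp_all add: enveloping_algebra_def tensor_op_swap) (simp add: op_ring_def)
qed

text \<open>The group \<open>N \<otimes>\<^sub>k M\<close> is a left module over \<open>B\<^sup>e = B \<otimes> B\<^sup>o\<^sup>p\<close> through the outer actions (\<open>SU\<close>) and a right
  module over \<open>A\<^sup>e\<close>, that is, a left module over \<open>A\<^sup>o\<^sup>p \<otimes> A\<close>, through the inner actions (\<open>RV\<close>).\<close>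

locale bimodule_pair = A: fd_algebra k A + B: fd_algebra k B + M: bimodule_over k A B M + N: bimodule_over k B A N
  for k :: "('k, 'u) ring_scheme" and A :: "('k, 'a, 'v) module_scheme" and B :: "('k, 'b, 'w) module_scheme"
    and M :: "('a, 'b, 'm, 'x) bimodule_scheme" and N :: "('b, 'a, 'n, 'y) bimodule_scheme"
begin

abbreviation "Nk \<equiv> restrict_scalars B N"
abbreviation "Mk \<equiv> restrict_scalars A M"

lemma SU: "external_tensor k B (op_ring B) N (right_mod M) Nk Mk"
proof -
  have "two_algebras k B (op_ring B)"
    using B.fd_algebra_op_ring B.fd_algebra_axioms by (simp add: two_algebras_def)
  moreover have "tensor_pair k Nk Mk"
    by (intro tensor_pair.intro B.left_module_restrict_scalars(2)[OF N.left_module_axioms]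
        A.left_module_restrict_scalars(1)[OF M.left_module_axioms])
  moreover have "add (right_mod M) = add M" by (simp add: right_mod_def)
  ultimately show ?thesis
    by (intro external_tensor.intro external_tensor_axioms.intro N.left_module_axioms M.right.left_module_axioms)
      (simp_all add: restrict_scalars_simps M.central)
qed

lemma RV: "external_tensor k (op_ring A) A (right_mod N) M Nk Mk"
proof -
  have "two_algebras k (op_ring A) A"
    using A.fd_algebra_op_ring A.fd_algebra_axioms by (simp add: two_algebras_def)
  moreover have "tensor_pair k Nk Mk"
    by (intro tensor_pair.intro B.left_module_restrict_scalars(2)[OF N.left_module_axioms]
        A.left_module_restrict_scalars(1)[OF M.left_module_axioms])
  moreover have "add (right_mod N) = add N" by (simp add: right_mod_def)
  ultimately show ?thesis
    by (intro external_tensor.intro external_tensor_axioms.intro M.left_module_axioms N.right.left_module_axioms)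
      (simp_all add: restrict_scalars_simps N.central)
qed

sublocale SU: external_tensor k B "op_ring B" N "right_mod M" Nk Mk by (rule SU)
sublocale RV: external_tensor k "op_ring A" A "right_mod N" M Nk Mk by (rule RV)

abbreviation "Ae \<equiv> enveloping_algebra k A"
abbreviation "Be \<equiv> enveloping_algebra k B"

lemma ring_Ae: "ring Ae"
  by (rule A.ring_enveloping_algebra)

lemma carrier_Ae: "carrier Ae = carrier RV.T"
  using A.op_enveloping_algebra_simps(1) by (simp add: RV.tensor_algebra_simps)

lemma carrier_Be: "carrier Be = carrier SU.T"
  by (simp add: enveloping_algebra_def SU.tensor_algebra_simps)

lemma actions_commute:
  assumes s: "s \<in> carrier SU.T" and r: "r \<in> carrier RV.T" and u: "u \<in> carrier SU.U.T"
  shows "SU.act s (RV.act r u) = RV.act r (SU.act s u)"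
proof -
  note UT = SU.UT
  show ?thesis
  proof (rule SU.tensor_hom_eqI[OF UT SU.act(1)[OF RV.act_closed[OF r u]] additive_maps_comp[OF SU.act(1)[OF u] RV.act_r[OF r]] _ s])
    fix a b assume ab: "a \<in> carrier B" "b \<in> carrier (op_ring B)"
    show "SU.act (SU.pure a b) (RV.act r u) = RV.act r (SU.act (SU.pure a b) u)"
      unfolding SU.act(2)[OF RV.act_closed[OF r u] ab] SU.act(2)[OF u ab]
    proof (rule RV.tensor_hom_eqI[OF UT additive_maps_comp[OF RV.act(1)[OF u] SU.act1(1)[OF ab]] RV.act(1) _ r])
      show au: "SU.act1 a b u \<in> carrier SU.U.T"
        using additive_maps_props(4)[OF UT UT SU.act1(1)[OF ab] u] .
      fix c d assume cd: "c \<in> carrier (op_ring A)" "d \<in> carrier A"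
      show "SU.act1 a b (RV.act (RV.pure c d) u) = RV.act (RV.pure c d) (SU.act1 a b u)"
        unfolding RV.act(2)[OF u cd] RV.act(2)[OF au cd]
        by (rule SU.U_hom_eqI[OF UT additive_maps_comp[OF RV.act1(1)[OF cd] SU.act1(1)[OF ab]]
              additive_maps_comp[OF SU.act1(1)[OF ab] RV.act1(1)[OF cd]] _ u])
          (use ab cd in \<open>simp add: SU.act1 RV.act1 N.rs M.rs N.smult_rsmult M.smult_rsmult\<close>)
    qed
  qed
qed

lemma TF: "tensor_functor Be Ae SU.E RV.E"
proof -
  have 1: "left_module Be SU.E" unfolding enveloping_algebra_def by (rule SU.left_module_E)
  have 2: "left_module (op_ring Ae) RV.E"
    by (rule left_module_ring_cong[OF RV.left_module_E ring_op_ring[OF ring_Ae]])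
      (use A.op_enveloping_algebra_simps A.op_enveloping_algebra in auto)
  show ?thesis
    by (intro tensor_functor.intro tensor_functor_axioms.intro 1 2)
      (simp_all add: SU.E_simps RV.E_simps carrier_Ae carrier_Be actions_commute)
qed

sublocale TF: tensor_functor Be Ae SU.E RV.E by (rule TF)

text \<open>The isomorphism is \<open>(n \<otimes> m) \<otimes> a \<mapsto> n a \<otimes> m\<close> with inverse \<open>n \<otimes> m \<mapsto> (n \<otimes> m) \<otimes> 1\<close>; both are
  balanced because \<open>(n a \<otimes> m) \<otimes> 1 = (n \<otimes> m) \<otimes> a = (n \<otimes> a m) \<otimes> 1\<close>.\<close>

theorem F_algebra_module:
  "mod_iso Be (TF.F (algebra_module k A)) (enveloping_module k B (tensor_bimodule A N M))"
proof -
  let ?AM = "algebra_module k A"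
  let ?TB = "tensor_bimodule A N M"
  let ?TM = "enveloping_module k B ?TB"
  note TB = bimodule_over_tensor_bimodule[OF B.fd_algebra_axioms A.fd_algebra_axioms B.fd_algebra_axioms
      N.bimodule_over_axioms M.bimodule_over_axioms]
  note AM = A.left_module_enveloping_module[OF A.bimodule_over_regular, folded algebra_module_def]
  note TM = B.left_module_enveloping_module[OF TB(1)]
  interpret AM: left_module Ae ?AM by (rule AM(1))
  interpret TM: left_module Be ?TM by (rule TM(1))
  interpret Q: tensor_pair A "right_mod N" M
    by (intro tensor_pair.intro N.right.left_module_axioms M.left_module_axioms)
  have AM_simps: "carrier ?AM = carrier A" "add ?AM = add A"
    by (simp_all add: algebra_module_def enveloping_module_def regular_bimodule_def)
  have AM_act: "RV.pure c d \<odot>\<^bsub>?AM\<^esub> x = c \<otimes>\<^bsub>A\<^esub> (x \<otimes>\<^bsub>A\<^esub> d)" if "c \<in> carrier A" "d \<in> carrier A" "x \<in> carrier A" for c d x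
    using AM(2)[OF that(1,2), of x] that by (simp add: tensor_op_swap regular_bimodule_def)
  have TM_simps: "carrier ?TM = carrier Q.T" "add ?TM = add Q.T" "\<zero>\<^bsub>?TM\<^esub> = \<zero>\<^bsub>Q.T\<^esub>"
    by (simp_all add: enveloping_module_def tensor_bimodule_def Let_def)
  have TB_carrier: "carrier ?TB = carrier Q.T" by (simp add: tensor_bimodule_def Let_def)
  have TM_act: "SU.pure a b \<odot>\<^bsub>?TM\<^esub> Q.pure n m = Q.pure (a \<odot>\<^bsub>N\<^esub> n) (rsmult M m b)"
    if "a \<in> carrier B" "b \<in> carrier B" "n \<in> carrier N" "m \<in> carrier M" for a b n m
    using that TM(2)[OF that(1,2), of "Q.pure n m"] Q.pure_closed[of n m] by (simp add: TB TB_carrier M.rs)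
  have Qpure: "Q.pure n m \<in> carrier ?TM" if "n \<in> carrier N" "m \<in> carrier M" for n m
    using that Q.pure_closed[of n m] by (simp add: TM_simps)
  have Qpure_add: "\<And>n n' m. n \<in> carrier N \<Longrightarrow> n' \<in> carrier N \<Longrightarrow> m \<in> carrier M \<Longrightarrow> Q.pure (n \<oplus>\<^bsub>N\<^esub> n') m = Q.pure n m \<oplus>\<^bsub>?TM\<^esub> Q.pure n' m"
    "\<And>n m m'. n \<in> carrier N \<Longrightarrow> m \<in> carrier M \<Longrightarrow> m' \<in> carrier M \<Longrightarrow> Q.pure n (m \<oplus>\<^bsub>M\<^esub> m') = Q.pure n m \<oplus>\<^bsub>?TM\<^esub> Q.pure n m'"
    "\<And>n m a. n \<in> carrier N \<Longrightarrow> m \<in> carrier M \<Longrightarrow> a \<in> carrier A \<Longrightarrow> Q.pure (rsmult N n a) m = Q.pure n (a \<odot>\<^bsub>M\<^esub> m)"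
    using Q.pure_add_l Q.pure_add_r Q.pure_balanced by (simp_all add: TM_simps)
  note ATM = TM.M.abelian_group_axioms and UT = SU.UT
  define \<kappa> where "\<kappa> a = tensor_lift k Nk Mk ?TM (\<lambda>n m. Q.pure (rsmult N n a) m)" for a
  have bal: "SU.U.balanced ?TM (\<lambda>n m. Q.pure (rsmult N n a) m)" if a: "a \<in> carrier A" for a
  proof (rule SU.U_balancedI)
    fix c n m assume *: "c \<in> carrier k" "n \<in> carrier N" "m \<in> carrier (right_mod M)"
    let ?c = "c \<odot>\<^bsub>A\<^esub> \<one>\<^bsub>A\<^esub>"
    have c: "?c \<in> carrier A" using * by simp
    have "rsmult N ((c \<odot>\<^bsub>B\<^esub> \<one>\<^bsub>B\<^esub>) \<odot>\<^bsub>N\<^esub> n) a = rsmult N n (?c \<otimes>\<^bsub>A\<^esub> a)"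
      using * a c by (simp add: N.central N.rs)
    also have "?c \<otimes>\<^bsub>A\<^esub> a = a \<otimes>\<^bsub>A\<^esub> ?c" using * a by (simp add: A.smult_mult_l A.smult_mult_r)
    also have "rsmult N n (a \<otimes>\<^bsub>A\<^esub> ?c) = rsmult N (rsmult N n a) ?c" using * a c by (simp add: N.rs)
    finally show "Q.pure (rsmult N ((c \<odot>\<^bsub>B\<^esub> \<one>\<^bsub>B\<^esub>) \<odot>\<^bsub>N\<^esub> n) a) m
        = Q.pure (rsmult N n a) ((c \<odot>\<^bsub>op_ring B\<^esub> \<one>\<^bsub>op_ring B\<^esub>) \<odot>\<^bsub>right_mod M\<^esub> m)"
      using * a c by (simp add: Qpure_add(3) N.rs M.central)
  qed (use a in \<open>simp_all add: Qpure Qpure_add N.rs\<close>)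
  have \<kappa>a: "\<kappa> a \<in> additive_maps SU.U.T ?TM" if "a \<in> carrier A" for a
    unfolding \<kappa>_def by (rule SU.U.tensor_lift(1)[OF ATM bal[OF that]])
  have \<kappa>p: "\<kappa> a (SU.U.pure n m) = Q.pure (rsmult N n a) m" if "a \<in> carrier A" "n \<in> carrier N" "m \<in> carrier M" for a n m
    unfolding \<kappa>_def using SU.U.tensor_lift(2)[OF ATM bal[OF that(1)]] that by (simp add: restrict_scalars_simps)
  note \<kappa>c = additive_maps_props(4)[OF UT ATM \<kappa>a]
  have \<kappa>add: "\<kappa> (a \<oplus>\<^bsub>A\<^esub> a') u = \<kappa> a u \<oplus>\<^bsub>?TM\<^esub> \<kappa> a' u" if "a \<in> carrier A" "a' \<in> carrier A" "u \<in> carrier SU.U.T" for a a' u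
    by (rule SU.U_hom_eqI[OF ATM \<kappa>a additive_maps_add[OF ATM \<kappa>a \<kappa>a] _ that(3)])
      (use that in \<open>simp_all add: \<kappa>p N.rs Qpure_add\<close>)
  have \<kappa>bal: "\<kappa> a (RV.act r u) = \<kappa> (r \<odot>\<^bsub>?AM\<^esub> a) u"
    if a: "a \<in> carrier A" and r: "r \<in> carrier RV.T" and u: "u \<in> carrier SU.U.T" for a r u
  proof (rule RV.tensor_hom_eqI[OF ATM additive_maps_comp[OF RV.act(1)[OF u] \<kappa>a[OF a]] _ _ r])
    show "(\<lambda>r. \<kappa> (r \<odot>\<^bsub>?AM\<^esub> a) u) \<in> additive_maps RV.T ?TM"
    proof -
      have "r \<odot>\<^bsub>?AM\<^esub> a \<in> carrier A" if "r \<in> carrier RV.T" for r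
        using AM.smult_closed[of r a] that a by (simp add: AM_simps carrier_Ae)
      moreover have "(r \<oplus>\<^bsub>RV.T\<^esub> r') \<odot>\<^bsub>?AM\<^esub> a = r \<odot>\<^bsub>?AM\<^esub> a \<oplus>\<^bsub>A\<^esub> r' \<odot>\<^bsub>?AM\<^esub> a" if "r \<in> carrier RV.T" "r' \<in> carrier RV.T" for r r'
      proof -
        have "add Ae = add (op_ring Ae)" by (simp add: op_ring_def)
        also have "\<dots> = add RV.T" by (simp only: A.op_enveloping_algebra_simps(2) RV.tensor_algebra_simps(3))
        finally have "add Ae = add RV.T" .
        then show ?thesis using AM.smult_l_distr[of r r' a] that a by (simp add: AM_simps carrier_Ae)
      qed
      ultimately show ?thesis using \<kappa>add u \<kappa>c by (simp add: additive_maps_def)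
    qed
    fix c d assume "c \<in> carrier (op_ring A)" "d \<in> carrier A"
    then have cd: "c \<in> carrier A" "d \<in> carrier A" by simp_all
    have cad: "c \<otimes>\<^bsub>A\<^esub> (a \<otimes>\<^bsub>A\<^esub> d) \<in> carrier A" using a cd by simp
    have "\<kappa> a (RV.act1 c d u) = \<kappa> (c \<otimes>\<^bsub>A\<^esub> (a \<otimes>\<^bsub>A\<^esub> d)) u"
    proof (rule SU.U_hom_eqI[OF ATM additive_maps_comp[OF RV.act1(1) \<kappa>a[OF a]] \<kappa>a[OF cad] _ u])
      fix n m assume "n \<in> carrier N" "m \<in> carrier (right_mod M)"
      then show "\<kappa> a (RV.act1 c d (SU.U.pure n m)) = \<kappa> (c \<otimes>\<^bsub>A\<^esub> (a \<otimes>\<^bsub>A\<^esub> d)) (SU.U.pure n m)"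
        using a cd by (simp add: RV.act1(2) \<kappa>p N.rs Qpure_add(3)[symmetric])
    qed (use cd in simp_all)
    then show "\<kappa> a (RV.act (RV.pure c d) u) = \<kappa> (RV.pure c d \<odot>\<^bsub>?AM\<^esub> a) u"
      using cd a u RV.act(2)[OF u, of c d] by (simp add: AM_act)
  qed
  define f where "f = tensor_lift Ae RV.E ?AM ?TM (\<lambda>u a. \<kappa> a u)"
  note fl = TF.lift[OF AM(1) ATM, of "\<lambda>u a. \<kappa> a u"]
  note E = SU.E_simps RV.E_simps AM_simps carrier_Ae
  have f: "f \<in> additive_maps (TF.F ?AM) ?TM"
    unfolding f_def
    by (rule fl(1)) (use additive_maps_props(2)[OF UT ATM \<kappa>a] in \<open>simp_all add: E \<kappa>c \<kappa>add \<kappa>bal\<close>)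
  have fp: "f (pure_tensor Ae RV.E ?AM u a) = \<kappa> a u" if "u \<in> carrier SU.U.T" "a \<in> carrier A" for u a
    unfolding f_def
    by (rule fl(2)) (use that additive_maps_props(2)[OF UT ATM \<kappa>a] in \<open>simp_all add: E \<kappa>c \<kappa>add \<kappa>bal\<close>)
  have \<kappa>S: "\<kappa> a \<in> mod_hom Be SU.E ?TM" if a: "a \<in> carrier A" for a
    unfolding enveloping_algebra_def
  proof (rule SU.E_hom[OF \<kappa>a[OF a] TM(1)[unfolded enveloping_algebra_def]])
    fix b b' n m assume "b \<in> carrier B" "b' \<in> carrier (op_ring B)" "n \<in> carrier N" "m \<in> carrier (right_mod M)"
    then show "\<kappa> a (SU.U.pure (b \<odot>\<^bsub>N\<^esub> n) (b' \<odot>\<^bsub>right_mod M\<^esub> m)) = SU.pure b b' \<odot>\<^bsub>?TM\<^esub> \<kappa> a (SU.U.pure n m)"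
      using a by (simp add: \<kappa>p M.rs N.rs TM_act N.smult_rsmult)
  qed
  have fS: "f \<in> mod_hom Be (TF.F ?AM) ?TM"
    by (rule TF.F_hom[OF AM(1) TM(1) f])
      (use mod_homD(3)[OF \<kappa>S] in \<open>simp add: fp E carrier_Be SU.act_closed\<close>)
  note P = TF.pure[OF AM(1), unfolded E]
  note AF = TF.abelian_group_F[OF AM(1)]
  have smR: "RV.pure c d \<odot>\<^bsub>RV.E\<^esub> SU.U.pure n m = SU.U.pure (rsmult N n c) (d \<odot>\<^bsub>M\<^esub> m)"
    if "c \<in> carrier A" "d \<in> carrier A" "n \<in> carrier N" "m \<in> carrier M" for c d n m
    using RV.act_pure[of c d n m] that by (simp add: RV.E_simps)
  have Up: "SU.U.pure n m \<in> carrier SU.U.T" if "n \<in> carrier N" "m \<in> carrier M" for n m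
    using that SU.U_pure_closed[of n m] by simp
  have move: "pure_tensor Ae RV.E ?AM (SU.U.pure (rsmult N n a) m) \<one>\<^bsub>A\<^esub> = pure_tensor Ae RV.E ?AM (SU.U.pure n m) a"
    "pure_tensor Ae RV.E ?AM (SU.U.pure n (a \<odot>\<^bsub>M\<^esub> m)) \<one>\<^bsub>A\<^esub> = pure_tensor Ae RV.E ?AM (SU.U.pure n m) a"
    if "a \<in> carrier A" "n \<in> carrier N" "m \<in> carrier M" for a n m
  proof -
    have c: "RV.pure a \<one>\<^bsub>A\<^esub> \<in> carrier RV.T" "RV.pure \<one>\<^bsub>A\<^esub> a \<in> carrier RV.T" using that by simp_all
    show "pure_tensor Ae RV.E ?AM (SU.U.pure (rsmult N n a) m) \<one>\<^bsub>A\<^esub> = pure_tensor Ae RV.E ?AM (SU.U.pure n m) a"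
      using P(4)[OF c(1) Up[OF that(2,3)], of "\<one>\<^bsub>A\<^esub>"] that by (simp add: smR[unfolded E] AM_act)
    show "pure_tensor Ae RV.E ?AM (SU.U.pure n (a \<odot>\<^bsub>M\<^esub> m)) \<one>\<^bsub>A\<^esub> = pure_tensor Ae RV.E ?AM (SU.U.pure n m) a"
      using P(4)[OF c(2) Up[OF that(2,3)], of "\<one>\<^bsub>A\<^esub>"] that by (simp add: smR[unfolded E] AM_act N.rs)
  qed
  define g where "g = tensor_lift A (right_mod N) M (TF.F ?AM) (\<lambda>n m. pure_tensor Ae RV.E ?AM (SU.U.pure n m) \<one>\<^bsub>A\<^esub>)"
  have gbal: "Q.balanced (TF.F ?AM) (\<lambda>n m. pure_tensor Ae RV.E ?AM (SU.U.pure n m) \<one>\<^bsub>A\<^esub>)"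
    unfolding Q.balanced_def using SU.U_pure_add by (simp add: P Up move)
  have g: "g \<in> additive_maps ?TM (TF.F ?AM)"
    using Q.tensor_lift(1)[OF AF gbal] by (simp add: g_def additive_maps_def TM_simps)
  have gp: "g (Q.pure n m) = pure_tensor Ae RV.E ?AM (SU.U.pure n m) \<one>\<^bsub>A\<^esub>" if "n \<in> carrier N" "m \<in> carrier M" for n m
    using Q.tensor_lift(2)[OF AF gbal] that by (simp add: g_def)
  have fg: "f (g t) = t" if t: "t \<in> carrier ?TM" for t
  proof (rule Q.tensor_hom_eqI[OF ATM])
    show "(\<lambda>t. f (g t)) \<in> additive_maps Q.T ?TM" "(\<lambda>t. t) \<in> additive_maps Q.T ?TM" "t \<in> carrier Q.T"
      using additive_maps_comp[OF g f] t by (auto simp: additive_maps_def TM_simps)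
    fix n m assume "n \<in> carrier (right_mod N)" "m \<in> carrier M"
    then show "f (g (Q.pure n m)) = Q.pure n m" by (simp add: gp fp Up \<kappa>p N.rs)
  qed
  have gf: "g (f t) = t" if t: "t \<in> carrier (TF.F ?AM)" for t
  proof (rule TF.hom_eqI[OF AM(1) AF additive_maps_comp[OF f g] _ _ t])
    show "(\<lambda>t. t) \<in> additive_maps (TF.F ?AM) (TF.F ?AM)" by (simp add: additive_maps_def)
    fix u a assume "u \<in> carrier SU.E" "a \<in> carrier ?AM"
    then have u: "u \<in> carrier SU.U.T" and a: "a \<in> carrier A" by (simp_all add: E)
    have pa: "(\<lambda>u. pure_tensor Ae RV.E ?AM u a) \<in> additive_maps SU.U.T (TF.F ?AM)"
      using P(1,2) a by (simp add: additive_maps_def)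
    have "g (\<kappa> a u) = pure_tensor Ae RV.E ?AM u a"
      by (rule SU.U_hom_eqI[OF AF additive_maps_comp[OF \<kappa>a[OF a] g] pa _ u])
        (use a in \<open>simp add: \<kappa>p gp N.rs move\<close>)
    then show "g (f (pure_tensor Ae RV.E ?AM u a)) = pure_tensor Ae RV.E ?AM u a" by (simp add: fp u a)
  qed
  have "bij_betw f (carrier (TF.F ?AM)) (carrier ?TM)"
    using fg gf additive_maps_props(4)[OF AF ATM f] additive_maps_props(4)[OF ATM AF g]
    by (intro bij_betw_byWitness[where f' = g]) auto
  then show ?thesis
    unfolding mod_iso_def using TF.left_module_F[OF AM(1)] TM(1) fS by blast
qed

end

section \<open>Transfer of periodicity\<close>

lemma (in fd_algebra) algebra_module_fin_gen: "fin_gen (enveloping_algebra k A) (algebra_module k A)"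
proof -
  note AM = left_module_enveloping_module[OF bimodule_over_regular, folded algebra_module_def]
  interpret E: two_algebras k A "op_ring A"
    using fd_algebra_op_ring fd_algebra_axioms by (simp add: two_algebras_def)
  have c: "carrier (algebra_module k A) = carrier A"
    by (simp add: algebra_module_def enveloping_module_def regular_bimodule_def)
  show ?thesis
  proof (rule fin_genI[OF AM(1), of "{\<one>\<^bsub>A\<^esub>}"])
    fix H assume H: "submodule H (enveloping_algebra k A) (algebra_module k A)" "{\<one>\<^bsub>A\<^esub>} \<subseteq> H"
    have "a \<in> H" if a: "a \<in> carrier A" for a
    proof -
      have "E.pure a \<one>\<^bsub>A\<^esub> \<in> carrier (enveloping_algebra k A)"
        using a by (simp add: enveloping_algebra_def E.tensor_algebra_simps)
      from submoduleD(4)[OF H(1) this, of "\<one>\<^bsub>A\<^esub>"] show "a \<in> H"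
        using AM(2)[OF a A.one_closed, of "\<one>\<^bsub>A\<^esub>"] H(2) a by (simp add: regular_bimodule_def)
    qed
    then show "H = carrier (algebra_module k A)" using submoduleD(1)[OF H(1)] c by auto
  qed (simp_all add: c)
qed

lemma (in fd_algebra) finite_length_enveloping_algebra:
  "finite_length (enveloping_algebra k A) (regular_module (enveloping_algebra k A))"
proof -
  interpret E: two_algebras k A "op_ring A"
    using fd_algebra_op_ring fd_algebra_axioms by (simp add: two_algebras_def)
  show ?thesis unfolding enveloping_algebra_def by (rule E.finite_length_tensor_algebra)
qed

lemma singular_equivalence_sym:
  "singular_equivalence k A B l M N \<Longrightarrow> singular_equivalence k B A l N M"
  unfolding singular_equivalence_def by blast

lemma singular_equivalence_bimodule_pair:
  assumes "fd_algebra k A" "fd_algebra k B" "singular_equivalence k A B l M N"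
  shows "bimodule_pair k A B M N"
  using assms unfolding singular_equivalence_def by (simp add: bimodule_pair_def)

context bimodule_pair begin

lemma fg_projective_SU:
  assumes "singular_equivalence k A B l M N"
  shows "fg_projective Be SU.E"
  unfolding enveloping_algebra_def
  by (rule SU.fg_projective_E) (use assms in \<open>auto simp: singular_equivalence_def intro: projective_imp_fg_projective\<close>)

lemma fg_projective_RV:
  assumes "singular_equivalence k A B l M N"
  shows "fg_projective (op_ring Ae) RV.E"
proof (rule fg_projective_ring_cong[OF _ ring_op_ring[OF ring_Ae]])
  show "fg_projective RV.TA RV.E"
    by (rule RV.fg_projective_E) (use assms in \<open>auto simp: singular_equivalence_def intro: projective_imp_fg_projective\<close>)
qed (use A.op_enveloping_algebra_simps A.op_enveloping_algebra in auto)

text \<open>For \<open>n = 0\<close> this is the stable isomorphism that belongs to the singular equivalence. The step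
  compares the image under \<open>F\<close> of a projective cover of \<open>\<Omega>\<^sup>n(A)\<close> with a projective cover of
  \<open>\<Omega>\<^sup>n\<^sup>+\<^sup>l(B)\<close>.\<close>

theorem F_syzygy:
  assumes eq: "singular_equivalence k A B l M N"
    and W: "syzygy_sequence Ae (algebra_module k A) W" and V: "syzygy_sequence Be (algebra_module k B) V"
  shows "stable_equiv Be (TF.F (W n)) (V (n + l))"
proof -
  interpret W: syzygy_sequence Ae "algebra_module k A" W by fact
  interpret V: syzygy_sequence Be "algebra_module k B" V by fact
  show ?thesis
  proof (induction n)
    case 0
    have 1: "mod_iso Be (TF.F (W 0)) (enveloping_module k B (tensor_bimodule A N M))"
      by (rule mod_iso_trans[OF TF.F_mod_iso[OF mod_iso_sym[OF W.start]] F_algebra_module])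
    have "stably_iso_syzygy k B l (tensor_bimodule A N M)" using eq by (simp add: singular_equivalence_def)
    then obtain Y :: "(('b \<times> 'b \<Rightarrow>\<^sub>0 int) set, nat \<Rightarrow> ('b \<times> 'b \<Rightarrow>\<^sub>0 int) set) module" where
      Y: "nth_syzygy Be l (algebra_module k B) Y" "stably_iso Be (enveloping_module k B (tensor_bimodule A N M)) Y"
      unfolding stably_iso_syzygy_def by (elim exE conjE) (rule that)
    have "stable_equiv Be Y (V l)"
      using Y(1) unfolding V.nth_syzygy_iff by (rule mod_iso_imp_stable_equiv[OF mod_iso_sym])
    from stable_equiv_trans[OF stable_equiv_trans[OF mod_iso_imp_stable_equiv[OF 1] stably_iso_imp_stable_equiv[OF Y(2)]] this]
    show ?case by simp
  next
    case (Suc n)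
    obtain P :: "(('a \<times> 'a \<Rightarrow>\<^sub>0 int) set, nat \<Rightarrow> ('a \<times> 'a \<Rightarrow>\<^sub>0 int) set) module" and i p where
      1: "short_exact Ae (W (Suc n)) P (W n) i p" "fg_projective Ae P" "short_exact.superfluous Ae (W (Suc n)) P i"
      by (rule syzygy_short_exact[OF W.step W.fg]) (rule that)
    obtain P' :: "(('b \<times> 'b \<Rightarrow>\<^sub>0 int) set, nat \<Rightarrow> ('b \<times> 'b \<Rightarrow>\<^sub>0 int) set) module" and i' p' where
      2: "short_exact Be (V (Suc (n + l))) P' (V (n + l)) i' p'" "fg_projective Be P'" "short_exact.superfluous Be (V (Suc (n + l))) P' i'"
      by (rule syzygy_short_exact[OF V.step V.fg]) (rule that)
    show ?case
      using short_exact_stable_equiv[OF TF.F_short_exact[OF fg_projective_RV[OF eq] 1(1)] 2(1)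
          TF.F_fg_projective[OF fg_projective_SU[OF eq] 1(2)] 2(2) Suc] by simp
  qed
qed

lemma syzygy_iso_transfer:
  assumes eq: "singular_equivalence k A B l M N"
    and W: "syzygy_sequence Ae (algebra_module k A) W" and V: "syzygy_sequence Be (algebra_module k B) V"
    and iso: "mod_iso Ae (W m) (W n)"
  shows "mod_iso Be (V (Suc (m + l))) (V (Suc (n + l)))"
proof -
  note F = F_syzygy[OF eq W V]
  have "stable_equiv Be (V (m + l)) (V (n + l))"
    by (rule stable_equiv_trans[OF stable_equiv_trans[OF stable_equiv_sym[OF F] mod_iso_imp_stable_equiv[OF TF.F_mod_iso[OF iso]]] F])
  then show ?thesis by (rule syzygy_sequence.stable_shift[OF V])
qed

text \<open>A zero module is sent to zero, so the corresponding syzygy of \<open>B\<close> is stably zero, that is,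
  projective, and the next one vanishes.\<close>

lemma syzygy_zero_transfer:
  assumes eq: "singular_equivalence k A B l M N"
    and W: "syzygy_sequence Ae (algebra_module k A) W" and V: "syzygy_sequence Be (algebra_module k B) V"
    and zero: "carrier (W n) = {\<zero>\<^bsub>W n\<^esub>}"
  shows "carrier (V (Suc (n + l))) = {\<zero>\<^bsub>V (Suc (n + l))\<^esub>}"
proof -
  have "fg_projective Be (V (n + l))"
    by (rule stable_equiv_zero_fg_projective[OF stable_equiv_sym[OF F_syzygy[OF eq W V]]
          TF.F_zero[OF syzygy_sequence.W_left_module[OF W] zero]])
  then show ?thesis by (rule syzygy_sequence.fg_projective_next_zero[OF V])
qed

lemma syzygy_period_transfer:
  assumes eq: "singular_equivalence k A B l M N"
    and W: "syzygy_sequence Ae (algebra_module k A) W" and V: "syzygy_sequence Be (algebra_module k B) V"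
    and p: "mod_iso Ae (W n) (W (n + p))" and q: "mod_iso Be (V m) (V (m + q))" "q > 0"
  shows "mod_iso Be (V m) (V (m + p))"
proof -
  interpret V: syzygy_sequence Be "algebra_module k B" V by fact
  \<comment> \<open>The transferred isomorphism is available from degree \<open>n + l + 1\<close> on, so \<open>m\<close> is first moved up
    by a multiple of \<open>q\<close> that reaches this degree.\<close>
  define i where "i = m + Suc (n + l) * q - Suc (n + l)"
  have "Suc (n + l) \<le> Suc (n + l) * q" using q(2) by (cases q) simp_all
  then have i: "Suc (n + l) + i = m + Suc (n + l) * q" unfolding i_def by linarith
  have e: "Suc (n + p + l) + i = m + Suc (n + l) * q + p" using i by linarith
  have 1: "mod_iso Be (V (m + Suc (n + l) * q)) (V (m + Suc (n + l) * q + p))"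
    using V.shift[OF syzygy_iso_transfer[OF eq W V p], of i] by (simp only: i e)
  have 2: "mod_iso Be (V m) (V (m + Suc (n + l) * q))" by (rule V.shift_mult[OF q(1)])
  show ?thesis
    by (rule mod_iso_trans[OF mod_iso_trans[OF 2 1] mod_iso_sym[OF V.shift[OF 2]]])
qed

end

theorem theorem3p6:
  fixes k :: "('k, 'u) ring_scheme"
    and \<Lambda> :: "('k, 'a, 'v) module_scheme" and \<Gamma> :: "('k, 'b, 'w) module_scheme"
  assumes "field k" and "fd_algebra k \<Lambda>" and "fd_algebra k \<Gamma>"
    and "\<exists>l (M :: ('a, 'b, 'm) bimodule) (N :: ('b, 'a, 'n) bimodule).
           singular_equivalence k \<Lambda> \<Gamma> l M N"
    and "eventually_periodic_algebra k \<Lambda>"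
  shows "eventually_periodic_algebra k \<Gamma> \<and>
    (\<forall>n m (Y :: (('a \<times> 'a \<Rightarrow>\<^sub>0 int) set, 'y) module) (Z :: (('b \<times> 'b \<Rightarrow>\<^sub>0 int) set, 'z) module).
       nth_syzygy (enveloping_algebra k \<Lambda>) n (algebra_module k \<Lambda>) Y \<and>
       periodic (enveloping_algebra k \<Lambda>) Y \<and>
       nth_syzygy (enveloping_algebra k \<Gamma>) m (algebra_module k \<Gamma>) Z \<and>
       periodic (enveloping_algebra k \<Gamma>) Z \<longrightarrow>
       period (enveloping_algebra k \<Lambda>) Y = period (enveloping_algebra k \<Gamma>) Z)"
proof -
  let ?L = "enveloping_algebra k \<Lambda>" and ?G = "enveloping_algebra k \<Gamma>"
  obtain l and M :: "('a, 'b, 'm) bimodule" and N :: "('b, 'a, 'n) bimodule" where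
    eq: "singular_equivalence k \<Lambda> \<Gamma> l M N" using assms(4) by blast
  note eq' = singular_equivalence_sym[OF eq]
  note pair = singular_equivalence_bimodule_pair[OF assms(2,3) eq]
  note pair' = singular_equivalence_bimodule_pair[OF assms(3,2) eq']
  note L = fd_algebra.algebra_module_fin_gen[OF assms(2)] fd_algebra.finite_length_enveloping_algebra[OF assms(2)]
  note G = fd_algebra.algebra_module_fin_gen[OF assms(3)] fd_algebra.finite_length_enveloping_algebra[OF assms(3)]
  obtain n0 p0 and Y0 :: "(('a \<times> 'a \<Rightarrow>\<^sub>0 int) set, nat \<Rightarrow> ('a \<times> 'a \<Rightarrow>\<^sub>0 int) set) module" where
    Y0: "nth_syzygy ?L n0 (algebra_module k \<Lambda>) Y0" "carrier Y0 \<noteq> {\<zero>\<^bsub>Y0\<^esub>}" "nth_syzygy ?L p0 Y0 Y0" "p0 > 0"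
    using assms(5) unfolding eventually_periodic_algebra_def eventually_periodic_def periodic_def by blast
  obtain W where W: "syzygy_sequence ?L (algebra_module k \<Lambda>) W"
    using syzygy_sequence_exists[OF L(2,1) Y0(1)] by blast
  have "stably_iso_syzygy k \<Gamma> l (tensor_bimodule \<Lambda> N M)" using eq by (simp add: singular_equivalence_def)
  then obtain Z0 :: "(('b \<times> 'b \<Rightarrow>\<^sub>0 int) set, nat \<Rightarrow> ('b \<times> 'b \<Rightarrow>\<^sub>0 int) set) module" where
    "nth_syzygy ?G l (algebra_module k \<Gamma>) Z0"
    unfolding stably_iso_syzygy_def by (elim exE conjE) (rule that)
  then obtain V where V: "syzygy_sequence ?G (algebra_module k \<Gamma>) V"
    using syzygy_sequence_exists[OF G(2,1)] by blast
  interpret W: syzygy_sequence ?L "algebra_module k \<Lambda>" W by (rule W)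
  interpret V: syzygy_sequence ?G "algebra_module k \<Gamma>" V by (rule V)
  have n0: "mod_iso ?L (W n0) Y0" using Y0(1) by (simp only: W.nth_syzygy_iff)
  have p0: "mod_iso ?L (W n0) (W (n0 + p0))" using Y0(3) by (simp only: W.nth_syzygy_self_iff[OF n0])
  \<comment> \<open>One degree beyond the stable isomorphism, where it has become an isomorphism.\<close>
  define m0 where "m0 = Suc (n0 + l)"
  have q0: "mod_iso ?G (V m0) (V (m0 + p0))"
    using bimodule_pair.syzygy_iso_transfer[OF pair eq W V p0] by (simp add: m0_def add.commute add.left_commute)
  have nonzero: "carrier (V m0) \<noteq> {\<zero>\<^bsub>V m0\<^esub>}"
  proof
    assume "carrier (V m0) = {\<zero>\<^bsub>V m0\<^esub>}"
    from bimodule_pair.syzygy_zero_transfer[OF pair' eq' V W this]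
    have z: "carrier (W (Suc (m0 + l))) = {\<zero>\<^bsub>W (Suc (m0 + l))\<^esub>}" .
    \<comment> \<open>Periodicity moves the vanishing syzygy down to degree \<open>n0\<close>.\<close>
    have "Suc (m0 + l) \<le> n0 + Suc (m0 + l) * p0" using Y0(4) by (cases p0) simp_all
    then have "carrier (W (n0 + Suc (m0 + l) * p0)) = {\<zero>\<^bsub>W (n0 + Suc (m0 + l) * p0)\<^esub>}"
      using W.zero_shift[OF z, of "n0 + Suc (m0 + l) * p0 - Suc (m0 + l)"] by (simp only: le_add_diff_inverse)
    from mod_iso_zero[OF mod_iso_trans[OF mod_iso_sym[OF W.shift_mult[OF p0]] n0] this] Y0(2) show False by blast
  qed
  have "nth_syzygy ?G p0 (V m0) (V m0)"
    unfolding V.nth_syzygy_self_iff[OF mod_iso_refl[OF V.W_left_module]] by (rule q0)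
  then have "periodic ?G (V m0)"
    unfolding periodic_def using Y0(4) by (intro exI[of _ p0] conjI)
  moreover have "nth_syzygy ?G m0 (algebra_module k \<Gamma>) (V m0)"
    unfolding V.nth_syzygy_iff by (rule mod_iso_refl[OF V.W_left_module])
  ultimately have "eventually_periodic_algebra k \<Gamma>"
    unfolding eventually_periodic_algebra_def eventually_periodic_def
    by (intro exI[of _ m0] exI[of _ "V m0"] conjI nonzero)
  moreover have "period ?L Y = period ?G Z"
    if Y: "nth_syzygy ?L n (algebra_module k \<Lambda>) Y" "periodic ?L Y"
      and Z: "nth_syzygy ?G m (algebra_module k \<Gamma>) Z" "periodic ?G Z"
    for n m and Y :: "(('a \<times> 'a \<Rightarrow>\<^sub>0 int) set, 'y) module" and Z :: "(('b \<times> 'b \<Rightarrow>\<^sub>0 int) set, 'z) module"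
  proof -
    have WY: "mod_iso ?L (W n) Y" using Y(1) by (simp only: W.nth_syzygy_iff)
    have VZ: "mod_iso ?G (V m) Z" using Z(1) by (simp only: V.nth_syzygy_iff)
    note WY' = W.nth_syzygy_self_iff[OF WY] and VZ' = V.nth_syzygy_self_iff[OF VZ]
    obtain p where p: "p > 0" "mod_iso ?L (W n) (W (n + p))" using Y(2) unfolding periodic_def WY' by blast
    obtain q where q: "q > 0" "mod_iso ?G (V m) (V (m + q))" using Z(2) unfolding periodic_def VZ' by blast
    have "mod_iso ?L (W n) (W (n + r)) \<longleftrightarrow> mod_iso ?G (V m) (V (m + r))" for r
      using bimodule_pair.syzygy_period_transfer[OF pair eq W V _ q(2,1), of n r]
        bimodule_pair.syzygy_period_transfer[OF pair' eq' V W _ p(2,1), of m r] by blast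
    then show ?thesis unfolding period_def WY' VZ' by simp
  qed
  ultimately show ?thesis by blast
qed

end
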